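(* Let $G$ be a bipartite subcubic graph. If every connected component of $G$ is isomorphic to the Heawood graph, then $R(G)=\lambda_h(G)=|\lambda_\ell(G)|=\sqrt{2}$. In any other case, the median eigenvalues $\lambda_h(G)$ and $\lambda_\ell(G)$ are contained in the interval $[-1,1]$, i.e., $R(G)\le 1$.
   Context: Graphs are finite, simple, unweighted, undirected, of order $n\ge 1$, and not necessarily connected. A graph is subcubic if its maximum degree is at most $3$. For a graph $G$ of order $n$, $\lambda_1(G)\ge\lambda_2(G)\ge\cdots\ge\lambda_n(G)$ denote the eigenvalues of its adjacency matrix, listed with multiplicity. Put $h=\lfloor\frac{n+1}{2}\rfloor$ and $\ell=\lceil\frac{n+1}{2}\rceil$; the eigenvalues $\lambda_h(G)$ and $\lambda_\ell(G)$ are called the median eigenvalues of $G$, and the HL-index of $G$ is $R(G)=\max\{|\lambda_h(G)|,|\lambda_\ell(G)|\}$. The Heawood graph is the bipartite incidence graph of points and lines of the Fano plane (14 vertices). *)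

theory Defs
  imports
    Complex_Main
    "Graph_Theory.Digraph_Isomorphism"
    "Jordan_Normal_Form.Char_Poly"
begin

text \<open>
  A finite simple undirected graph is an instance of the locale \<^locale>\<open>graph\<close>: a finite, symmetric
  digraph without loops and parallel arcs.  Each undirected edge is represented by a pair of
  opposite arcs, so the degree of a vertex is its out-degree, and the connected components are the
  strongly connected components \<^const>\<open>pre_digraph.sccs\<close>.
\<close>

definition subcubic :: "('a, 'b) pre_digraph \<Rightarrow> bool" where
  "subcubic G \<longleftrightarrow> (\<forall>v\<in>verts G. out_degree G v \<le> 3)"

definition bipartite :: "('a, 'b) pre_digraph \<Rightarrow> bool" where
  "bipartite G \<longleftrightarrow> (\<exists>X Y. verts G = X \<union> Y \<and> X \<inter> Y = {} \<and>
     (\<forall>e\<in>arcs G. (tail G e \<in> X \<and> head G e \<in> Y) \<or> (tail G e \<in> Y \<and> head G e \<in> X)))"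


section \<open>Adjacency spectrum\<close>

text \<open>The adjacency matrix with respect to an enumeration \<open>vs\<close> of the vertices.\<close>

definition adjacency_matrix :: "('a, 'b) pre_digraph \<Rightarrow> 'a list \<Rightarrow> real mat" where
  "adjacency_matrix G vs =
     mat (length vs) (length vs) (\<lambda>(i, j). if vs ! i \<rightarrow>\<^bsub>G\<^esub> vs ! j then 1 else 0)"

text \<open>
  The real roots of the characteristic polynomial with multiplicity, in non-increasing order.  The
  choice of the enumeration is immaterial (\<open>spectrum_eq\<close>), and since the matrix is symmetric, all
  the roots are real (\<open>length_graph_spectrum\<close>).
\<close>

definition graph_spectrum :: "('a, 'b) pre_digraph \<Rightarrow> real list" where
  "graph_spectrum G = rev (sorted_list_of_multiset (proots (char_poly
     (adjacency_matrix G (SOME vs. distinct vs \<and> set vs = verts G)))))"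

text \<open>The eigenvalues are numbered from 1.\<close>

definition graph_eigenvalue :: "('a, 'b) pre_digraph \<Rightarrow> nat \<Rightarrow> real" where
  "graph_eigenvalue G k = graph_spectrum G ! (k - 1)"

definition lower_median :: "nat \<Rightarrow> nat" where
  "lower_median n = nat \<lfloor>(real n + 1) / 2\<rfloor>"

definition upper_median :: "nat \<Rightarrow> nat" where
  "upper_median n = nat \<lceil>(real n + 1) / 2\<rceil>"

definition lambda_h :: "('a, 'b) pre_digraph \<Rightarrow> real" where
  "lambda_h G = graph_eigenvalue G (lower_median (card (verts G)))"

definition lambda_l :: "('a, 'b) pre_digraph \<Rightarrow> real" where
  "lambda_l G = graph_eigenvalue G (upper_median (card (verts G)))"

definition HL_index :: "('a, 'b) pre_digraph \<Rightarrow> real" where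
  "HL_index G = max \<bar>lambda_h G\<bar> \<bar>lambda_l G\<bar>"

lemma char_poly_adjacency_cong:
  assumes "distinct vs" "distinct ws" "set vs = set ws"
  shows "char_poly (adjacency_matrix G vs) = char_poly (adjacency_matrix G ws)"
proof -
  let ?n = "length ws"
  have len: "length vs = ?n"
    using assms by (metis distinct_card)
  define P where "P = mat ?n ?n (\<lambda>(i, j). if vs ! i = ws ! j then 1 else 0 :: real)"
  define Q where "Q = mat ?n ?n (\<lambda>(i, j). if ws ! i = vs ! j then 1 else 0 :: real)"
  have car: "P \<in> carrier_mat ?n ?n" "Q \<in> carrier_mat ?n ?n"
    "adjacency_matrix G vs \<in> carrier_mat ?n ?n" "adjacency_matrix G ws \<in> carrier_mat ?n ?n"
    by (auto simp: P_def Q_def adjacency_matrix_def len)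
  have ex: "\<exists>!j. j < ?n \<and> ws ! j = vs ! i" if "i < ?n" for i
    using that assms len by (metis in_set_conv_nth nth_eq_iff_index_eq)
  have ex': "\<exists>!j. j < ?n \<and> vs ! j = ws ! i" if "i < ?n" for i
    using that assms len by (metis in_set_conv_nth nth_eq_iff_index_eq)
  have selP: "(\<Sum>k<?n. (if vs ! i = ws ! k then 1 else 0) * f k) = f j"
    if "i < ?n" "j < ?n" "ws ! j = vs ! i" for i j and f :: "nat \<Rightarrow> real"
  proof -
    have "vs ! i = ws ! k \<longleftrightarrow> k = j" if "k < ?n" for k
      using ex[OF \<open>i < ?n\<close>] that \<open>j < ?n\<close> \<open>ws ! j = vs ! i\<close> by metis
    then have "(\<Sum>k<?n. (if vs ! i = ws ! k then 1 else 0) * f k) =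
               (\<Sum>k<?n. if k = j then f k else 0)"
      by (intro sum.cong) auto
    then show ?thesis using that by simp
  qed
  have selQ: "(\<Sum>k<?n. (if ws ! i = vs ! k then 1 else 0) * f k) = f j"
    if "i < ?n" "j < ?n" "vs ! j = ws ! i" for i j and f :: "nat \<Rightarrow> real"
  proof -
    have "ws ! i = vs ! k \<longleftrightarrow> k = j" if "k < ?n" for k
      using ex'[OF \<open>i < ?n\<close>] that \<open>j < ?n\<close> \<open>vs ! j = ws ! i\<close> by metis
    then have "(\<Sum>k<?n. (if ws ! i = vs ! k then 1 else 0) * f k) =
               (\<Sum>k<?n. if k = j then f k else 0)"
      by (intro sum.cong) auto
    then show ?thesis using that by simp
  qed
  have multP: "(P * B) $$ (i, j) = B $$ (i', j)"
    if "B \<in> carrier_mat ?n ?n" "i < ?n" "j < ?n" "i' < ?n" "ws ! i' = vs ! i" for B i j i'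
  proof -
    have "(P * B) $$ (i, j) = (\<Sum>k<?n. (if vs ! i = ws ! k then 1 else 0) * B $$ (k, j))"
      using that by (auto simp: P_def scalar_prod_def lessThan_atLeast0 intro!: sum.cong)
    with selP[of i i' "\<lambda>k. B $$ (k, j)"] that show ?thesis by simp
  qed
  have multQ: "(Q * B) $$ (i, j) = B $$ (i', j)"
    if "B \<in> carrier_mat ?n ?n" "i < ?n" "j < ?n" "i' < ?n" "vs ! i' = ws ! i" for B i j i'
  proof -
    have "(Q * B) $$ (i, j) = (\<Sum>k<?n. (if ws ! i = vs ! k then 1 else 0) * B $$ (k, j))"
      using that by (auto simp: Q_def scalar_prod_def lessThan_atLeast0 intro!: sum.cong)
    with selQ[of i i' "\<lambda>k. B $$ (k, j)"] that show ?thesis by simp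
  qed
  have PQ: "P * Q = 1\<^sub>m ?n"
  proof (rule eq_matI)
    fix i j assume ij: "i < dim_row (1\<^sub>m ?n :: real mat)" "j < dim_col (1\<^sub>m ?n :: real mat)"
    then obtain i' where i': "i' < ?n" "ws ! i' = vs ! i" using ex[of i] by auto
    have "(P * Q) $$ (i, j) = Q $$ (i', j)" using ij i' car by (intro multP) auto
    also have "\<dots> = (1\<^sub>m ?n) $$ (i, j)"
      using ij i' assms(1) len by (auto simp: Q_def nth_eq_iff_index_eq)
    finally show "(P * Q) $$ (i, j) = (1\<^sub>m ?n) $$ (i, j)" .
  qed (use car in auto)
  have QP: "Q * P = 1\<^sub>m ?n"
    using PQ car mat_mult_left_right_inverse by blast
  have "P * adjacency_matrix G ws = adjacency_matrix G vs * P"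
  proof (rule eq_matI)
    fix i j assume "i < dim_row (adjacency_matrix G vs * P)" "j < dim_col (adjacency_matrix G vs * P)"
    then have ij: "i < ?n" "j < ?n" using car by auto
    obtain i' where i': "i' < ?n" "ws ! i' = vs ! i" using ex[of i] ij by auto
    obtain j' where j': "j' < ?n" "vs ! j' = ws ! j" using ex'[of j] ij by auto
    have "(adjacency_matrix G vs * P) $$ (i, j) =
        (\<Sum>k<?n. (if ws ! j = vs ! k then 1 else 0) * adjacency_matrix G vs $$ (i, k))"
      using ij car
      by (auto simp: P_def scalar_prod_def lessThan_atLeast0 intro!: sum.cong)
    also have "\<dots> = adjacency_matrix G vs $$ (i, j')"
      using selQ[of j j'] ij j' by auto
    also have "\<dots> = adjacency_matrix G ws $$ (i', j)"
      using ij i' j' len by (auto simp: adjacency_matrix_def)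
    also have "\<dots> = (P * adjacency_matrix G ws) $$ (i, j)"
      using ij i' car by (intro multP[symmetric]) auto
    finally show "(P * adjacency_matrix G ws) $$ (i, j) = (adjacency_matrix G vs * P) $$ (i, j)" ..
  qed (use car in auto)
  then have "P * adjacency_matrix G ws * Q = adjacency_matrix G vs * (P * Q)"
    using car assoc_mult_mat by metis
  also have "\<dots> = adjacency_matrix G vs" using PQ car by simp
  finally have "similar_mat (adjacency_matrix G vs) (adjacency_matrix G ws)"
    using car PQ QP by (intro similar_matI[of _ _ P Q ?n]) auto
  then show ?thesis by (rule char_poly_similar)
qed

lemma spectrum_eq:
  assumes "distinct vs" "set vs = verts G"
  shows "graph_spectrum G =
           rev (sorted_list_of_multiset (proots (char_poly (adjacency_matrix G vs))))"
proof -
  have "distinct (SOME vs. distinct vs \<and> set vs = verts G) \<and>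
        set (SOME vs. distinct vs \<and> set vs = verts G) = verts G"
    using assms by (intro someI[of "\<lambda>vs. distinct vs \<and> set vs = verts G" vs]) auto
  then show ?thesis
    unfolding graph_spectrum_def using assms by (metis char_poly_adjacency_cong)
qed

lemma symmetric_real_eigenvalue_real:
  fixes A :: "real mat"
  assumes A: "A \<in> carrier_mat n n"
    and sym: "\<And>i j. i < n \<Longrightarrow> j < n \<Longrightarrow> A $$ (i, j) = A $$ (j, i)"
    and ev: "eigenvalue (map_mat complex_of_real A) a"
  shows "a \<in> \<real>"
proof -
  let ?A = "map_mat complex_of_real A"
  obtain v where v: "v \<in> carrier_vec n" "v \<noteq> 0\<^sub>v n" "?A *\<^sub>v v = a \<cdot>\<^sub>v v"
    using ev A unfolding eigenvalue_def eigenvector_def by auto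
  have row: "(\<Sum>j<n. of_real (A $$ (i, j)) * v $ j) = a * v $ i" if "i < n" for i
  proof -
    have "(?A *\<^sub>v v) $ i = (\<Sum>j<n. of_real (A $$ (i, j)) * v $ j)"
      using A v(1) that by (auto simp: scalar_prod_def lessThan_atLeast0 intro!: sum.cong)
    then show ?thesis using v that by simp
  qed
  define s where "s = (\<Sum>i<n. v $ i * cnj (v $ i))"
  have s_eq: "s = of_real (\<Sum>i<n. (cmod (v $ i))\<^sup>2)"
    by (simp add: s_def complex_norm_square del: of_real_power)
  obtain i where "i < n" "v $ i \<noteq> 0"
    using v(1,2) by (metis carrier_vecD eq_vecI index_zero_vec)
  then have "(\<Sum>i<n. (cmod (v $ i))\<^sup>2) > 0"
    by (intro sum_pos2[of _ i]) auto
  then have "s \<noteq> 0" unfolding s_eq of_real_eq_0_iff by linarith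
  have "a * s = (\<Sum>i<n. (\<Sum>j<n. of_real (A $$ (i, j)) * v $ j) * cnj (v $ i))"
    unfolding s_def sum_distrib_left by (intro sum.cong) (auto simp: row)
  also have "\<dots> = (\<Sum>i<n. \<Sum>j<n. of_real (A $$ (i, j)) * v $ j * cnj (v $ i))"
    by (simp add: sum_distrib_right)
  also have "\<dots> = (\<Sum>j<n. \<Sum>i<n. of_real (A $$ (i, j)) * v $ j * cnj (v $ i))"
    by (rule sum.swap)
  also have "\<dots> = (\<Sum>j<n. v $ j * cnj (\<Sum>i<n. of_real (A $$ (j, i)) * v $ i))"
    by (auto simp: sum_distrib_left sym intro!: sum.cong)
  also have "\<dots> = cnj a * s"
    unfolding s_def sum_distrib_left by (intro sum.cong) (auto simp: row)
  finally have "a = cnj a" using \<open>s \<noteq> 0\<close> by simp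
  then show ?thesis by (metis Reals_cnj_iff)
qed

lemma size_proots_symmetric:
  fixes A :: "real mat"
  assumes A: "A \<in> carrier_mat n n"
    and sym: "\<And>i j. i < n \<Longrightarrow> j < n \<Longrightarrow> A $$ (i, j) = A $$ (j, i)"
  shows "size (proots (char_poly A)) = n"
proof -
  interpret h: map_poly_comm_ring_hom complex_of_real ..
  let ?A = "map_mat complex_of_real A"
  have car: "?A \<in> carrier_mat n n" using A by auto
  obtain as where as: "char_poly ?A = (\<Prod>a\<leftarrow>as. [:- a, 1:])" "length as = n"
    using char_poly_factorized[OF car] by blast
  have real: "a \<in> \<real>" if "a \<in> set as" for a
  proof -
    have "poly (char_poly ?A) a = 0"
      unfolding as(1) using that by (auto simp: poly_prod_list prod_list_zero_iff)
    then have "eigenvalue ?A a" using eigenvalue_root_char_poly[OF car] by simp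
    then show ?thesis using symmetric_real_eigenvalue_real[OF A sym] by blast
  qed
  have re: "(\<Prod>a\<leftarrow>xs. [:- a, 1:]) = map_poly complex_of_real (\<Prod>a\<leftarrow>map Re xs. [:- a, 1:])"
    if "\<forall>a\<in>set xs. a \<in> \<real>" for xs
    using that
  proof (induction xs)
    case (Cons x xs)
    then have "[:- x, 1:] = map_poly complex_of_real [:- Re x, 1:]"
      by (auto elim!: Reals_cases)
    then show ?case using Cons by (simp add: h.hom_mult del: mult_pCons_left)
  qed simp
  have "map_poly complex_of_real (char_poly A) =
        map_poly complex_of_real (\<Prod>a\<leftarrow>map Re as. [:- a, 1:])"
    using re[of as] real as(1) by (simp add: of_real_hom.char_poly_hom[OF A, symmetric])
  then have "char_poly A = (\<Prod>a\<leftarrow>map Re as. [:- a, 1:])"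
    by (simp add: poly_eq_iff coeff_map_poly)
  moreover have "size (proots (\<Prod>a\<leftarrow>xs. [:- a, 1:])) = length xs" for xs :: "real list"
  proof (induction xs)
    case (Cons x xs)
    have nz: "(\<Prod>a\<leftarrow>xs. [:- a, 1:]) \<noteq> 0" by (auto simp: prod_list_zero_iff)
    have "size (proots ([:- x, 1:] * (\<Prod>a\<leftarrow>xs. [:- a, 1:]))) = Suc (length xs)"
      using Cons nz by (subst proots_mult) auto
    then show ?case by simp
  qed simp
  ultimately show ?thesis using as(2) by (metis length_map)
qed

lemma length_graph_spectrum:
  assumes "graph G"
  shows "length (graph_spectrum G) = card (verts G)"
proof -
  interpret graph G by fact
  obtain vs where vs: "distinct vs" "set vs = verts G"
    using finite_distinct_list[OF finite_verts] by blast
  have "size (proots (char_poly (adjacency_matrix G vs))) = length vs"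
    using arcs_ends_symmetric[OF sym_arcs]
    by (intro size_proots_symmetric) (auto simp: adjacency_matrix_def)
  then show ?thesis
    using vs spectrum_eq[OF vs] distinct_card[OF vs(1)]
    by (metis length_rev mset_sorted_list_of_multiset size_mset)
qed

lemma sorted_graph_spectrum: "sorted (rev (graph_spectrum G))"
  by (simp add: graph_spectrum_def)


section \<open>The Heawood graph\<close>

text \<open>
  The Fano plane in its cyclic presentation: the lines are the translates of the perfect difference
  set \<open>{0, 1, 3}\<close> modulo 7.
\<close>

definition fano_points :: "nat set" where
  "fano_points = {0..<7}"

definition fano_lines :: "nat set set" where
  "fano_lines = (\<lambda>i. {i, (i + 1) mod 7, (i + 3) mod 7}) ` {0..<7}"

definition heawood_graph :: "(nat + nat set) pair_pre_digraph" where
  "heawood_graph = \<lparr> pverts = fano_points <+> fano_lines,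
     parcs = {(Inl p, Inr L) | p L. p \<in> fano_points \<and> L \<in> fano_lines \<and> p \<in> L} \<union>
             {(Inr L, Inl p) | p L. p \<in> fano_points \<and> L \<in> fano_lines \<and> p \<in> L} \<rparr>"

lemma fano_lines_eq:
  "fano_lines = {{0,1,3}, {1,2,4}, {2,3,5}, {3,4,6}, {4,5,0}, {5,6,1}, {6,0,2}}"
proof -
  have "{0..<7} = {0, 1, 2, 3, 4, 5, 6 :: nat}" by auto
  then show ?thesis unfolding fano_lines_def by (simp add: numeral_2_eq_2)
qed

lemma fano_plane:
  shows "card fano_points = 7" "card fano_lines = 7"
    and "L \<in> fano_lines \<Longrightarrow> L \<subseteq> fano_points \<and> card L = 3"
    and "\<lbrakk>p \<in> fano_points; q \<in> fano_points; p \<noteq> q\<rbrakk> \<Longrightarrow> \<exists>!L. L \<in> fano_lines \<and> p \<in> L \<and> q \<in> L"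
    and "\<lbrakk>L \<in> fano_lines; M \<in> fano_lines; L \<noteq> M\<rbrakk> \<Longrightarrow> \<exists>!p. p \<in> L \<and> p \<in> M"
proof -
  have pts: "fano_points = {0, 1, 2, 3, 4, 5, 6}" unfolding fano_points_def by auto
  show "card fano_points = 7" by (simp add: fano_points_def)
  show "card fano_lines = 7" unfolding fano_lines_eq by code_simp
  show "L \<in> fano_lines \<Longrightarrow> L \<subseteq> fano_points \<and> card L = 3"
    unfolding fano_lines_eq pts by auto
  show "\<exists>!L. L \<in> fano_lines \<and> p \<in> L \<and> q \<in> L"
    if pq: "p \<in> fano_points" "q \<in> fano_points" "p \<noteq> q"
  proof -
    have "\<forall>p\<in>fano_points. \<forall>q\<in>fano_points. p \<noteq> q \<longrightarrow>
      (\<exists>L\<in>fano_lines. p \<in> L \<and> q \<in> L \<and>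
        (\<forall>M\<in>fano_lines. p \<in> M \<longrightarrow> q \<in> M \<longrightarrow> M = L))"
      unfolding fano_lines_eq pts by code_simp
    then show ?thesis using pq by metis
  qed
  show "\<exists>!p. p \<in> L \<and> p \<in> M"
    if LM: "L \<in> fano_lines" "M \<in> fano_lines" "L \<noteq> M"
  proof -
    have "\<forall>L\<in>fano_lines. \<forall>M\<in>fano_lines. L \<noteq> M \<longrightarrow>
      (\<exists>p\<in>L. p \<in> M \<and> (\<forall>q\<in>L. q \<in> M \<longrightarrow> q = p))"
      unfolding fano_lines_eq by code_simp
    then show ?thesis using LM by metis
  qed
qed

lemma graph_heawood: "graph (with_proj heawood_graph)"
proof -
  let ?V = "fano_points <+> fano_lines"
  have fin: "finite ?V"
    by (auto simp: fano_points_def fano_lines_def)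
  have "parcs heawood_graph \<subseteq> ?V \<times> ?V"
    by (auto simp: heawood_graph_def)
  then have "finite (parcs heawood_graph)"
    using fin finite_subset by blast
  with fin show ?thesis
    by unfold_locales
       (auto simp: heawood_graph_def arc_to_ends_def symmetric_def sym_def)
qed

lemma card_heawood: "card (verts (with_proj heawood_graph)) = 14"
  using fano_plane(1,2) by (auto simp: heawood_graph_def card_Plus_conv_if fano_points_def fano_lines_def)

end

theory Submission
  imports Defs "HOL-Library.Function_Algebras" "HOL-Analysis.Function_Topology"
begin

text \<open>
  Let \<open>A\<close> be the adjacency operator of the bipartite graph \<open>G\<close>.  Changing the sign on one side of the
  bipartition turns \<open>A\<close> into \<open>- A\<close>, so the spectrum is symmetric about 0.  Hence
  \<open>lambda_l G = - lambda_h G\<close>, and \<open>lambda_h G\<close> is the least modulus of an eigenvalue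
  (\<open>bipartite_median_eigenvalue\<close>).  By Rayleigh's principle, applied to \<open>A\<^sup>2\<close>, it is at most \<open>s\<close> as soon
  as one nonzero vector satisfies \<open>\<parallel>A x\<parallel> \<le> s \<parallel>x\<parallel>\<close> (\<open>small_eigenvalue_exists\<close>).  This reduces the bound
  \<open>lambda_h G \<le> 1\<close> to a vector with \<open>\<parallel>A x\<parallel> \<le> \<parallel>x\<parallel>\<close> that is supported on one side of one component.

  Take a component, call its two sides points and lines, and suppose that no such vector exists on
  either side.  Then \<open>B x x = \<parallel>A x\<parallel>\<^sup>2 - \<parallel>x\<parallel>\<^sup>2\<close> is a positive definite integral quadratic form on the
  integer vectors over the points, and likewise over the lines.  Testing it on vectors with at most
  four nonzero entries shows that two points lie on at most one common line, and that every point
  lies on exactly three lines and vice versa (\<open>card_lines_of_point\<close>).  So the unit vectors of the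
  points have norm 2, and two of them have product 1 or 0 according to whether the points are
  collinear: they are linearly independent roots that span an irreducible root lattice whose rank is
  the number of points.

  The main tool is \<open>D4_classes_card_le_8\<close>: if this lattice contains a root system of type \<open>D4\<close> and two
  further roots in different nontrivial classes of the dual lattice of \<open>D4\<close> modulo \<open>D4\<close>, then it
  contains \<open>E6\<close>, which an irreducible root lattice can extend only to \<open>E7\<close> and \<open>E8\<close>; so there are at
  most 8 points.  If two neighbours of a point \<open>v\<close> are not collinear, the points near \<open>v\<close> always
  provide such a configuration, or else a vector on which a form is not positive
  (\<open>card_le_8_if_nonadjacent_neighbours\<close>).  Therefore there are at most 8 points or collinearity is
  transitive.  Since each point is collinear with exactly 6 others, both cases force 7 pairwise
  collinear points (\<open>all_collinear\<close>), that is, the Fano plane (\<open>fano_coordinates\<close>), and the component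
  is the Heawood graph.

  For the Heawood graph itself, \<open>\<parallel>A x\<parallel>\<^sup>2\<close> is \<open>2 \<parallel>x\<parallel>\<^sup>2\<close> plus the squares of the two sums of \<open>x\<close> over the points
  and over the lines (\<open>heawood_energy\<close>).  So \<open>\<parallel>A x\<parallel> \<ge> sqrt 2 \<parallel>x\<parallel>\<close>, with equality when both sums vanish,
  and the least modulus of an eigenvalue is \<open>sqrt 2\<close>.
\<close>

section \<open>Integral quadratic forms and root systems\<close>

text \<open>
  Fewer equations than unknowns: Gaussian elimination without division, which keeps the solution
  integral.  One equation is used to eliminate an unknown \<open>a\<close> with nonzero coefficient.
\<close>

lemma homogeneous_system_solution:
  fixes \<phi> :: "'e \<Rightarrow> 'p \<Rightarrow> int"
  assumes "finite E" "finite P" "card E < card P"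
  shows "\<exists>x. (\<exists>p\<in>P. x p \<noteq> 0) \<and> (\<forall>p. p \<notin> P \<longrightarrow> x p = 0) \<and> (\<forall>i\<in>E. (\<Sum>p\<in>P. \<phi> i p * x p) = 0)"
  using assms
proof (induction E arbitrary: P \<phi> rule: finite_induct)
  case empty
  then obtain p where "p \<in> P" by fastforce
  then show ?case by (intro exI[of _ "\<lambda>q. if q = p then 1 else 0"]) auto
next
  case (insert i E)
  show ?case
  proof (cases "\<forall>p\<in>P. \<phi> i p = 0")
    case True
    moreover have "card E < card P" using insert.prems(2) insert.hyps by simp
    then obtain x where "\<exists>p\<in>P. x p \<noteq> 0" "\<forall>p. p \<notin> P \<longrightarrow> x p = 0"
        "\<forall>i\<in>E. (\<Sum>p\<in>P. \<phi> i p * x p) = 0"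
      using insert.IH[of P \<phi>] insert.prems(1) by blast
    ultimately show ?thesis by (intro exI[of _ x]) simp
  next
    case False
    then obtain a where a: "a \<in> P" "\<phi> i a \<noteq> 0" by blast
    let ?P = "P - {a}" and ?\<psi> = "\<lambda>j p. \<phi> i a * \<phi> j p - \<phi> j a * \<phi> i p"
    have "card E < card ?P" using insert a by simp
    then obtain y where y: "\<exists>p\<in>?P. y p \<noteq> 0" "\<forall>p. p \<notin> ?P \<longrightarrow> y p = 0"
        "\<forall>j\<in>E. (\<Sum>p\<in>?P. ?\<psi> j p * y p) = 0"
      using insert.IH[of ?P ?\<psi>] insert.prems by auto
    define s where "s = (\<Sum>p\<in>?P. \<phi> i p * y p)"
    define x where "x p = (if p = a then - s else \<phi> i a * y p)" for p
    have sum_x: "(\<Sum>p\<in>P. \<phi> j p * x p) = (\<Sum>p\<in>?P. ?\<psi> j p * y p)" for j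
    proof -
      have "(\<Sum>p\<in>P. \<phi> j p * x p) = - \<phi> j a * s + (\<Sum>p\<in>?P. \<phi> j p * (\<phi> i a * y p))"
        using a insert.prems by (simp add: sum.remove[of P a] x_def)
      also have "\<dots> = (\<Sum>p\<in>?P. ?\<psi> j p * y p)"
        unfolding s_def sum_distrib_left sum.distrib[symmetric]
        by (intro sum.cong) (simp_all add: algebra_simps)
      finally show ?thesis .
    qed
    have "\<exists>p\<in>P. x p \<noteq> 0" using y(1) a by (auto simp: x_def)
    moreover have "x p = 0" if "p \<notin> P" for p using that y(2) a(1) by (auto simp: x_def)
    moreover have "(\<Sum>p\<in>P. \<phi> j p * x p) = 0" if "j \<in> insert i E" for j
      using that y(3) unfolding sum_x by auto
    ultimately show ?thesis by blast
  qed
qed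

text \<open>
  The Gram matrix of the simple roots of a simply laced Dynkin diagram with three branches.  Node 0 is the
  branching node, and the entry \<open>i > 0\<close> of the list is the node to which node \<open>i\<close> is attached: 1, 2 and 3
  to the branching node, then 4 to 1, 5 to 2, 6 to 4 and 7 to 6.  The first 4, 5, 6, 7, 8 nodes form the
  diagrams \<open>D4\<close>, \<open>D5\<close>, \<open>E6\<close>, \<open>E7\<close>, \<open>E8\<close>.
\<close>

definition E_gram :: "nat \<Rightarrow> nat \<Rightarrow> int" where
  "E_gram i j = (if i = j then 2
     else if 0 < max i j \<and> [0,0,0,0,1,2,4,6] ! max i j = min i j then - 1 else 0)"

text \<open>
  The coefficients, in the simple roots, of the sum of all positive roots of the diagram with \<open>k\<close>
  nodes.  What matters is that its product with every simple root is 2.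
\<close>

definition E_height :: "nat \<Rightarrow> int list" where
  "E_height k = [[10, 6, 6, 6], [18, 14, 10, 10, 8], [42, 30, 30, 22, 16, 16],
     [96, 75, 66, 49, 52, 34, 27], [270, 220, 182, 136, 168, 92, 114, 58]] ! (k - 4)"

text \<open>
  The coefficients of the highest root of the diagram with \<open>k\<close> nodes.
\<close>

definition E_highest :: "nat \<Rightarrow> int list" where
  "E_highest k = [[2, 1, 1, 1], [2, 2, 1, 1, 1], [3, 2, 2, 2, 1, 1],
     [4, 3, 3, 2, 2, 2, 1], [6, 5, 4, 3, 4, 2, 3, 2]] ! (k - 4)"

lemma upto_numeral: "{..<8::nat} = {0,1,2,3,4,5,6,7}" "{..<7::nat} = {0,1,2,3,4,5,6}" "{..<6::nat} = {0,1,2,3,4,5}"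
  "{..<5::nat} = {0,1,2,3,4}" "{..<4::nat} = {0,1,2,3}"
  by auto

lemma E_tables:
  assumes "k \<in> {4..8}"
  shows "\<forall>i<k. (\<Sum>j<k. E_gram i j * E_height k ! j) = 2"
    and "(\<Sum>i<k. E_highest k ! i * (\<Sum>j<k. E_gram i j * E_highest k ! j)) = 2"
    and "\<forall>i<k. E_highest k ! i \<ge> 0"
    and "length (E_highest k) = k"
proof -
  have "k = 4 \<or> k = 5 \<or> k = 6 \<or> k = 7 \<or> k = 8" using assms by auto
  then have "(\<forall>i\<in>{..<k}. (\<Sum>j<k. E_gram i j * E_height k ! j) = 2) \<and>
     (\<Sum>i<k. E_highest k ! i * (\<Sum>j<k. E_gram i j * E_highest k ! j)) = 2 \<and>
     (\<forall>i\<in>{..<k}. E_highest k ! i \<ge> 0) \<and> length (E_highest k) = k"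
    by (elim disjE) (simp_all add: upto_numeral E_gram_def E_height_def E_highest_def)
  then show "\<forall>i<k. (\<Sum>j<k. E_gram i j * E_height k ! j) = 2"
    "(\<Sum>i<k. E_highest k ! i * (\<Sum>j<k. E_gram i j * E_highest k ! j)) = 2"
    "\<forall>i<k. E_highest k ! i \<ge> 0"
    "length (E_highest k) = k" by auto
qed

text \<open>
  The vectors are the integral functions on \<open>P\<close> and the form is given by its Gram matrix \<open>K\<close>.  The
  vectors are functions on the whole type, so a vector counts as nonzero only if it is nonzero somewhere
  on \<open>P\<close>.
\<close>

locale positive_form =
  fixes P :: "'p set" and K :: "'p \<Rightarrow> 'p \<Rightarrow> int"
  assumes finite_P: "finite P"
    and K_sym: "K p q = K q p"
    and pos: "p \<in> P \<Longrightarrow> x p \<noteq> 0 \<Longrightarrow> 0 < (\<Sum>p\<in>P. \<Sum>q\<in>P. K p q * x p * x q)"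
begin

definition B :: "('p \<Rightarrow> int) \<Rightarrow> ('p \<Rightarrow> int) \<Rightarrow> int" where
  "B x y = (\<Sum>p\<in>P. \<Sum>q\<in>P. K p q * x p * y q)"

definition e :: "'p \<Rightarrow> 'p \<Rightarrow> int" where
  "e p q = (if q = p then 1 else 0)"

definition comb :: "int list \<Rightarrow> ('p \<Rightarrow> int) list \<Rightarrow> 'p \<Rightarrow> int" where
  "comb c us p = (\<Sum>i<length us. c ! i * (us ! i) p)"

lemma B_sym: "B x y = B y x"
  unfolding B_def by (subst sum.swap) (simp add: K_sym mult_ac)

lemma B_left: "B (x + y) z = B x z + B y z" "B (x - y) z = B x z - B y z" "B (- x) z = - B x z" "B 0 z = 0"
  by (simp_all add: B_def algebra_simps sum.distrib sum_subtractf sum_negf)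

lemma B_right: "B z (x + y) = B z x + B z y" "B z (x - y) = B z x - B z y" "B z (- x) = - B z x" "B z 0 = 0"
  by (simp_all add: B_def algebra_simps sum.distrib sum_subtractf sum_negf)

lemmas B_simps = B_left B_right

lemma B_comb: "B z (comb c us) = (\<Sum>i<length us. c ! i * B z (us ! i))"
proof -
  have "B z (comb c us) = (\<Sum>p\<in>P. \<Sum>q\<in>P. \<Sum>i<length us. c ! i * (K p q * z p * (us ! i) q))"
    by (simp add: B_def comb_def sum_distrib_left mult_ac)
  also have "\<dots> = (\<Sum>p\<in>P. \<Sum>i<length us. \<Sum>q\<in>P. c ! i * (K p q * z p * (us ! i) q))"
    by (intro sum.cong refl sum.swap)
  also have "\<dots> = (\<Sum>i<length us. \<Sum>p\<in>P. \<Sum>q\<in>P. c ! i * (K p q * z p * (us ! i) q))"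
    by (rule sum.swap)
  finally show ?thesis by (simp add: B_def sum_distrib_left)
qed

lemma B_e: "p \<in> P \<Longrightarrow> q \<in> P \<Longrightarrow> B (e p) (e q) = K p q"
  using finite_P by (simp add: B_def e_def if_distrib[of "\<lambda>x. _ * x"] cong: if_cong)

lemma B_e_right: "B x y = (\<Sum>p\<in>P. y p * B x (e p))"
proof -
  have "(\<Sum>p\<in>P. y p * B x (e p)) = (\<Sum>p\<in>P. y p * (\<Sum>q\<in>P. K q p * x q))"
    using finite_P by (simp add: B_def e_def if_distrib[of "\<lambda>x. _ * x"] cong: if_cong)
  also have "\<dots> = (\<Sum>p\<in>P. \<Sum>q\<in>P. K q p * x q * y p)"
    by (simp add: sum_distrib_left mult_ac)
  also have "\<dots> = B x y" unfolding B_def by (rule sum.swap)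
  finally show ?thesis by simp
qed

lemma B_nonneg: "B x x \<ge> 0"
proof (cases "\<exists>p\<in>P. x p \<noteq> 0")
  case True
  then show ?thesis using pos[of _ x] by (auto simp: B_def intro: less_imp_le)
qed (auto simp: B_def)

text \<open>
  A nonzero product with some vector is the convenient certificate that a vector is nonzero on \<open>P\<close>.
\<close>

lemma B_pos: "B x y \<noteq> 0 \<Longrightarrow> 0 < B x x"
proof -
  assume "B x y \<noteq> 0"
  then have "\<exists>p\<in>P. x p \<noteq> 0" by (force simp: B_def intro!: sum.neutral)
  then show ?thesis using pos[of _ x] by (auto simp: B_def)
qed

lemma B_pos_point: "p \<in> P \<Longrightarrow> x p \<noteq> 0 \<Longrightarrow> 0 < B x x"
  using pos[of p x] by (simp add: B_def)

definition E_diagram :: "('p \<Rightarrow> int) list \<Rightarrow> bool" where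
  "E_diagram us \<longleftrightarrow> (\<forall>i<length us. \<forall>j<length us. B (us ! i) (us ! j) = E_gram i j)"

lemma E_diagram_snoc:
  assumes us: "E_diagram us" and z: "B z z = 2"
    and zi: "\<And>i. i < length us \<Longrightarrow> B z (us ! i) = E_gram (length us) i"
  shows "E_diagram (us @ [z])"
proof -
  have sym: "E_gram i j = E_gram j i" for i j by (simp add: E_gram_def max.commute min.commute)
  have diag: "E_gram i i = 2" for i by (simp add: E_gram_def)
  have zi': "B (us ! i) z = E_gram i (length us)" if "i < length us" for i
    using zi[OF that] by (simp add: B_sym[of "us ! i"] sym)
  show ?thesis
    using us z zi zi' diag unfolding E_diagram_def
    by (auto simp: nth_append less_Suc_eq)
qed

text \<open>
  Reflecting a root \<open>z\<close> in simple roots that have positive product with it changes \<open>z\<close> only by the lattice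
  \<open>\<Lambda>\<close> of the simple roots and ends in a root \<open>y\<close> with nonpositive product with all of them; the product
  with the sum of the positive roots decreases in each step and is bounded below.  Such a \<open>y\<close> cannot have product
  \<open>-2\<close> with the highest root \<open>\<theta>\<close>, since \<open>y + \<theta>\<close> would have norm 0.  This leaves very few possibilities for the
  products of \<open>y\<close> with the simple roots, and each of them extends the diagram.
  
  The pair \<open>N\<close>, \<open>x\<close> certifies that \<open>z\<close> is not in \<open>\<Lambda>\<close>: a congruence modulo \<open>N\<close> holds on \<open>\<Lambda>\<close> and fails
  for \<open>z\<close>.  With \<open>N = 0\<close> it says that \<open>x\<close> is orthogonal to \<open>\<Lambda>\<close> but not to \<open>z\<close>.
\<close>

lemma antidominant_root:
  assumes us: "E_diagram us" "length us \<in> {4..8}"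
    and z: "B z z = 2" and wit: "\<not> N dvd B z x" "\<And>u. u \<in> set us \<Longrightarrow> N dvd B u x"
  shows "\<exists>y. B y y = 2 \<and> (\<forall>i<length us. B y (us ! i) \<le> 0) \<and>
    (\<Sum>i<length us. E_highest (length us) ! i * B y (us ! i)) \<ge> - 1 \<and>
    (\<forall>M w. (\<forall>u\<in>set us. M dvd B u w) \<longrightarrow> M dvd B z w - B y w) \<and>
    ((\<exists>u\<in>set us. B z u \<noteq> 0) \<longrightarrow> (\<exists>u\<in>set us. B y u \<noteq> 0))"
proof -
  define \<delta> where "\<delta> = comb (E_height (length us)) us"
  define \<theta> where "\<theta> = comb (E_highest (length us)) us"
  have u: "B u u = 2" "B u \<delta> = 2" if u: "u \<in> set us" for u
  proof -
    obtain i where i: "i < length us" "u = us ! i" using u by (metis in_set_conv_nth)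
    show "B u u = 2" using us(1) i by (simp add: E_diagram_def E_gram_def)
    show "B u \<delta> = 2" using us(1) i E_tables(1)[OF us(2)]
      by (simp add: \<delta>_def B_comb E_diagram_def mult.commute)
  qed
  define ok where "ok y \<longleftrightarrow> B y y = 2 \<and> 
    (\<forall>M w. (\<forall>u\<in>set us. M dvd B u w) \<longrightarrow> M dvd B z w - B y w) \<and>
    ((\<exists>u\<in>set us. B z u \<noteq> 0) \<longrightarrow> (\<exists>u\<in>set us. B y u \<noteq> 0))" for y
  have ok_wit: "\<not> N dvd B y x" if "ok y" for y
  proof
    assume "N dvd B y x"
    moreover have "N dvd B z x - B y x" using that wit(2) unfolding ok_def by blast
    ultimately show False using wit(1) by (metis diff_add_cancel dvd_add)
  qed
  have pos: "0 < B (y + v) (y + v)" if "ok y" "N dvd B v x" for y v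
  proof (rule B_pos)
    show "B (y + v) x \<noteq> 0"
      using ok_wit[OF that(1)] that(2) by (metis B_left(1) add_diff_cancel_right' dvd_0_right dvd_diff)
  qed
  have "\<exists>y. ok y \<and> (\<forall>u\<in>set us. B y u \<le> 0)" if "ok y" for y
    using that
  proof (induction "nat (B y \<delta> + B \<delta> \<delta> + 2)" arbitrary: y rule: less_induct)
    case less
    show ?case
    proof (cases "\<forall>u\<in>set us. B y u \<le> 0")
      case False
      then obtain v where v: "v \<in> set us" "B y v > 0" by force
      have "0 < B (y + (- v)) (y + (- v))"
        using wit(2)[OF v(1)] by (intro pos[OF less.prems]) (simp add: B_simps)
      then have y1: "B y v = 1"
        using v less.prems u(1)[OF v(1)] by (simp add: ok_def B_simps B_sym[of v y])
      have "ok (y - v)" unfolding ok_def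
      proof (intro conjI allI impI)
        show "B (y - v) (y - v) = 2"
          using y1 less.prems u(1)[OF v(1)] by (simp add: ok_def B_simps B_sym[of v y])
        show "M dvd B z w - B (y - v) w" if "\<forall>u\<in>set us. M dvd B u w" for M w
        proof -
          have "M dvd B z w - B y w" "M dvd B v w" using that less.prems v(1) by (auto simp: ok_def)
          then have "M dvd (B z w - B y w) + B v w" by (rule dvd_add)
          then show ?thesis by (simp add: B_simps algebra_simps)
        qed
        have "B (y - v) v \<noteq> 0" using y1 u(1)[OF v(1)] by (simp add: B_simps)
        then show "\<exists>u\<in>set us. B (y - v) u \<noteq> 0" using v(1) by blast
      qed
      moreover have "0 \<le> B (y + \<delta>) (y + \<delta>)" by (rule B_nonneg)
      then have "0 \<le> 2 + 2 * B y \<delta> + B \<delta> \<delta>"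
        using less.prems by (simp add: ok_def B_simps B_sym[of \<delta> y])
      then have "nat (B (y - v) \<delta> + B \<delta> \<delta> + 2) < nat (B y \<delta> + B \<delta> \<delta> + 2)"
        using u(2)[OF v(1)] B_nonneg[of \<delta>] by (simp add: B_simps)
      ultimately show ?thesis using less.hyps by blast
    qed (use less.prems in blast)
  qed
  moreover have "ok z" using z by (simp add: ok_def)
  ultimately obtain y where y: "ok y" "\<forall>u\<in>set us. B y u \<le> 0" by blast
  have "B \<theta> (us ! i) = (\<Sum>j<length us. E_gram i j * E_highest (length us) ! j)" if "i < length us" for i
    using us(1) that by (simp add: \<theta>_def B_sym[of _ "us ! i"] B_comb E_diagram_def mult.commute)
  then have "(\<Sum>i<length us. E_highest (length us) ! i * B \<theta> (us ! i)) =
      (\<Sum>i<length us. E_highest (length us) ! i * (\<Sum>j<length us. E_gram i j * E_highest (length us) ! j))"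
    by simp
  also have "(\<Sum>i<length us. E_highest (length us) ! i * B \<theta> (us ! i)) = B \<theta> \<theta>"
    using B_comb[of \<theta> "E_highest (length us)" us] by (simp flip: \<theta>_def)
  finally have \<theta>\<theta>: "B \<theta> \<theta> = 2" using E_tables(2)[OF us(2)] by simp
  have "N dvd B x \<theta>" unfolding \<theta>_def B_comb
    using wit(2) by (intro dvd_sum dvd_mult) (simp add: B_sym[of x])
  then have "N dvd B \<theta> x" by (simp add: B_sym[of \<theta>])
  then have "0 < B (y + \<theta>) (y + \<theta>)" using y(1) by (intro pos) 
  then have "B y \<theta> \<ge> - 1"
    using y(1) \<theta>\<theta> by (simp add: ok_def B_simps B_sym[of \<theta> y])
  then show ?thesis using y unfolding ok_def \<theta>_def B_comb by (intro exI[of _ y]) auto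
qed


lemma E_diagram_list:
  "E_diagram us \<longleftrightarrow> (\<forall>i\<in>{..<length us}. \<forall>j\<in>{..<length us}. B (us ! i) (us ! j) = E_gram i j)"
  by (auto simp: E_diagram_def)

lemma E_diagram_4:
  "E_diagram [c, l1, l2, l3] \<longleftrightarrow>
     B c c = 2 \<and> B l1 l1 = 2 \<and> B l2 l2 = 2 \<and> B l3 l3 = 2 \<and>
     B c l1 = - 1 \<and> B c l2 = - 1 \<and> B c l3 = - 1 \<and> B l1 l2 = 0 \<and> B l1 l3 = 0 \<and> B l2 l3 = 0"
  unfolding E_diagram_list
  by (simp add: lessThan_Suc E_gram_def B_sym[of l1 c] B_sym[of l2 c] B_sym[of l3 c]
      B_sym[of l2 l1] B_sym[of l3 l1] B_sym[of l3 l2] conj_ac)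

lemma E_diagram_5:
  "E_diagram [c, l1, l2, l3, m] \<longleftrightarrow> E_diagram [c, l1, l2, l3] \<and>
     B m m = 2 \<and> B m c = 0 \<and> B m l1 = - 1 \<and> B m l2 = 0 \<and> B m l3 = 0"
  unfolding E_diagram_list
  by (simp add: lessThan_Suc E_gram_def B_sym[of c m] B_sym[of l1 m] B_sym[of l2 m] B_sym[of l3 m])
     blast

text \<open>
  The parity hypotheses say that \<open>z\<close> is in the nontrivial class of the dual lattice that belongs to the leg
  \<open>l1\<close>.  The antidominant root in its class is joined to \<open>l1\<close> only, because the highest root of \<open>D4\<close> is
  \<open>2 c + l1 + l2 + l3\<close>.
\<close>

lemma D4_extend:
  assumes us: "E_diagram [c, l1, l2, l3]"
    and z: "B z z = 2" "odd (B z l1 + B z l2)" "even (B z l2 + B z l3)"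
  obtains y where "E_diagram [c, l1, l2, l3, y]"
proof -
  let ?us = "[c, l1, l2, l3]"
  have ev: "2 dvd B u (l1 + l2)" "2 dvd B u (l2 + l3)" if "u \<in> set ?us" for u
    using us that unfolding E_diagram_4
    by (auto simp: B_simps B_sym[of l1 c] B_sym[of l2 c] B_sym[of l3 c]
        B_sym[of l2 l1] B_sym[of l3 l1] B_sym[of l3 l2])
  have nz: "\<not> 2 dvd B z (l1 + l2)" using z(2) by (simp add: B_simps)
  have len: "length ?us \<in> {4..8}" by simp
  obtain y where y: "B y y = 2" "\<forall>i<length ?us. B y (?us ! i) \<le> 0"
    "(\<Sum>i<length ?us. E_highest (length ?us) ! i * B y (?us ! i)) \<ge> - 1"
    and y': "\<forall>M w. (\<forall>u\<in>set ?us. M dvd B u w) \<longrightarrow> M dvd B z w - B y w"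
    using antidominant_root[OF us len z(1) nz ev(1)] by blast
  have y'': "2 dvd B z (l1 + l2) - B y (l1 + l2)" "2 dvd B z (l2 + l3) - B y (l2 + l3)"
    using y'[rule_format, OF ev(1)] y'[rule_format, OF ev(2)] by blast+
  have "B y c \<le> 0" "B y l1 \<le> 0" "B y l2 \<le> 0" "B y l3 \<le> 0"
    using y(2)[rule_format, of 0] y(2)[rule_format, of 1] y(2)[rule_format, of 2]
      y(2)[rule_format, of 3] by simp_all
  moreover have "2 * B y c + B y l1 + B y l2 + B y l3 \<ge> - 1"
    using y(3) by (simp add: lessThan_Suc E_highest_def)
  moreover have "odd (B y l1 + B y l2)" "even (B y l2 + B y l3)"
    using y'' z(2,3) by (simp_all add: B_simps)
  moreover from this have "B y l1 + B y l2 \<noteq> 0" "B y l2 + B y l3 \<noteq> - 1"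
    by (metis dvd_0_right, metis even_minus odd_one)
  ultimately have "B y c = 0" "B y l1 = - 1" "B y l2 = 0" "B y l3 = 0"
    by linarith+
  then have "E_diagram (?us @ [y])"
    using us y(1) by (intro E_diagram_snoc) (auto simp: E_gram_def less_Suc_eq)
  then show ?thesis using that by simp
qed

text \<open>
  The highest root \<open>2 c + 2 l1 + l2 + l3 + m\<close> of \<open>D5\<close> has coefficient 1 at the three ends of the diagram, so an
  antidominant root is joined to at most one end.  The parity hypothesis, which singles out the spinor classes, forces
  \<open>l2\<close> or \<open>l3\<close>, and both give \<open>E6\<close>.
\<close>

lemma D5_extend:
  assumes us: "E_diagram [c, l1, l2, l3, m]"
    and z: "B z z = 2" "odd (B z l2 + B z l3)"
  obtains us where "E_diagram us" "length us = 6"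
proof -
  let ?us = "[c, l1, l2, l3, m]"
  have ev: "2 dvd B u (l2 + l3)" if "u \<in> set ?us" for u
    using us that unfolding E_diagram_5 E_diagram_4
    by (auto simp: B_simps B_sym[of l1 c] B_sym[of l2 c] B_sym[of l3 c]
        B_sym[of l2 l1] B_sym[of l3 l1] B_sym[of l3 l2])
  have nz: "\<not> 2 dvd B z (l2 + l3)" using z(2) by (simp add: B_simps)
  have len: "length ?us \<in> {4..8}" by simp
  obtain y where y: "B y y = 2" "\<forall>i<length ?us. B y (?us ! i) \<le> 0"
    "(\<Sum>i<length ?us. E_highest (length ?us) ! i * B y (?us ! i)) \<ge> - 1"
    and y': "\<forall>M w. (\<forall>u\<in>set ?us. M dvd B u w) \<longrightarrow> M dvd B z w - B y w"
    using antidominant_root[OF us len z(1) nz ev] by blast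
  have y'': "2 dvd B z (l2 + l3) - B y (l2 + l3)"
    using y'[rule_format, OF ev] by blast
  have le: "B y c \<le> 0" "B y l1 \<le> 0" "B y l2 \<le> 0" "B y l3 \<le> 0" "B y m \<le> 0"
    using y(2)[rule_format, of 0] y(2)[rule_format, of 1] y(2)[rule_format, of 2]
      y(2)[rule_format, of 3] y(2)[rule_format, of 4] by simp_all
  have sum: "2 * B y c + 2 * B y l1 + B y l2 + B y l3 + B y m \<ge> - 1"
    using y(3) by (simp add: lessThan_Suc E_highest_def)
  have odd: "odd (B y l2 + B y l3)"
    using y'' z(2) by (simp add: B_simps)
  have "B y l2 + B y l3 \<noteq> 0" using odd by (metis dvd_0_right)
  then have 0: "B y c = 0" "B y l1 = 0" "B y m = 0"
    using le sum by linarith+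
  have "B y l2 = - 1 \<and> B y l3 = 0 \<or> B y l2 = 0 \<and> B y l3 = - 1"
    using le sum \<open>B y l2 + B y l3 \<noteq> 0\<close> by linarith
  then show ?thesis
  proof
    assume "B y l2 = - 1 \<and> B y l3 = 0"
    with 0 have "E_diagram (?us @ [y])"
      using us y(1) by (intro E_diagram_snoc) (auto simp: E_gram_def less_Suc_eq)
    then show ?thesis by (rule that) simp
  next
    assume l: "B y l2 = 0 \<and> B y l3 = - 1"
    have "E_diagram [c, l1, l3, l2, m]"
      using us unfolding E_diagram_5 E_diagram_4 by (simp add: B_sym[of l3 l2])
    with 0 l have "E_diagram ([c, l1, l3, l2, m] @ [y])"
      using us y(1) by (intro E_diagram_snoc) (auto simp: E_gram_def less_Suc_eq)
    then show ?thesis by (rule that) simp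
  qed
qed

end

text \<open>
  The unit vectors of \<open>P\<close> are roots, and the graph of nonzero products between them is connected.
\<close>

locale connected_positive_form = positive_form +
  assumes connected: "S \<subseteq> P \<Longrightarrow> S \<noteq> {} \<Longrightarrow> (\<And>p q. p \<in> S \<Longrightarrow> q \<in> P \<Longrightarrow> K p q \<noteq> 0 \<Longrightarrow> q \<in> S) \<Longrightarrow> S = P"
    and K_diag: "p \<in> P \<Longrightarrow> K p p = 2"
begin

text \<open>
  Some unit vector lies neither in the span of \<open>us\<close> nor in its orthogonal complement.  As there are more points than
  vectors in \<open>us\<close>, some \<open>x \<noteq> 0\<close> is orthogonal to \<open>us\<close>, so not every unit vector is in the span; not every one is in
  the complement either.  If each unit vector were in one of the two, the points would fall into two parts
  without products between them.
\<close>

lemma independent_point: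
  assumes "length us < card P" "u \<in> set us" "B u u \<noteq> 0"
  obtains a x where "a \<in> P" "\<And>u. u \<in> set us \<Longrightarrow> B u x = 0" "B (e a) x \<noteq> 0"
    "\<exists>u\<in>set us. B (e a) u \<noteq> 0"
proof -
  let ?T = "{p \<in> P. \<exists>u\<in>set us. B (e p) u \<noteq> 0}"
  let ?R = "{p \<in> P. \<exists>x. (\<forall>u\<in>set us. B u x = 0) \<and> B (e p) x \<noteq> 0}"
  have "card (set us) < card P" using assms(1) card_length[of us] by linarith
  then obtain x where x: "\<exists>p\<in>P. x p \<noteq> 0" "\<forall>u\<in>set us. (\<Sum>p\<in>P. B u (e p) * x p) = 0"
    using homogeneous_system_solution[of "set us" P "\<lambda>u p. B u (e p)"] finite_P by auto
  have x0: "\<forall>u\<in>set us. B u x = 0"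
    using x(2) by (simp add: B_e_right[of _ x] mult.commute)
  have "B x x \<noteq> 0" using x(1) B_pos_point by force
  then obtain p where p: "p \<in> P" "B x (e p) \<noteq> 0"
    unfolding B_e_right[of x x] by (metis (no_types, lifting) mult_zero_right sum.neutral)
  then have pR: "p \<in> ?R" using x0 by (auto simp: B_sym[of "e p"])
  have "?T \<noteq> {}"
  proof -
    obtain p where "p \<in> P" "B u (e p) \<noteq> 0"
      using assms(3) unfolding B_e_right[of u u] by (metis (no_types, lifting) mult_zero_right sum.neutral)
    then show ?thesis using assms(2) by (auto simp: B_sym[of u])
  qed
  have "?T \<inter> ?R \<noteq> {}"
  proof
    assume disj: "?T \<inter> ?R = {}"
    \<comment> \<open>A neighbour \<open>b\<close> of \<open>a\<close> outside \<open>?T\<close> would itself be a vector that is orthogonal to \<open>us\<close> but not to \<open>a\<close>.\<close>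
    have "?T = P"
    proof (rule connected)
      fix a b assume ab: "a \<in> ?T" "b \<in> P" "K a b \<noteq> 0"
      show "b \<in> ?T"
      proof (rule ccontr)
        assume "b \<notin> ?T"
        then have "\<forall>u\<in>set us. B u (e b) = 0" using ab(2) by (auto simp: B_sym[of _ "e b"])
        moreover have "B (e a) (e b) \<noteq> 0" using ab by (simp add: B_e)
        ultimately have "a \<in> ?R" using ab(1) by blast
        then show False using ab(1) disj by blast
      qed
    qed (use \<open>?T \<noteq> {}\<close> in auto)
    then show False using disj pR p(1) by blast
  qed
  then show ?thesis using that by blast
qed

text \<open>
  An antidominant root outside the span is joined to exactly one node at which the highest root has
  coefficient 1.  For \<open>E6\<close> these are the ends of the two long legs, for \<open>E7\<close> the end of the longest leg, and for \<open>E8\<close>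
  there is none.  So with more than 8 points the diagram could be extended from \<open>E6\<close> through \<open>E7\<close> and \<open>E8\<close>
  to a contradiction.
\<close>

lemma E6_card_le_8:
  assumes "E_diagram us" "length us = 6"
  shows "card P \<le> 8"
proof (rule ccontr)
  assume P9: "\<not> card P \<le> 8"
  have step: "\<exists>y. B y y = 2 \<and> (\<forall>i<length us. B y (us ! i) \<le> 0) \<and>
      (\<Sum>i<length us. E_highest (length us) ! i * B y (us ! i)) \<ge> - 1 \<and> (\<exists>i<length us. B y (us ! i) \<noteq> 0)"
    if us: "E_diagram us" "length us \<in> {6..8}" for us
  proof -
    have len: "0 < length us" "length us < card P" and len': "length us \<in> {4..8}"
      using us(2) P9 by auto
    have "us ! 0 \<in> set us" using len by simp
    moreover have "B (us ! 0) (us ! 0) \<noteq> 0" using us(1) len by (simp add: E_diagram_def E_gram_def)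
    ultimately obtain a x where "a \<in> P" "\<And>u. u \<in> set us \<Longrightarrow> B u x = 0" "B (e a) x \<noteq> 0"
        "\<exists>u\<in>set us. B (e a) u \<noteq> 0"
      using independent_point[OF len(2)] by metis
    then have "\<exists>y. B y y = 2 \<and> (\<forall>i<length us. B y (us ! i) \<le> 0) \<and>
        (\<Sum>i<length us. E_highest (length us) ! i * B y (us ! i)) \<ge> - 1 \<and> (\<exists>u\<in>set us. B y u \<noteq> 0)"
      using antidominant_root[OF us(1) len', of "e a" 0 x] by (simp add: B_e K_diag) blast
    then show ?thesis unfolding Bex_def in_set_conv_nth by blast
  qed
  obtain c l1 l2 l3 m1 m2 where us: "us = [c, l1, l2, l3, m1, m2]"
    using assms(2) by (auto simp: numeral_eq_Suc length_Suc_conv)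
  obtain y where y: "B y y = 2" "\<forall>i<6. B y (us ! i) \<le> 0"
      "(\<Sum>i<6. E_highest 6 ! i * B y (us ! i)) \<ge> - 1" "\<exists>i\<in>{..<6}. B y (us ! i) \<noteq> 0"
    using step[of us] assms by auto
  have le: "B y c \<le> 0" "B y l1 \<le> 0" "B y l2 \<le> 0" "B y l3 \<le> 0" "B y m1 \<le> 0" "B y m2 \<le> 0"
    using y(2)[rule_format, of 0] y(2)[rule_format, of 1] y(2)[rule_format, of 2]
      y(2)[rule_format, of 3] y(2)[rule_format, of 4] y(2)[rule_format, of 5] by (simp_all add: us)
  have "3 * B y c + 2 * B y l1 + 2 * B y l2 + 2 * B y l3 + B y m1 + B y m2 \<ge> - 1"
    using y(3) by (simp add: us upto_numeral E_highest_def)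
  moreover have "B y c \<noteq> 0 \<or> B y l1 \<noteq> 0 \<or> B y l2 \<noteq> 0 \<or> B y l3 \<noteq> 0 \<or> B y m1 \<noteq> 0 \<or> B y m2 \<noteq> 0"
    using y(4) by (simp add: us upto_numeral)
  ultimately have 0: "B y c = 0" "B y l1 = 0" "B y l2 = 0" "B y l3 = 0"
      "B y m1 = - 1 \<and> B y m2 = 0 \<or> B y m1 = 0 \<and> B y m2 = - 1"
    using le by linarith+
  have "\<exists>us. E_diagram us \<and> length us = 7"
    using 0(5)
  proof
    assume "B y m1 = - 1 \<and> B y m2 = 0"
    with 0 have "E_diagram (us @ [y])"
      using assms y(1) by (intro E_diagram_snoc) (auto simp: us E_gram_def less_Suc_eq)
    then show ?thesis by (intro exI[of _ "us @ [y]"]) (simp add: us)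
  next
    assume m: "B y m1 = 0 \<and> B y m2 = - 1"
    have "E_diagram [c, l2, l1, l3, m2, m1]"
      using assms by (simp add: us E_diagram_list lessThan_Suc E_gram_def)
    with 0 m have "E_diagram ([c, l2, l1, l3, m2, m1] @ [y])"
      using y(1) by (intro E_diagram_snoc) (auto simp: E_gram_def less_Suc_eq)
    then show ?thesis by (intro exI[of _ "[c, l2, l1, l3, m2, m1] @ [y]"]) simp
  qed
  then obtain us where us: "E_diagram us" "length us = 7" by blast
  obtain y where y: "B y y = 2" "\<forall>i\<in>{..<7}. B y (us ! i) \<le> 0"
      "(\<Sum>i<7. E_highest 7 ! i * B y (us ! i)) \<ge> - 1" "\<exists>i\<in>{..<7}. B y (us ! i) \<noteq> 0"
    using step[of us] us by auto
  have "B y (us ! 6) = - 1" "\<forall>i\<in>{..<6}. B y (us ! i) = 0"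
    using y(2-4) by (simp_all add: upto_numeral E_highest_def)
  then have "E_diagram (us @ [y])"
    using us y(1) by (intro E_diagram_snoc) (auto simp: upto_numeral E_gram_def less_Suc_eq numeral_eq_Suc)
  with us obtain us where us: "E_diagram us" "length us = 8" by fastforce
  obtain y where y: "\<forall>i\<in>{..<8}. B y (us ! i) \<le> 0"
      "(\<Sum>i<8. E_highest 8 ! i * B y (us ! i)) \<ge> - 1" "\<exists>i\<in>{..<8}. B y (us ! i) \<noteq> 0"
    using step[of us] us by auto
  then show False by (simp add: upto_numeral E_highest_def)
qed

text \<open>
  The class of a root in the dual lattice of \<open>D4\<close> modulo \<open>D4\<close> is given by the parities of its products with the three
  orthogonal legs; it is nontrivial if one leg is odd one out.  Here \<open>z\<close> belongs to the leg \<open>l1\<close> and \<open>w\<close> to another one.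
  The root \<open>z\<close> extends \<open>D4\<close> to \<open>D5\<close>, and \<open>w\<close> extends this to \<open>E6\<close>.
\<close>

theorem D4_classes_card_le_8:
  assumes c: "B c c = 2" and l: "B l1 l1 = 2" "B l2 l2 = 2" "B l3 l3 = 2"
    and cl: "B c l1 = - 1" "B c l2 = - 1" "B c l3 = - 1"
    and ll: "B l1 l2 = 0" "B l1 l3 = 0" "B l2 l3 = 0"
    and z: "B z z = 2" "odd (B z l1 + B z l2)" "even (B z l2 + B z l3)"
    and w: "B w w = 2" "odd (B w l2 + B w l3)"
  shows "card P \<le> 8"
proof -
  have "E_diagram [c, l1, l2, l3]"
    using c l cl ll by (simp add: E_diagram_4)
  then obtain y where "E_diagram [c, l1, l2, l3, y]" using D4_extend z by blast
  then show ?thesis using D5_extend w E6_card_le_8 by blast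
qed

end

section \<open>Positive definite cubic triple systems\<close>

text \<open>
  \<open>T p q r\<close> says that \<open>{p, q, r}\<close> is a line.  Of the dual form on the lines only one consequence is needed:
  four lines that meet cyclically have a further intersection, since otherwise their vectors with alternating
  signs would have norm 0.
\<close>

locale cubic_triple_system = connected_positive_form P K
  for P :: "'p set" and K +
  fixes T :: "'p \<Rightarrow> 'p \<Rightarrow> 'p \<Rightarrow> bool"
  assumes T_in: "T p q r \<Longrightarrow> p \<in> P"
    and T_swap: "T p q r \<Longrightarrow> T q p r"
    and T_rotate: "T p q r \<Longrightarrow> T q r p"
    and T_neq: "T p q r \<Longrightarrow> p \<noteq> q"
    and T_unique: "T p q r \<Longrightarrow> T p q s \<Longrightarrow> r = s"
    and K_T: "p \<in> P \<Longrightarrow> q \<in> P \<Longrightarrow> p \<noteq> q \<Longrightarrow> K p q = (if \<exists>r. T p q r then 1 else 0)"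
    and three_lines: "p \<in> P \<Longrightarrow> \<exists>a a' b b' c c'. distinct [p, a, a', b, b', c, c'] \<and>
       (\<forall>x y. T p x y \<longleftrightarrow> (x, y) \<in> {(a, a'), (a', a), (b, b'), (b', b), (c, c'), (c', c)})"
    and dual_C4: "T b c x1 \<Longrightarrow> T c b' x2 \<Longrightarrow> T b' c' x3 \<Longrightarrow> T c' b x4 \<Longrightarrow>
       distinct [{b, c, x1}, {c, b', x2}, {b', c', x3}, {c', b, x4}] \<Longrightarrow>
       {b, c, x1} \<inter> {b', c', x3} \<noteq> {} \<or> {c, b', x2} \<inter> {c', b, x4} \<noteq> {}"
begin

definition col :: "'p \<Rightarrow> 'p \<Rightarrow> bool" where
  "col p q \<longleftrightarrow> (\<exists>r. T p q r)"

text \<open>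
  The three lines through \<open>p\<close> are \<open>{p, a, a'}\<close>, \<open>{p, b, b'}\<close> and \<open>{p, c, c'}\<close>.
\<close>

definition star :: "'p \<Rightarrow> 'p \<Rightarrow> 'p \<Rightarrow> 'p \<Rightarrow> 'p \<Rightarrow> 'p \<Rightarrow> 'p \<Rightarrow> bool" where
  "star p a a' b b' c c' \<longleftrightarrow> p \<in> P \<and> distinct [p, a, a', b, b', c, c'] \<and>
     (\<forall>x y. T p x y \<longleftrightarrow> (x, y) \<in> {(a, a'), (a', a), (b, b'), (b', b), (c, c'), (c', c)})"

lemma T_perms: "T p q r \<Longrightarrow> T p r q \<and> T q p r \<and> T q r p \<and> T r p q \<and> T r q p"
  using T_swap T_rotate by blast

lemma T_distinct: "T p q r \<Longrightarrow> p \<noteq> q \<and> p \<noteq> r \<and> q \<noteq> r"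
  using T_perms T_neq by blast

lemma T_col: "T p q r \<Longrightarrow> col p q \<and> col q p \<and> col p r \<and> col r p \<and> col q r \<and> col r q"
  unfolding col_def using T_perms by blast

lemma col_sym: "col p q \<Longrightarrow> col q p"
  unfolding col_def using T_swap by blast

lemma col_commute: "col p q \<longleftrightarrow> col q p"
  using col_sym by blast

lemma col_in: "col p q \<Longrightarrow> p \<in> P" "col p q \<Longrightarrow> q \<in> P"
  unfolding col_def using T_in T_swap by blast+

lemma col_neq: "col p q \<Longrightarrow> p \<noteq> q"
  unfolding col_def using T_neq by blast

lemma B_e_self: "p \<in> P \<Longrightarrow> B (e p) (e p) = 2"
  by (simp add: B_e K_diag)

lemma B_e_col: "col p q \<Longrightarrow> B (e p) (e q) = 1"
  using B_e[of p q] K_T[of p q] col_in[of p q] col_neq[of p q] by (auto simp: col_def)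

lemma B_e_not_col: "p \<in> P \<Longrightarrow> q \<in> P \<Longrightarrow> p \<noteq> q \<Longrightarrow> \<not> col p q \<Longrightarrow> B (e p) (e q) = 0"
  using B_e[of p q] K_T[of p q] by (auto simp: col_def)

lemmas B_e_simps = B_e_self B_e_col B_e_not_col B_e_not_col[OF _ _ not_sym]

lemma B_e_nonneg: "p \<in> P \<Longrightarrow> q \<in> P \<Longrightarrow> 0 \<le> B (e p) (e q)"
  by (cases "p = q"; cases "col p q") (simp_all add: B_e_self B_e_col B_e_not_col)

lemma star_exists: "p \<in> P \<Longrightarrow> \<exists>a a' b b' c c'. star p a a' b b' c c'"
  using three_lines[of p] unfolding star_def by blast

lemma star_perms:
  assumes "star p a a' b b' c c'"
  shows "star p a' a b b' c c'" "star p b b' a a' c c'" "star p a a' c c' b b'"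
  using assms unfolding star_def by auto

lemma star_T: "star p a a' b b' c c' \<Longrightarrow> T p a a' \<and> T p b b' \<and> T p c c'"
  by (simp add: star_def)

lemma star_distinct: "star p a a' b b' c c' \<Longrightarrow> distinct [p, a, a', b, b', c, c']"
  by (simp add: star_def)

lemma star_col: "star p a a' b b' c c' \<Longrightarrow> col p x \<longleftrightarrow> x \<in> {a, a', b, b', c, c'}"
  unfolding star_def col_def by auto

lemma star_in: "star p a a' b b' c c' \<Longrightarrow> {p, a, a', b, b', c, c'} \<subseteq> P"
  using star_col[of p a a' b b' c c'] col_in(2) by (auto simp: star_def)

lemma star_iff:
  "star p a a' b b' c c' \<Longrightarrow> T p x y \<longleftrightarrow> (x, y) \<in> {(a, a'), (a', a), (b, b'), (b', b), (c, c'), (c', c)}"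
  by (simp add: star_def)

lemma star_at:
  assumes "T p a a'"
  shows "\<exists>b b' c c'. star p a a' b b' c c'"
proof -
  obtain d d' b b' c c' where s: "star p d d' b b' c c'"
    using star_exists T_in assms by blast
  have "(a, a') \<in> {(d, d'), (d', d), (b, b'), (b', b), (c, c'), (c', c)}"
    using assms unfolding star_iff[OF s] .
  then consider "a = d" "a' = d'" | "a = d'" "a' = d" | "a = b" "a' = b'" | "a = b'" "a' = b"
    | "a = c" "a' = c'" | "a = c'" "a' = c" by auto
  then show ?thesis
    by cases (use s star_perms in metis)+
qed

lemma star_at2:
  assumes "T p a a'" "T p b b'" "b \<noteq> a" "b \<noteq> a'"
  shows "\<exists>c c'. star p a a' b b' c c'"
proof -
  obtain d d' c c' where s: "star p a a' d d' c c'"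
    using star_at assms(1) by blast
  have "(b, b') \<in> {(a, a'), (a', a), (d, d'), (d', d), (c, c'), (c', c)}"
    using assms(2) unfolding star_iff[OF s] .
  then consider "b = d" "b' = d'" | "b = d'" "b' = d" | "b = c" "b' = c'" | "b = c'" "b' = c"
    using assms(3,4) by auto
  then show ?thesis
    by cases (use s star_perms in metis)+
qed

lemma starI:
  assumes "T p a a'" "T p b b'" "T p c c'" "b \<notin> {a, a'}" "c \<notin> {a, a', b, b'}"
  shows "star p a a' b b' c c'"
proof -
  obtain d d' where s: "star p a a' b b' d d'"
    using star_at2 assms by blast
  have "(c, c') \<in> {(a, a'), (a', a), (b, b'), (b', b), (d, d'), (d', d)}"
    using assms(3) unfolding star_iff[OF s] .
  then consider "c = d" "c' = d'" | "c = d'" "c' = d"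
    using assms(5) by auto
  then show ?thesis
    by cases (use s star_perms in metis)+
qed

lemma star_of_nonadjacent:
  assumes "col v a" "col v b" "a \<noteq> b" "\<not> col a b"
  shows "\<exists>a' b' c c'. star v a a' b b' c c'"
proof -
  obtain a' b' where T: "T v a a'" "T v b b'" using assms(1,2) unfolding col_def by blast
  then have "b \<noteq> a'" using assms(4) T_col by blast
  then show ?thesis using star_at2[OF T] assms(3) by blast
qed

text \<open>
  With alternating signs, an induced 4-cycle of the collinearity graph has norm \<open>4 \<sqdot> 2 - 4 \<sqdot> 2 = 0\<close>.
\<close>

lemma no_induced_C4:
  assumes "col p q" "col q r" "col r s" "col s p" "p \<noteq> r" "q \<noteq> s" "\<not> col p r" "\<not> col q s"
  shows False
proof -
  have P: "p \<in> P" "q \<in> P" "r \<in> P" "s \<in> P" using assms col_in by blast+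
  have "B (e p - e q + e r - e s) (e p - e q + e r - e s) = 0"
    using assms P
    by (simp add: B_simps B_e_simps col_commute)
  moreover have "(e p - e q + e r - e s) p = 1"
    using assms col_neq by (auto simp: e_def)
  ultimately show False using B_pos_point[of p "e p - e q + e r - e s"] P(1) by simp
qed

lemma card_neighbours:
  assumes "p \<in> P"
  shows "card {q. col p q} = 6"
proof -
  obtain a a' b b' c c' where s: "star p a a' b b' c c'" using star_exists assms by blast
  then have "{q. col p q} = set [a, a', b, b', c, c']" using star_col by auto
  also have "card \<dots> = length [a, a', b, b', c, c']"
    using star_distinct[OF s] by (intro distinct_card) simp
  finally show ?thesis by simp
qed

text \<open>
  Let \<open>a, b, c\<close> be a claw at \<open>v\<close>: then \<open>- v\<close> with the legs \<open>a, b, c\<close> is a diagram \<open>D4\<close>.  The third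
  point \<open>a'\<close> of the line \<open>v a\<close> is collinear with \<open>a\<close> and \<open>b\<close>, hence not with \<open>c\<close>, and belongs to the class of \<open>c\<close>.
  A root of another class is \<open>c'\<close> if it is collinear with \<open>b\<close>, and otherwise the third point \<open>x\<close> of the line
  \<open>a' b\<close>, which is not collinear with \<open>a\<close> because \<open>v, a, x, b\<close> would be an induced 4-cycle.
\<close>

lemma card_le_8_if_claw_linked:
  assumes s: "star v a a' b b' c c'" and n: "\<not> col a b" "\<not> col a c" "\<not> col b c"
    and link: "col a' b"
  shows "card P \<le> 8"
proof -
  note d = star_distinct[OF s] and T = star_T[OF s]
  have P: "v \<in> P" "a \<in> P" "a' \<in> P" "b \<in> P" "b' \<in> P" "c \<in> P" "c' \<in> P" using star_in[OF s] by auto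
  have cv: "col v a" "col v b" "col v c" "col v a'" "col v c'" using T T_col by blast+
  have ca: "col a a'" "col b b'" "col c c'" using T T_col by blast+
  have no_two: "\<not> (col x b \<and> col x y)" if xy: "(x, y, z) \<in> {(a', c, a), (c', a, c)}" for x y z
  proof
    assume "col x b \<and> col x y"
    moreover have "col x z" using xy ca col_sym by auto
    moreover have "{y, z} = {a, c}" "x \<in> P" "col v x" using xy P cv by auto
    ultimately have x: "col x a" "col x b" "col x c" "x \<in> P" "col v x" by (auto simp: doubleton_eq_iff)
    \<comment> \<open>If \<open>x\<close> is collinear with all of \<open>a, b, c\<close>, then \<open>a, b, c, v - x\<close> are four orthogonal roots that
      have product 1 with \<open>v\<close>, so their sum must be \<open>2 v\<close>.\<close>
    have "B (e a + e b + e c - e v - e x) (e a + e b + e c - e v - e x) = 0"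
      using x P n cv d
      by (simp add: B_simps B_e_simps col_commute)
    moreover have "(e a + e b + e c - e v - e x) v = - 1"
      using d x(5) col_neq by (auto simp: e_def)
    ultimately show False using B_pos_point[of v "e a + e b + e c - e v - e x"] P(1) by simp
  qed
  have a'c: "\<not> col a' c" using no_two[of a' c a] link by blast
  obtain w where w: "w \<in> P" "B (e w) (e a) = 0" "B (e w) (e b) = 1"
  proof (cases "col c' b")
    case True
    moreover have "\<not> col c' a" using no_two[of c' a c] True by blast
    ultimately show ?thesis using that[of c'] P d by (simp add: B_e_simps col_commute)
  next
    case False
    obtain x where x: "T a' b x" using link by (auto simp: col_def)
    have "x \<noteq> v" using x T T_unique[of a' v a b] T_perms d by (metis distinct_length_2_or_more)
    moreover have "\<not> col v x"
    proof
      assume "col v x"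
      then have "x \<in> {a, a', b, b', c, c'}" using star_col[OF s] by blast
      moreover have "x \<noteq> a" using x n(1) T_col by blast
      moreover have "x \<noteq> a'" "x \<noteq> b" using x T_distinct by blast+
      moreover have "x \<noteq> b'"
      proof
        assume "x = b'"
        then have "T b b' a'" "T b b' v" using x T T_perms by blast+
        then show False using T_unique d by fastforce
      qed
      moreover have "x \<noteq> c" using x a'c T_col by blast
      moreover have "x \<noteq> c'" using x False T_col by blast
      ultimately show False by blast
    qed
    moreover have "\<not> col x a"
    proof
      assume "col x a"
      moreover have "col x b" using x T_col by blast
      ultimately show False
        using no_induced_C4[of v a x b] cv \<open>\<not> col v x\<close> \<open>x \<noteq> v\<close> n(1) d col_commute by auto
    qed
    moreover have "x \<noteq> a" using x n(1) T_col by blast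
    moreover have "x \<in> P" "col x b" using x T_col col_in by blast+
    ultimately show ?thesis using that[of x] P by (simp add: B_e_simps col_commute)
  qed
  show ?thesis
    by (rule D4_classes_card_le_8[of "- e v" "e c" "e a" "e b" "e a'" "e w"])
      (use P n cv ca d link a'c w in \<open>simp_all add: B_simps B_e_simps col_commute\<close>)
qed


text \<open>
  If neither \<open>a'\<close> nor \<open>b'\<close> is collinear with a further leg, they belong to the classes of \<open>a\<close> and \<open>b\<close>.
\<close>

lemma card_le_8_if_claw:
  assumes s: "star v a a' b b' c c'" and n: "\<not> col a b" "\<not> col a c" "\<not> col b c"
  shows "card P \<le> 8"
proof (cases "col a' b \<or> col a' c \<or> col b' a \<or> col b' c")
  case True
  have n': "\<not> col b a" "\<not> col c a" "\<not> col c b" using n col_sym by blast+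
  have "star v a a' c c' b b'" "star v b b' a a' c c'" "star v b b' c c' a a'"
    using s star_perms by metis+
  then show ?thesis
    using True card_le_8_if_claw_linked[OF s n] card_le_8_if_claw_linked[of v a a' c c' b b']
      card_le_8_if_claw_linked[of v b b' a a' c c'] card_le_8_if_claw_linked[of v b b' c c' a a'] n n'
    by blast
next
  case False
  note d = star_distinct[OF s] and T = star_T[OF s]
  have P: "v \<in> P" "a \<in> P" "a' \<in> P" "b \<in> P" "b' \<in> P" "c \<in> P" "c' \<in> P" using star_in[OF s] by auto
  have cv: "col v a" "col v b" "col v c" "col a a'" "col b b'" using T T_col by blast+
  have F: "\<not> col a' b" "\<not> col a' c" "\<not> col b' a" "\<not> col b' c" using False by blast+
  show ?thesis
    by (rule D4_classes_card_le_8[of "- e v" "e a" "e b" "e c" "e a'" "e b'"])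
      (use P n cv d F in \<open>simp_all add: B_simps B_e_simps col_commute\<close>)
qed

text \<open>
  The point \<open>x\<close> is collinear with \<open>a\<close>, which leaves only \<open>a'\<close> and \<open>c\<close> among the neighbours of \<open>v\<close>; and \<open>a'\<close> is
  not on the line \<open>a c\<close>, because it is on the line \<open>v a\<close>.
\<close>

lemma not_neighbour_of_centre:
  assumes s: "star v a a' b b' c c'" and x: "T a c x" and n: "\<not> col a b" "\<not> col a b'" "\<not> col a c'"
  shows "x \<noteq> v \<and> \<not> col v x"
proof -
  note d = star_distinct[OF s] and T = star_T[OF s]
  have "x \<noteq> w" if "T a w y" "y \<noteq> c" "w \<noteq> c" for w y
  proof
    assume "x = w"
    then have "T a w c" using x T_perms by blast
    then show False using that T_unique by blast
  qed
  then have "x \<noteq> v" "x \<noteq> a'"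
    using T T_perms d by (metis distinct_length_2_or_more)+
  moreover have "x \<noteq> b" "x \<noteq> b'" "x \<noteq> c'" using x n T_col by blast+
  moreover have "x \<noteq> a" "x \<noteq> c" using x T_distinct by blast+
  ultimately show ?thesis using star_col[OF s] by blast
qed

text \<open>
  The collinear pairs \<open>a, c\<close> and \<open>b, c'\<close> of neighbours of \<open>v\<close> are linked by the line \<open>v c c'\<close>.
  The point \<open>c\<close> is the centre of a diagram \<open>D4\<close>, with \<open>- c\<close> joined to \<open>v\<close>, \<open>c - c'\<close> and \<open>c - a\<close>.
  Then \<open>b\<close> belongs to the leg \<open>c - a\<close>, and the third point \<open>x\<close> of the line \<open>a c\<close> to another
  one, provided that it is not collinear with \<open>c'\<close>.
\<close>

lemma card_le_8_if_triangles_linked: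
  assumes s: "star v a a' b b' c c'"
    and n: "\<not> col a b" "\<not> col a b'" "\<not> col a c'" "\<not> col c b" and l: "col a c" "col b c'"
  shows "card P \<le> 8"
proof (cases "col b' c'")
  case False
  have "star v a a' b' b c' c" using s star_perms by metis
  then show ?thesis using card_le_8_if_claw[of v a a' b' b c' c] n False by blast
next
  case True
  note d = star_distinct[OF s] and T = star_T[OF s]
  have P: "v \<in> P" "a \<in> P" "a' \<in> P" "b \<in> P" "b' \<in> P" "c \<in> P" "c' \<in> P" using star_in[OF s] by auto
  have cv: "col v a" "col v b" "col v c" "col v c'" "col c c'" "col v b'" using T T_col by blast+
  obtain x where x: "T a c x" using l by (auto simp: col_def)
  have xv: "x \<noteq> v" "\<not> col v x" using not_neighbour_of_centre[OF s x] n by blast+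
  have xP: "x \<in> P" and xc: "col x a" "col x c" using x T_col col_in by blast+
  have x_not: "\<not> col x y" if "y = b \<or> y = b'" for y
  proof
    assume "col x y"
    then show False
      using no_induced_C4[of v a x y] cv xc xv n that d by (auto simp: col_commute)
  qed
  \<comment> \<open>Otherwise \<open>x\<close> would be on one of the three lines through \<open>c'\<close>, which contain \<open>v\<close>, \<open>b\<close> and \<open>b'\<close>.\<close>
  have "\<not> col c' x"
  proof
    assume "col c' x"
    obtain y where y: "T c' b y" using l(2) col_sym by (auto simp: col_def)
    obtain y' where y': "T c' b' y'" using True col_sym by (auto simp: col_def)
    have "y \<noteq> b'"
    proof
      assume "y = b'"
      then have "T b b' c'" "T b b' v" using y T T_perms by blast+
      then show False using T_unique d by fastforce
    qed
    moreover have "T c' v c" using T T_perms by blast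
    ultimately have "star c' v c b y b' y'"
      using y y' d by (intro starI) auto
    then have "x \<in> {v, c, b, y, b', y'}" using \<open>col c' x\<close> star_col by blast
    moreover have "x \<noteq> v" "x \<noteq> c" using xv x T_distinct by blast+
    moreover have "x \<noteq> b" "x \<noteq> b'" using xc n col_sym by blast+
    moreover have "x \<noteq> y" "x \<noteq> y'" using y y' x_not T_col by blast+
    ultimately show False by blast
  qed
  moreover have "x \<noteq> c'" using xc n(3) col_sym by blast
  ultimately show ?thesis
    by (intro D4_classes_card_le_8[of "- e c" "e c - e a" "e v" "e c - e c'" "e b" "e x"])
      (use P n cv d l xv xc xP x_not[of b] x T_distinct[OF x] in \<open>simp_all add: B_simps B_e_simps col_commute\<close>)
qed

text \<open>
  Without claws, the neighbours \<open>b, b', c, c'\<close> of \<open>v\<close> are pairwise collinear.  The lines \<open>b c\<close>, \<open>c b'\<close>, \<open>b' c'\<close>,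
  \<open>c' b\<close> meet cyclically, so two opposite ones share a point \<open>x\<close>, which is collinear with all of
  \<open>b, b', c, c'\<close> but not with \<open>v\<close>.  Thus \<open>v\<close>, \<open>x\<close> and \<open>b - b'\<close> are orthogonal, and they are the legs of a diagram
  \<open>D4\<close> with centre \<open>- b\<close>, in which \<open>c\<close> belongs to \<open>b - b'\<close> and \<open>a\<close> to \<open>v\<close>.
\<close>

lemma card_le_8_if_triangle_and_K5:
  assumes s: "star v a a' b b' c c'"
    and n: "\<not> col a b" "\<not> col a b'" "\<not> col a c" "\<not> col a c'" "\<not> col a' b"
    and l: "col b c" "col b c'"
  shows "card P \<le> 8"
proof (cases "col b' c \<and> col b' c'")
  case False
  have "star v a a' b' b c c'" "star v a a' b' b c' c" using s star_perms by metis+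
  then show ?thesis
    using card_le_8_if_claw[of v a a' b' b c c'] card_le_8_if_claw[of v a a' b' b c' c] n False by blast
next
  case True
  have main: "card P \<le> 8"
    if s: "star v a a' b b' c c'" and n: "\<not> col a b" "\<not> col a c" "\<not> col a' b"
      and l: "col b' c" and x: "T b c x" "T b' c' x" for c c' x
  proof -
    note d = star_distinct[OF s] and T = star_T[OF s]
    have P: "v \<in> P" "a \<in> P" "a' \<in> P" "b \<in> P" "b' \<in> P" "c \<in> P" "c' \<in> P" using star_in[OF s] by auto
    have cv: "col v a" "col v b" "col v c" "col v b'" "col b b'" using T T_col by blast+
    have xc: "col x b" "col x c" "col x b'" "x \<in> P" using x T_col col_in by blast+
    have "x \<noteq> v"
    proof
      assume "x = v"
      then have "T b v c" "T b v b'" using x T T_perms by blast+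
      then show False using T_unique d by fastforce
    qed
    moreover have "\<not> col v x"
    proof
      assume "col v x"
      then have "x \<in> {a, a', b, b', c, c'}" using star_col[OF s] by blast
      moreover have "x \<noteq> a" "x \<noteq> a'" using xc n col_sym by blast+
      moreover have "x \<noteq> b" "x \<noteq> c" "x \<noteq> b'" "x \<noteq> c'" using x T_distinct by blast+
      ultimately show False by blast
    qed
    moreover have "\<not> col x a"
    proof
      assume "col x a"
      then show False
        using no_induced_C4[of v a x b] cv xc \<open>x \<noteq> v\<close> \<open>\<not> col v x\<close> n d by (auto simp: col_commute)
    qed
    moreover have "x \<noteq> a" using xc n col_sym by blast
    moreover have "col b c" using x T_col by blast
    ultimately show ?thesis
      by (intro D4_classes_card_le_8[of "- e b" "e b - e b'" "e v" "e x" "e c" "e a"])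
        (use P n cv d l xc in \<open>simp_all add: B_simps B_e_simps col_commute\<close>)
  qed
  note d = star_distinct[OF s] and T = star_T[OF s]
  have "col b c" "col c b'" "col b' c'" "col c' b" using l True col_sym by blast+
  then obtain x1 x2 x3 x4 where x: "T b c x1" "T c b' x2" "T b' c' x3" "T c' b x4"
    by (auto simp: col_def)
  have mates: "b \<noteq> x2" "b \<noteq> x3" "b' \<noteq> x1" "b' \<noteq> x4" "c \<noteq> x3" "c \<noteq> x4" "c' \<noteq> x1" "c' \<noteq> x2"
  proof -
    have "False" if "T p q r" "T v p q \<or> T v q p \<or> T v p r \<or> T v r p \<or> T v q r \<or> T v r q" "v \<noteq> p" "v \<noteq> q" "v \<noteq> r" for p q r
      using that T_unique T_perms by metis
    then show "b \<noteq> x2" "b \<noteq> x3" "b' \<noteq> x1" "b' \<noteq> x4" "c \<noteq> x3" "c \<noteq> x4" "c' \<noteq> x1" "c' \<noteq> x2"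
      using x T d by (metis distinct_length_2_or_more)+
  qed
  \<comment> \<open>The mates of \<open>b, b', c, c'\<close> on lines through \<open>v\<close> are already fixed, so the third points are new.\<close>
  have "distinct [{b, c, x1}, {c, b', x2}, {b', c', x3}, {c', b, x4}]"
  proof -
    have "b \<notin> {c, b', x2}" "b \<notin> {b', c', x3}" "c \<notin> {c', b, x4}" "c \<notin> {b', c', x3}" "b' \<notin> {c', b, x4}"
      using d mates by auto
    then show ?thesis
      by (simp only: distinct.simps list.set) blast
  qed
  from dual_C4[OF x this] have "x1 = x3 \<or> x2 = x4"
    using d mates T_distinct[OF x(1)] T_distinct[OF x(2)] T_distinct[OF x(3)] T_distinct[OF x(4)] by auto
  then show ?thesis
  proof
    assume "x1 = x3"
    then show ?thesis using main[OF s, of x1] n l x True by simp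
  next
    assume "x2 = x4"
    moreover have "star v a a' b b' c' c" using s star_perms by metis
    moreover have "T b c' x4" "T b' c x2" using x T_perms by blast+
    ultimately show ?thesis using main[of c' c x2] n l True by simp
  qed
qed


lemma card_le_8_if_independent_neighbours:
  assumes "col v a" "col v b" "col v c" "a \<noteq> b" "a \<noteq> c" "b \<noteq> c"
    and n: "\<not> col a b" "\<not> col a c" "\<not> col b c"
  shows "card P \<le> 8"
proof -
  obtain a' b' d d' where s: "star v a a' b b' d d'" using star_of_nonadjacent assms by blast
  note T = star_T[OF s]
  have "c \<in> {a, a', b, b', d, d'}" using star_col[OF s] assms by blast
  moreover have "c \<noteq> a'" "c \<noteq> b'" using T n T_col by blast+
  ultimately have "c = d \<or> c = d'" using assms by blast
  moreover have "star v a a' b b' d' d" using s star_perms by metis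
  ultimately show ?thesis using card_le_8_if_claw s n by blast
qed

text \<open>
  Without claws, each of \<open>c\<close> and \<open>c'\<close> is collinear with exactly one of \<open>a\<close> and \<open>b\<close>: the six neighbours of \<open>v\<close> are
  covered by two cliques, of sizes 3 and 3 or of sizes 2 and 4.
\<close>

lemma card_le_8_if_no_common_neighbour:
  assumes ab: "col v a" "col v b" "a \<noteq> b" "\<not> col a b"
    and none: "\<And>x. col v x \<Longrightarrow> \<not> (col x a \<and> col x b)"
  shows "card P \<le> 8"
proof (rule ccontr)
  assume gt: "\<not> card P \<le> 8"
  obtain a' b' c c' where s: "star v a a' b b' c c'" using star_of_nonadjacent ab by blast
  note d = star_distinct[OF s] and T = star_T[OF s]
  have cv: "col v a'" "col v b'" "col v c" "col v c'" "col a' a" "col b' b" using T T_col by blast+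
  have n: "\<not> col b a" "\<not> col a' b" "\<not> col b a'" "\<not> col b' a" "\<not> col a b'"
    using none[of a'] none[of b'] cv ab col_sym by blast+
  have xor: "col x a \<longleftrightarrow> \<not> col x b" if "x = c \<or> x = c'" for x
  proof -
    have "col v x" "x \<noteq> a" "x \<noteq> b" using that cv d by auto
    then show ?thesis
      using none[of x] card_le_8_if_independent_neighbours[of v a b x] ab gt col_sym by blast
  qed
  have p: "star v a a' b b' c' c" "star v b b' a a' c c'" using s star_perms by metis+
  consider "col c a" "col c' b" | "col c b" "col c' a" | "col c b" "col c' b" | "col c a" "col c' a"
    using xor by blast
  then have "card P \<le> 8"
  proof cases
    case 1
    then show ?thesis
      using card_le_8_if_triangles_linked[OF s] ab n xor[of c] xor[of c'] col_sym by blast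
  next
    case 2
    then show ?thesis
      using card_le_8_if_triangles_linked[OF p(1)] ab n xor[of c] xor[of c'] col_sym by blast
  next
    case 3
    then show ?thesis
      using card_le_8_if_triangle_and_K5[OF s] ab n xor[of c] xor[of c'] col_sym by blast
  next
    case 4
    then show ?thesis
      using card_le_8_if_triangle_and_K5[OF p(2)] ab n xor[of c] xor[of c'] col_sym by blast
  qed
  then show False using gt by simp
qed

text \<open>
  The roots \<open>a\<close>, \<open>b\<close> and \<open>v - p\<close> are orthogonal and joined to \<open>- v\<close>.  The point \<open>q\<close> belongs to the leg \<open>v - p\<close>, and any
  point \<open>w\<close> that is collinear with \<open>a\<close> but not with \<open>b\<close> belongs to another leg.
\<close>

lemma card_le_8_if_two_common_neighbours:
  assumes ab: "col v a" "col v b" "a \<noteq> b" "\<not> col a b"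
    and p: "col v p" "col p a" "col p b" and q: "col v q" "col q a" "col q b" and "p \<noteq> q"
  shows "card P \<le> 8"
proof -
  have "col p q"
    using no_induced_C4[of p a q b] assms col_sym by blast
  \<comment> \<open>Otherwise the 6 neighbours of \<open>a\<close> would form a clique, which contains \<open>v\<close>, and \<open>v\<close> would be collinear
    with the other 5, with \<open>a\<close> and with \<open>b\<close>.\<close>
  have "\<exists>w. col w a \<and> \<not> col w b"
  proof (rule ccontr)
    assume "\<not> ?thesis"
    then have sub: "col w b" if "col w a" for w using that by blast
    have clique: "col x y" if "col x a" "col y a" "x \<noteq> y" for x y
      using no_induced_C4[of x a y b] that sub ab(3,4) col_sym by blast
    let ?N = "{x. col a x}"
    have "card ?N = 6" using card_neighbours ab(1) col_in by blast
    moreover have "card {x. col v x} = 6" using card_neighbours ab(1) col_in by blast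
    moreover have "insert a (insert b (?N - {v})) \<subseteq> {x. col v x}"
    proof
      fix x assume "x \<in> insert a (insert b (?N - {v}))"
      then consider "x = a" | "x = b" | "col a x" "x \<noteq> v" by blast
      then show "x \<in> {x. col v x}"
        by cases (use ab clique[of v x] col_sym in blast)+
    qed
    moreover have "finite {x. col v x}"
      using \<open>card {x. col v x} = 6\<close> card.infinite by fastforce
    ultimately have "card (insert a (insert b (?N - {v}))) \<le> 6" by (metis card_mono)
    moreover have "finite ?N" using \<open>card ?N = 6\<close> card.infinite by fastforce
    moreover have "v \<in> ?N" "a \<notin> ?N" "b \<notin> ?N" using ab col_sym col_neq by blast+
    ultimately show False using \<open>card ?N = 6\<close> ab(3) by simp
  qed
  then obtain w where w: "col w a" "\<not> col w b" by blast
  have P: "v \<in> P" "a \<in> P" "b \<in> P" "p \<in> P" "q \<in> P" "w \<in> P" using assms w col_in by blast+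
  have ne: "w \<noteq> b" "v \<noteq> a" "v \<noteq> b" "v \<noteq> p" "v \<noteq> q" "p \<noteq> a" "p \<noteq> b" "q \<noteq> a" "q \<noteq> b"
    using assms w col_neq col_sym by blast+
  show ?thesis
    by (rule D4_classes_card_le_8[of "- e v" "e v - e p" "e a" "e b" "e q" "e w"])
      (use assms w P ne \<open>col p q\<close> in \<open>simp_all add: B_simps B_e_simps col_commute\<close>)
qed

text \<open>
  This excludes that five neighbours \<open>a, a', p, c, c'\<close> of \<open>v\<close> form a clique and the sixth one, \<open>b\<close>, is joined
  to \<open>p\<close> only: the lines through \<open>p\<close> are then \<open>v b\<close>, \<open>a c\<close> and \<open>a' c'\<close>, up to a swap of \<open>c\<close> and \<open>c'\<close>.  The third point \<open>x\<close> of the line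
  \<open>a c'\<close> is collinear neither with \<open>v\<close> nor with \<open>p\<close>, so that \<open>a + c' + b - v - p - x\<close> is not positive.
\<close>

lemma no_K5_with_pendant:
  assumes s: "star v a a' b p c c'" and n: "\<not> col a b" "\<not> col c' b" "\<not> col c b"
    and l: "col p a" "col p c'" "col a c'" and pa'c': "T p a c" "T p a' c'"
  shows False
proof -
  note d = star_distinct[OF s] and T = star_T[OF s]
  have P: "v \<in> P" "a \<in> P" "a' \<in> P" "b \<in> P" "p \<in> P" "c \<in> P" "c' \<in> P" using star_in[OF s] by auto
  have cv: "col v a" "col v b" "col v p" "col v c'" "col b p" using T T_col by blast+
  obtain x where x: "T a c' x" using l by (auto simp: col_def)
  have xP: "x \<in> P" and xc: "col x a" "col x c'" using x T_col col_in by blast+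
  have x_not: "x \<noteq> w" if "T a w y \<or> T c' w y" "y \<noteq> c'" "y \<noteq> a" for w y
  proof
    assume "x = w"
    then have "T a w c'" "T c' w a" using x T_perms by blast+
    then show False using that T_unique by blast
  qed
  have "x \<noteq> v" using x_not[of v a'] T T_perms d by (metis distinct_length_2_or_more)
  moreover have "x \<noteq> a'" using x_not[of a' v] T T_perms d by (metis distinct_length_2_or_more)
  moreover have "x \<noteq> b" using xc n col_sym by blast
  moreover have "x \<noteq> p" using x_not[of p c] pa'c' T_perms d by (metis distinct_length_2_or_more)
  moreover have "x \<noteq> c" using x_not[of c p] pa'c' T_perms d by (metis distinct_length_2_or_more)
  moreover have "x \<noteq> a" "x \<noteq> c'" using x T_distinct by blast+
  ultimately have ne: "x \<notin> {v, a, a', b, p, c, c'}" by blast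
  then have "\<not> col v x" using star_col[OF s] by blast
  have "T p v b" using T T_perms by blast
  then have "star p v b a c a' c'"
    using pa'c' d by (intro starI) auto
  then have "\<not> col p x" using ne star_col by blast
  have "B (e a + e c' + e b - e v - e p - e x) (e a + e c' + e b - e v - e p - e x) = - 2 * B (e b) (e x)"
    using P xP ne d n cv l xc \<open>\<not> col v x\<close> \<open>\<not> col p x\<close>
    by (simp add: B_simps B_e_simps col_commute B_sym[of "e x" "e b"])
  moreover have "(e a + e c' + e b - e v - e p - e x) v = - 1"
    using d ne by (auto simp: e_def)
  ultimately show False
    using B_pos_point[of v "e a + e c' + e b - e v - e p - e x"] P(1) B_e_nonneg[OF P(4) xP] by simp
qed

text \<open>
  By the last hypothesis, the neighbours of \<open>v\<close> on the side of \<open>a\<close> are collinear with \<open>p\<close> and those on the side of \<open>b\<close>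
  are not.  If there is some \<open>r\<close> on the side of \<open>b\<close>, then \<open>a\<close> and \<open>r\<close> have no common neighbour among
  the neighbours of \<open>v\<close>.  Otherwise \<open>p\<close> is the third point of the line \<open>v b\<close>, and the neighbours of \<open>v\<close> are a
  clique of size 5 with the pendant vertex \<open>b\<close>.
\<close>

lemma card_le_8_if_one_common_neighbour:
  assumes ab: "col v a" "col v b" "a \<noteq> b" "\<not> col a b"
    and p: "col v p" "col p a" "col p b"
    and one: "\<And>x. col v x \<Longrightarrow> col x a \<Longrightarrow> col x b \<Longrightarrow> x = p"
    and types: "\<And>x. col v x \<Longrightarrow> x \<notin> {a, b, p} \<Longrightarrow> (col x a \<and> \<not> col x b \<and> col x p) \<or> (col x b \<and> \<not> col x a \<and> \<not> col x p)"
  shows "card P \<le> 8"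
proof (cases "\<exists>r. col v r \<and> r \<notin> {a, b, p} \<and> col r b \<and> \<not> col r a \<and> \<not> col r p")
  case True
  then obtain r where r: "col v r" "r \<notin> {a, b, p}" "col r b" "\<not> col r a" "\<not> col r p" by blast
  have "\<not> (col x a \<and> col x r)" if x: "col v x" for x
  proof
    assume xar: "col x a \<and> col x r"
    then have "x \<notin> {a, b, p}" using ab r col_sym col_neq by blast
    then have "col x p" "\<not> col x b" using types[of x] x xar by blast+
    then show False
      using no_induced_C4[of b r x p] xar r p \<open>x \<notin> {a, b, p}\<close> col_sym by blast
  qed
  then show ?thesis
    using card_le_8_if_no_common_neighbour[of v a r] ab r col_sym by blast
next
  case False
  then have all: "col x a \<and> \<not> col x b \<and> col x p" if "col v x" "x \<notin> {a, b, p}" for x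
    using types[of x] that by blast
  obtain a' b' c c' where s: "star v a a' b b' c c'" using star_of_nonadjacent ab by blast
  note d = star_distinct[OF s] and T = star_T[OF s]
  have "col v b'" "col b' b" using T T_col by blast+
  then have b': "b' = p" using all[of b'] d by auto
  note s = s[unfolded b'] note d = star_distinct[OF s] and T = star_T[OF s]
  have cv: "col v a'" "col v c" "col v c'" using T T_col by blast+
  have a': "\<not> col a' b" "col p a'" and c: "col c a" "\<not> col c b" "col p c" and c': "col c' a" "\<not> col c' b" "col p c'"
    using all[of a'] all[of c] all[of c'] cv d col_sym by auto
  obtain y where y: "T p a y" using p(2) by (auto simp: col_def)
  obtain y' where y': "T p a' y'" using a'(2) by (auto simp: col_def)
  have yy: "y \<noteq> a'" "y \<noteq> y'"
  proof -
    show "y \<noteq> a'"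
    proof
      assume "y = a'"
      then have "T a a' p" "T a a' v" using y T T_perms by blast+
      then show False using T_unique d by fastforce
    qed
    show "y \<noteq> y'"
      using y y' T_unique T_perms d by (metis distinct_length_2_or_more)
  qed
  have "T p v b" using T T_perms by blast
  then have st: "star p v b a y a' y'"
    using y y' d yy by (intro starI) auto
  have "c \<in> {v, b, a, y, a', y'}" "c' \<in> {v, b, a, y, a', y'}" using c c' star_col[OF st] by blast+
  then have "c = y \<and> c' = y' \<or> c = y' \<and> c' = y" using d by auto
  then have False
  proof
    assume "c = y \<and> c' = y'"
    then show False
      using no_K5_with_pendant[OF s] ab c c' p y y' col_sym by blast
  next
    assume "c = y' \<and> c' = y"
    moreover have "star v a a' b p c' c" using s star_perms by metis
    ultimately show False
      using no_K5_with_pendant[of v a a' b p c' c] ab c c' p y y' col_sym by blast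
  qed
  then show ?thesis ..
qed

text \<open>
  What remains is the case of exactly one common neighbour \<open>p\<close> of \<open>a\<close> and \<open>b\<close> among the neighbours of \<open>v\<close>.  In the diagram
  \<open>D4\<close> with centre \<open>- v\<close> and legs \<open>a\<close>, \<open>b\<close>, \<open>v - p\<close>, each further neighbour of \<open>v\<close> belongs to the
  leg \<open>a\<close> or to the leg \<open>b\<close>.  If both legs occur, there are at most 8 points; otherwise
  the previous lemma applies, possibly with \<open>a\<close> and \<open>b\<close> exchanged.
\<close>

lemma card_le_8_if_nonadjacent_neighbours:
  assumes ab: "col v a" "col v b" "a \<noteq> b" "\<not> col a b"
  shows "card P \<le> 8"
proof (rule ccontr)
  assume gt: "\<not> card P \<le> 8"
  obtain p where p: "col v p" "col p a" "col p b"
    using card_le_8_if_no_common_neighbour[OF ab] gt by blast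
  have one: "x = p" if "col v x" "col x a" "col x b" for x
    using card_le_8_if_two_common_neighbours[OF ab p that] gt by blast
  have xor: "col x a \<longleftrightarrow> \<not> col x b" if "col v x" "x \<notin> {a, b, p}" for x
    using one[of x] that card_le_8_if_independent_neighbours[of v a b x] ab gt col_sym by blast
  have P: "v \<in> P" "a \<in> P" "b \<in> P" "p \<in> P" using ab p col_in by blast+
  have ne: "v \<noteq> a" "v \<noteq> b" "v \<noteq> p" "p \<noteq> a" "p \<noteq> b" using ab p col_neq by blast+
  have same: False
    if x: "col v x" "x \<notin> {a, b, p}" "col x a \<longleftrightarrow> col x p"
      and y: "col v y" "y \<notin> {a, b, p}" "col y a \<longleftrightarrow> \<not> col y p" for x y
  proof -
    have "x \<in> P" "y \<in> P" using x y col_in by blast+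
    then have "card P \<le> 8"
      by (intro D4_classes_card_le_8[of "- e v" "e a" "e b" "e v - e p" "e x" "e y"];
        use ab p P ne x y xor[OF x(1,2)] xor[OF y(1,2)] in
          \<open>cases "col x p"; cases "col y p"; simp add: B_simps B_e_simps col_commute\<close>)
    then show False using gt by simp
  qed
  have "(\<forall>x. col v x \<longrightarrow> x \<notin> {a, b, p} \<longrightarrow> (col x a \<longleftrightarrow> col x p)) \<or>
        (\<forall>x. col v x \<longrightarrow> x \<notin> {a, b, p} \<longrightarrow> (col x a \<longleftrightarrow> \<not> col x p))"
    using same by blast
  then show False
  proof
    assume *: "\<forall>x. col v x \<longrightarrow> x \<notin> {a, b, p} \<longrightarrow> (col x a \<longleftrightarrow> col x p)"
    then have "card P \<le> 8" using xor one
      by (intro card_le_8_if_one_common_neighbour[OF ab p]) blast+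
    then show False using gt by simp
  next
    assume *: "\<forall>x. col v x \<longrightarrow> x \<notin> {a, b, p} \<longrightarrow> (col x a \<longleftrightarrow> \<not> col x p)"
    have "card P \<le> 8"
      by (rule card_le_8_if_one_common_neighbour[of v b a p])
        (use ab p one xor * col_sym in blast)+
    then show False using gt by simp
  qed
qed

text \<open>
  With at most 8 points and 6 neighbours for each, a noncollinear pair \<open>p, q\<close> means 8 points, each
  with one non-neighbour; two such pairs form an induced 4-cycle.  With more points, collinearity is
  transitive, so that \<open>p\<close> and its neighbours are all points.
\<close>

theorem all_collinear:
  assumes "p \<in> P" "q \<in> P" "p \<noteq> q"
  shows "col p q"
proof (rule ccontr)
  assume pq: "\<not> col p q"
  show False
  proof (cases "card P \<le> 8")
    case True
    have N: "{x. col p x} = P - {p, q}" if "p \<in> P" "q \<in> P" "p \<noteq> q" "\<not> col p q" for p q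
    proof (rule card_subset_eq)
      show "{x. col p x} \<subseteq> P - {p, q}" using that col_in col_neq by blast
      have "card (P - {p, q}) = card P - 2" using that finite_P by (simp add: card_Diff_subset)
      moreover have "card {x. col p x} \<le> card (P - {p, q})"
        using \<open>{x. col p x} \<subseteq> P - {p, q}\<close> finite_P by (intro card_mono) auto
      ultimately show "card {x. col p x} = card (P - {p, q})"
        using True card_neighbours[OF that(1)] by simp
    qed (use finite_P in simp)
    have Np: "{x. col p x} = P - {p, q}" and Nq: "{x. col q x} = P - {q, p}"
      using N[OF assms pq] N[of q p] assms pq col_sym by blast+
    have cP: "card P = 8"
      using card_neighbours[OF assms(1)] assms finite_P card_Diff_subset[of "{p, q}" P] unfolding Np by simp
    obtain r where r: "col p r" using card_neighbours[OF assms(1)] by (metis Collect_empty_eq card.empty zero_neq_numeral)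
    have "\<exists>s\<in>P. s \<noteq> r \<and> \<not> col r s"
    proof (rule ccontr)
      assume "\<not> ?thesis"
      then have "P - {r} \<subseteq> {s. col r s}" by blast
      moreover have "card {s. col r s} = 6" using card_neighbours r col_in by blast
      moreover have "finite {s. col r s}" using finite_P col_in by (metis (no_types, lifting) mem_Collect_eq rev_finite_subset subsetI)
      ultimately have "card (P - {r}) \<le> 6" by (metis card_mono)
      then show False using cP r col_in by simp
    qed
    then obtain s where s: "s \<in> P" "s \<noteq> r" "\<not> col r s" by blast
    have "r \<in> P - {q, p}" using r Np by blast
    then have qr: "col q r" using Nq by blast
    then have "s \<noteq> p" "s \<noteq> q" using s r col_sym by blast+
    then have "col p s" "col q s" using s(1) Np Nq by blast+
    then show False
      using no_induced_C4[of p r q s] r qr s pq assms(3) col_sym by blast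
  next
    case False
    have "insert p {x. col p x} = P"
    proof (rule connected)
      fix x y assume x: "x \<in> insert p {x. col p x}" and y: "y \<in> P" "K x y \<noteq> 0"
      have "x \<in> P" using x assms(1) col_in by blast
      then have "x = y \<or> col x y" using y K_T[of x y] by (cases "x = y") (auto simp: col_def split: if_splits)
      then show "y \<in> insert p {x. col p x}"
        using card_le_8_if_nonadjacent_neighbours[of x p y] x False col_sym by blast
    qed (use assms(1) col_in in auto)
    then show False using pq assms by blast
  qed
qed

end

section \<open>Incidence structures on which both quadratic forms are positive definite\<close>

text \<open>
  Expanding the squares counts, for each pair of points, the lines through both.
\<close>

lemma sum_of_squares_incidence:
  fixes x :: "'p \<Rightarrow> 'c :: comm_ring_1" and I :: "'p \<Rightarrow> 'l \<Rightarrow> bool"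
  assumes P: "finite P" and L: "finite L" and inc: "\<And>p l. I p l \<Longrightarrow> p \<in> P \<and> l \<in> L"
  shows "(\<Sum>l\<in>L. (\<Sum>p | I p l. x p)\<^sup>2) =
    (\<Sum>p\<in>P. \<Sum>q\<in>P. of_nat (card {l. I p l \<and> I q l}) * x p * x q)"
proof -
  have sq: "(\<Sum>p | I p l. x p)\<^sup>2 = (\<Sum>p\<in>P. \<Sum>q\<in>P. if I p l \<and> I q l then x p * x q else 0)" for l
  proof -
    have "(\<Sum>p | I p l. x p) = (\<Sum>p\<in>P. if I p l then x p else 0)"
      using P inc by (intro sum.mono_neutral_cong_left) auto
    then show ?thesis
      by (simp add: power2_eq_square sum_product if_distrib[of "\<lambda>z. z * _"] if_distrib[of "\<lambda>z. _ * z"] cong: if_cong)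
         (intro sum.cong refl, auto)
  qed
  have card_eq: "(\<Sum>l\<in>L. if I p l \<and> I q l then x p * x q else 0) = of_nat (card {l. I p l \<and> I q l}) * x p * x q" for p q
  proof -
    have "(\<Sum>l\<in>L. if I p l \<and> I q l then x p * x q else 0) = (\<Sum>l\<in>{l. I p l \<and> I q l}. x p * x q)"
      using L inc by (intro sum.mono_neutral_cong_right) auto
    then show ?thesis by simp
  qed
  have "(\<Sum>l\<in>L. (\<Sum>p | I p l. x p)\<^sup>2) = (\<Sum>p\<in>P. \<Sum>q\<in>P. \<Sum>l\<in>L. if I p l \<and> I q l then x p * x q else 0)"
    unfolding sq by (subst sum.swap) (intro sum.cong refl sum.swap)
  then show ?thesis by (simp only: card_eq)
qed

text \<open>
  The two sides of a subcubic bipartite graph.  The last two assumptions say that the adjacency operator strictly increases the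
  norm of every nonzero integral vector that is supported on one side.
\<close>

locale incidence =
  fixes P :: "'p set" and L :: "'l set" and I :: "'p \<Rightarrow> 'l \<Rightarrow> bool"
  assumes finite_points: "finite P" and finite_lines: "finite L"
    and incident_in: "I p l \<Longrightarrow> p \<in> P \<and> l \<in> L"
    and card_lines_le: "p \<in> P \<Longrightarrow> card {l. I p l} \<le> 3"
    and card_points_le: "l \<in> L \<Longrightarrow> card {p. I p l} \<le> 3"
    and expanding_points: "p \<in> P \<Longrightarrow> x p \<noteq> (0::int) \<Longrightarrow>
      (\<Sum>p\<in>P. (x p)\<^sup>2) < (\<Sum>l\<in>L. (\<Sum>p | I p l. x p)\<^sup>2)"
    and expanding_lines: "l \<in> L \<Longrightarrow> y l \<noteq> (0::int) \<Longrightarrow>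
      (\<Sum>l\<in>L. (y l)\<^sup>2) < (\<Sum>p\<in>P. (\<Sum>l | I p l. y l)\<^sup>2)"
begin

definition K :: "'p \<Rightarrow> 'p \<Rightarrow> int" where
  "K p q = int (card {l. I p l \<and> I q l}) - (if p = q then 1 else 0)"

lemma finite_lines_of: "finite {l. I p l}"
  using finite_lines incident_in by (metis (no_types, lifting) finite_subset mem_Collect_eq subsetI)

lemma finite_points_of: "finite {p. I p l}"
  using finite_points incident_in by (metis (no_types, lifting) finite_subset mem_Collect_eq subsetI)

lemma quadratic_form_eq:
  "(\<Sum>p\<in>P. \<Sum>q\<in>P. K p q * x p * x q) = (\<Sum>l\<in>L. (\<Sum>p | I p l. x p)\<^sup>2) - (\<Sum>p\<in>P. (x p)\<^sup>2)"
proof -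
  have "(\<Sum>l\<in>L. (\<Sum>p | I p l. x p)\<^sup>2) = (\<Sum>p\<in>P. \<Sum>q\<in>P. int (card {l. I p l \<and> I q l}) * x p * x q)"
    using finite_points finite_lines incident_in by (intro sum_of_squares_incidence)
  moreover have "(\<Sum>p\<in>P. (x p)\<^sup>2) = (\<Sum>p\<in>P. \<Sum>q\<in>P. (if p = q then 1 else 0) * x p * x q)"
    using finite_points by (simp add: power2_eq_square if_distrib[of "\<lambda>z. z * _"] cong: if_cong)
  ultimately show ?thesis
    by (simp add: K_def left_diff_distrib sum_subtractf)
qed

sublocale positive_form P K
proof
  show "finite P" by (rule finite_points)
  show "K p q = K q p" for p q by (simp add: K_def conj_commute eq_commute)
  show "0 < (\<Sum>p\<in>P. \<Sum>q\<in>P. K p q * x p * x q)" if "p \<in> P" "x p \<noteq> 0" for p and x :: "'p \<Rightarrow> int"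
    using expanding_points[of p x] that by (simp add: quadratic_form_eq)
qed

lemma dual: "incidence L P (\<lambda>l p. I p l)"
  using finite_points finite_lines incident_in card_lines_le card_points_le expanding_points expanding_lines
  by unfold_locales auto

lemma K_self: "K p p = int (card {l. I p l}) - 1"
  by (simp add: K_def)

lemma K_self_le: "p \<in> P \<Longrightarrow> K p p \<le> 2"
  using card_lines_le[of p] by (simp add: K_self)

lemma K_self_pos: "p \<in> P \<Longrightarrow> 1 \<le> K p p"
  using B_pos_point[of p "e p"] by (simp add: B_e e_def)

lemma card_lines_ge_2: "p \<in> P \<Longrightarrow> 2 \<le> card {l. I p l}"
  using K_self_pos[of p] by (simp add: K_self)

text \<open>
  This is positivity on the difference of two unit vectors.
\<close>

lemma K_pair_bound:
  assumes "p \<in> P" "q \<in> P" "p \<noteq> q"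
  shows "2 * K p q < K p p + K q q"
proof -
  have "B (e p - e q) (e p - e q) = K p p + K q q - 2 * K p q"
    using assms by (simp add: B_simps B_e K_sym[of q p])
  moreover have "(e p - e q) p = 1" using assms by (simp add: e_def)
  ultimately show ?thesis using B_pos_point[of p "e p - e q"] assms by simp
qed

text \<open>
  Since \<open>K p p\<close> and \<open>K q q\<close> are at most 2, there is no room for a second common line.
\<close>

lemma K_incident:
  assumes "I p l" "I q l" "p \<noteq> q"
  shows "K p q = 1"
proof -
  have P: "p \<in> P" "q \<in> P" using assms incident_in by blast+
  have "finite {l. I p l \<and> I q l}" using finite_lines_of[of p] by (rule finite_subset[rotated]) blast
  then have "card {l. I p l \<and> I q l} \<noteq> 0" using assms by auto
  then show ?thesis
    using K_pair_bound[OF P assms(3)] K_self_le[OF P(1)] K_self_le[OF P(2)] assms(3) by (simp add: K_def)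
qed

lemma line_unique:
  assumes "I p l" "I q l" "I p m" "I q m" "p \<noteq> q"
  shows "l = m"
proof (rule ccontr)
  assume "l \<noteq> m"
  have "finite {l. I p l \<and> I q l}" using finite_lines_of[of p] by (rule finite_subset[rotated]) blast
  then have "card {l, m} \<le> card {l. I p l \<and> I q l}" using assms by (intro card_mono) auto
  then show False using K_incident[OF assms(1,2,5)] assms(5) \<open>l \<noteq> m\<close> by (simp add: K_def)
qed

lemma K_0: "p \<noteq> q \<Longrightarrow> (\<And>l. I p l \<Longrightarrow> I q l \<Longrightarrow> False) \<Longrightarrow> K p q = 0"
proof -
  assume "p \<noteq> q" "\<And>l. I p l \<Longrightarrow> I q l \<Longrightarrow> False"
  moreover from this have "card {l. I p l \<and> I q l} = 0" by (metis (mono_tags) Collect_empty_eq card.empty)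
  ultimately show ?thesis by (simp only: K_def) simp
qed

lemma no_two_short_points:
  assumes "I p l" "I q l" "p \<noteq> q"
  shows "card {l. I p l} \<noteq> 2 \<or> card {l. I q l} \<noteq> 2"
  using K_pair_bound[of p q] K_incident[OF assms] assms incident_in by (auto simp: K_self)

lemma card_points_ge_2:
  assumes "l \<in> L"
  shows "2 \<le> card {p. I p l}"
  using incidence.card_lines_ge_2[OF dual assms] .

text \<open>
  The test vectors that exclude a point \<open>a\<close> on only two lines \<open>l\<close> and \<open>m\<close>, if \<open>m\<close> has three points \<open>a, q, q'\<close>.  For a
  further point \<open>p\<close> of \<open>l\<close>, the vector \<open>p + q - 2 a\<close> shows that \<open>p\<close> and \<open>q\<close> are joined by a line,
  and \<open>x + 2 a - p - q\<close> shows that this line has no third point \<open>x\<close>.  The same holds for \<open>q'\<close>, but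
  two lines with two points each cannot meet.
\<close>

lemma no_short_point_on_long_line:
  assumes a: "a \<in> P" "{l. I a l} = {l, m}" "l \<noteq> m" and m: "card {p. I p m} = 3"
  shows False
proof -
  have al: "I a l" "I a m" using a by blast+
  have Kaa: "K a a = 1" using a(2,3) by (simp add: K_self)
  have "card {p. I p l} \<ge> 2" using card_points_ge_2 al incident_in by blast
  then have "{p. I p l} \<noteq> {a}" by (metis card.empty card.insert empty_iff finite.emptyI not_less_eq_eq numeral_2_eq_2 le_refl)
  then obtain p where p: "I p l" "p \<noteq> a" using al by blast
  have "card ({p. I p m} - {a}) = 2" using m al finite_points_of by simp
  then obtain q q' where qq: "{p. I p m} - {a} = {q, q'}" "q \<noteq> q'" by (auto simp: card_2_iff)
  then have q: "I q m" "q \<noteq> a" "I q' m" "q' \<noteq> a" by blast+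
  have pm: "\<not> I p m" and lq: "\<not> I r l" if "I r m" "r \<noteq> a" for r
    using line_unique[of a l _ m] al p that a(3) by blast+
  have pm: "\<not> I p m" using pm q by blast
  have P: "a \<in> P" "p \<in> P" using a p incident_in by blast+
  have Kap: "K a p = 1" using K_incident al p by blast
  have joined: "\<exists>n. I p n \<and> I r n" if r: "I r m" "r \<noteq> a" for r
  proof (rule ccontr)
    assume "\<not> ?thesis"
    then have "K p r = 0" using K_0[of p r] r pm by blast
    moreover have "r \<in> P" "K a r = 1" using r incident_in al K_incident by blast+
    ultimately have "B (e p + e r - e a - e a) (e p + e r - e a - e a) \<le> 0"
      using P Kaa Kap K_self_le[of p] K_self_le[of r]
      by (simp only: B_simps) (simp add: B_e K_sym[of r p] K_sym[of p a] K_sym[of r a])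
    moreover have "(e p + e r - e a - e a) a = - 2" using p(2) r by (simp add: e_def)
    ultimately show False using B_pos_point[of a "e p + e r - e a - e a"] a(1) by simp
  qed
  have long: False if r: "I r m" "r \<noteq> a" and n: "I p n" "I r n" "card {s. I s n} \<noteq> 2" for r n
  proof -
    have rp: "r \<noteq> p" using r pm by blast
    have "card {s. I s n} = 3"
      using n card_points_ge_2[of n] card_points_le[of n] incident_in[of p n] by linarith
    have "{p, r} \<noteq> {s. I s n}" using rp n(3) by (metis card_2_iff)
    then obtain x where x: "I x n" "x \<noteq> p" "x \<noteq> r" using n by blast
    have nl: "n \<noteq> l" "n \<noteq> m" using n r lq pm by blast+
    have xa: "x \<noteq> a" using x(1) a(2) nl by blast
    have "\<not> I x l" "\<not> I x m"
      using line_unique[of x l p n] line_unique[of x m r n] x p r n nl by blast+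
    moreover have "k = l \<or> k = m" if "I a k" for k using a(2) that by blast
    ultimately have "K x a = 0" using K_0[OF xa] by blast
    moreover have "K x p = 1" "K x r = 1" "K p r = 1" "K a r = 1" "r \<in> P" "x \<in> P"
      using K_incident x n r rp al incident_in by blast+
    ultimately have "B (e x + e a + e a - e p - e r) (e x + e a + e a - e p - e r) \<le> 0"
      using P Kaa Kap K_self_le[of p] K_self_le[of r] K_self_le[of x]
      by (simp only: B_simps) (simp add: B_e K_sym[of r p] K_sym[of p a] K_sym[of r a] K_sym[of p x] K_sym[of r x] K_sym[of a x])
    moreover have "(e x + e a + e a - e p - e r) x = 1" using x xa by (simp add: e_def)
    ultimately show False using B_pos_point[of x "e x + e a + e a - e p - e r"] \<open>x \<in> P\<close> by simp
  qed
  obtain n n' where n: "I p n" "I q n" "I p n'" "I q' n'" using joined q by blast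
  have "n \<noteq> n'" using line_unique[of q m q' n] q qq(2) n pm by blast
  moreover have "card {s. I s n} = 2" "card {s. I s n'} = 2" using long q n by blast+
  ultimately show False using incidence.no_two_short_points[OF dual n(1,3)] by blast
qed

lemma card_lines_of_point:
  assumes "p \<in> P"
  shows "card {l. I p l} = 3"
proof (rule ccontr)
  assume "card {l. I p l} \<noteq> 3"
  then have "card {l. I p l} = 2" using card_lines_ge_2 card_lines_le assms by fastforce
  then obtain l m where lm: "{l. I p l} = {l, m}" "l \<noteq> m" by (auto simp: card_2_iff)
  then have "I p l" "I p m" by blast+
  then have "card {p. I p l} \<noteq> 2 \<or> card {p. I p m} \<noteq> 2"
    using incidence.no_two_short_points[OF dual] lm(2) by blast
  moreover have "l \<in> L" "m \<in> L" using \<open>I p l\<close> \<open>I p m\<close> incident_in by blast+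
  ultimately have "card {p. I p l} = 3 \<or> card {p. I p m} = 3"
    using card_points_ge_2[of l] card_points_ge_2[of m] card_points_le[of l] card_points_le[of m] by linarith
  then show False
    using no_short_point_on_long_line[OF assms lm] no_short_point_on_long_line[of p m l] assms lm by (metis insert_commute)
qed

lemma card_points_of_line: "l \<in> L \<Longrightarrow> card {p. I p l} = 3"
  using incidence.card_lines_of_point[OF dual] .

definition T :: "'p \<Rightarrow> 'p \<Rightarrow> 'p \<Rightarrow> bool" where
  "T p q r \<longleftrightarrow> distinct [p, q, r] \<and> (\<exists>l. {s. I s l} = {p, q, r})"

lemma T_I: "I p l \<Longrightarrow> I q l \<Longrightarrow> p \<noteq> q \<Longrightarrow> \<exists>r. T p q r \<and> {s. I s l} = {p, q, r}"
proof -
  assume pq: "I p l" "I q l" "p \<noteq> q"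
  have "card ({s. I s l} - {p, q}) = 1"
    using card_points_of_line[of l] pq incident_in finite_points_of by (simp add: card_Diff_subset)
  then obtain r where "{s. I s l} - {p, q} = {r}" by (metis card_1_singletonE)
  moreover have "{s. I s l} = ({s. I s l} - {p, q}) \<union> {p, q}" "r \<in> {r}" using pq by auto
  ultimately have r: "{s. I s l} = {p, q, r}" "r \<noteq> p" "r \<noteq> q" by auto
  then show ?thesis using pq(3) unfolding T_def by (intro exI[of _ r]) auto
qed

text \<open>
  The dual of the absence of induced 4-cycles.
\<close>

lemma intersecting_lines_chord:
  assumes "I p1 l1" "I p1 l2" "I p2 l2" "I p2 l3" "I p3 l3" "I p3 l4" "I p4 l4" "I p4 l1"
    and "distinct [l1, l2, l3, l4]"
  shows "(\<exists>p. I p l1 \<and> I p l3) \<or> (\<exists>p. I p l2 \<and> I p l4)"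
proof (rule ccontr)
  assume n: "\<not> ?thesis"
  interpret D: incidence L P "\<lambda>l p. I p l" by (rule dual)
  have L: "l1 \<in> L" "l2 \<in> L" "l3 \<in> L" "l4 \<in> L" using assms(1-8) incident_in by metis+
  have k: "D.K l1 l2 = 1" "D.K l2 l3 = 1" "D.K l3 l4 = 1" "D.K l4 l1 = 1"
    using D.K_incident[of p1 l1 l2] D.K_incident[of p2 l2 l3] D.K_incident[of p3 l3 l4]
      D.K_incident[of p4 l4 l1] assms by auto
  have k0: "D.K l1 l3 = 0" "D.K l2 l4 = 0" using D.K_0[of l1 l3] D.K_0[of l2 l4] n assms by auto
  have "D.B (D.e l1 - D.e l2 + D.e l3 - D.e l4) (D.e l1 - D.e l2 + D.e l3 - D.e l4) \<le> 0"
    using L k k0 D.K_self_le[of l1] D.K_self_le[of l2] D.K_self_le[of l3] D.K_self_le[of l4]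
    by (simp add: D.B_simps D.B_e D.K_sym[of l2 l1] D.K_sym[of l3 l2] D.K_sym[of l4 l3]
        D.K_sym[of l1 l4] D.K_sym[of l3 l1] D.K_sym[of l4 l2])
  moreover have "(D.e l1 - D.e l2 + D.e l3 - D.e l4) l1 = 1" using assms(9) by (auto simp: D.e_def)
  ultimately show False using D.B_pos_point[of l1 "D.e l1 - D.e l2 + D.e l3 - D.e l4"] L(1) by simp
qed

end

text \<open>
  Connectedness is expressed on the points alone, through collinearity.
\<close>

locale connected_incidence = incidence +
  assumes connected_points: "S \<subseteq> P \<Longrightarrow> S \<noteq> {} \<Longrightarrow>
    (\<And>p q l. p \<in> S \<Longrightarrow> I p l \<Longrightarrow> I q l \<Longrightarrow> q \<in> S) \<Longrightarrow> S = P"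
begin

sublocale cubic_triple_system P K T
proof
  show "S = P" if "S \<subseteq> P" "S \<noteq> {}" "\<And>p q. p \<in> S \<Longrightarrow> q \<in> P \<Longrightarrow> K p q \<noteq> 0 \<Longrightarrow> q \<in> S" for S
  proof (rule connected_points[OF that(1,2)])
    fix p q l assume pq: "p \<in> S" "I p l" "I q l"
    then show "q \<in> S"
      using that(3)[of p q] K_incident[of p l q] incident_in by (cases "p = q") auto
  qed
  show "K p p = 2" if "p \<in> P" for p using card_lines_of_point[OF that] by (simp add: K_self)
  show "T p q r \<Longrightarrow> p \<in> P" for p q r unfolding T_def using incident_in by blast
  show "T p q r \<Longrightarrow> T q p r" for p q r unfolding T_def by (auto simp: insert_commute)
  show "T p q r \<Longrightarrow> T q r p" for p q r unfolding T_def by (auto simp: insert_commute)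
  show "T p q r \<Longrightarrow> p \<noteq> q" for p q r unfolding T_def by auto
  show "r = s" if r: "T p q r" and s: "T p q s" for p q r s
  proof -
    obtain l m where lm: "{s. I s l} = {p, q, r}" "{t. I t m} = {p, q, s}"
      using r s unfolding T_def by blast
    then have "I p l" "I q l" "I p m" "I q m" by blast+
    then have "l = m" using line_unique r unfolding T_def by auto
    then have "{p, q, r} = {p, q, s}" using lm by simp
    then show ?thesis using r s unfolding T_def by auto
  qed
  show "K p q = (if \<exists>r. T p q r then 1 else 0)" if "p \<in> P" "q \<in> P" "p \<noteq> q" for p q
  proof (cases "\<exists>l. I p l \<and> I q l")
    case True
    then obtain l where l: "I p l" "I q l" by blast
    then show ?thesis using K_incident[OF l] T_I[OF l] that(3) by auto
  next
    case False
    moreover from this have "\<not> T p q r" for r unfolding T_def by blast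
    ultimately show ?thesis using K_0[of p q] that(3) by auto
  qed
  show "{b, c, x1} \<inter> {b', c', x3} \<noteq> {} \<or> {c, b', x2} \<inter> {c', b, x4} \<noteq> {}"
    if x: "T b c x1" "T c b' x2" "T b' c' x3" "T c' b x4"
      and d: "distinct [{b, c, x1}, {c, b', x2}, {b', c', x3}, {c', b, x4}]" for b c x1 b' x2 c' x3 x4
  proof -
    obtain l1 l2 l3 l4 where l: "{s. I s l1} = {b, c, x1}" "{s. I s l2} = {c, b', x2}"
        "{s. I s l3} = {b', c', x3}" "{s. I s l4} = {c', b, x4}"
      using x unfolding T_def by blast
    have "distinct (map (\<lambda>l. {s. I s l}) [l1, l2, l3, l4])" using d l by simp
    then have "distinct [l1, l2, l3, l4]" by (simp only: distinct_map)
    moreover have "I c l1" "I c l2" "I b' l2" "I b' l3" "I c' l3" "I c' l4" "I b l4" "I b l1"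
      using l by blast+
    ultimately have "(\<exists>p. I p l1 \<and> I p l3) \<or> (\<exists>p. I p l2 \<and> I p l4)"
      by (intro intersecting_lines_chord)
    then have "{s. I s l1} \<inter> {s. I s l3} \<noteq> {} \<or> {s. I s l2} \<inter> {s. I s l4} \<noteq> {}" by blast
    then show ?thesis unfolding l .
  qed
  show "\<exists>a a' b b' c c'. distinct [p, a, a', b, b', c, c'] \<and>
     (\<forall>x y. T p x y \<longleftrightarrow> (x, y) \<in> {(a, a'), (a', a), (b, b'), (b', b), (c, c'), (c', c)})"
    if p: "p \<in> P" for p
  proof -
    obtain l1 l2 l3 where l: "{l. I p l} = {l1, l2, l3}" "l1 \<noteq> l2" "l1 \<noteq> l3" "l2 \<noteq> l3"
      using card_lines_of_point[OF p] by (auto simp: card_3_iff)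
    have "\<exists>a a'. {s. I s l} = {p, a, a'} \<and> distinct [p, a, a']" if "I p l" for l
    proof -
      have "card ({s. I s l} - {p}) = 2"
        using card_points_of_line[of l] that incident_in finite_points_of by simp
      then obtain a a' where "{s. I s l} - {p} = {a, a'}" "a \<noteq> a'" by (auto simp: card_2_iff)
      then have "{s. I s l} = {p, a, a'}" "p \<noteq> a" "p \<noteq> a'" using that by blast+
      then show ?thesis using \<open>a \<noteq> a'\<close> by auto
    qed
    moreover have pl: "I p l1" "I p l2" "I p l3" using l by blast+
    ultimately obtain a a' b b' c c' where s: "{s. I s l1} = {p, a, a'}" "{s. I s l2} = {p, b, b'}"
        "{s. I s l3} = {p, c, c'}" and d: "distinct [p, a, a']" "distinct [p, b, b']" "distinct [p, c, c']"
      by metis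
    have disj: "{x, x'} \<inter> {y, y'} = {}"
      if lm: "{s. I s l} = {p, x, x'}" "{s. I s m} = {p, y, y'}" "l \<noteq> m"
        and "distinct [p, x, x']" "distinct [p, y, y']" for l m x x' y y'
    proof -
      have "z = p" if "z \<in> {x, x'}" "z \<in> {y, y'}" for z
      proof -
        have "I z l" "I p l" "I z m" "I p m" using lm(1,2) that by blast+
        then show ?thesis using line_unique lm(3) by blast
      qed
      then show ?thesis using that(4) by auto
    qed
    have "distinct [p, a, a', b, b', c, c']"
      using d disj[OF s(1,2) l(2) d(1,2)] disj[OF s(1,3) l(3) d(1,3)] disj[OF s(2,3) l(4) d(2,3)] by auto
    moreover have "T p x y \<longleftrightarrow> (x, y) \<in> {(a, a'), (a', a), (b, b'), (b', b), (c, c'), (c', c)}" for x y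
    proof
      assume "T p x y"
      then obtain l where xy: "{s. I s l} = {p, x, y}" "distinct [p, x, y]" unfolding T_def by blast
      then have "l \<in> {l1, l2, l3}" using l(1) by blast
      moreover have "{x, y} = {s. I s l} - {p}" "{a, a'} = {s. I s l1} - {p}"
          "{b, b'} = {s. I s l2} - {p}" "{c, c'} = {s. I s l3} - {p}"
        unfolding xy(1) s using xy(2) d by auto
      ultimately have "{x, y} \<in> {{a, a'}, {b, b'}, {c, c'}}" by auto
      then show "(x, y) \<in> {(a, a'), (a', a), (b, b'), (b', b), (c, c'), (c', c)}"
        by (auto simp: doubleton_eq_iff)
    next
      assume "(x, y) \<in> {(a, a'), (a', a), (b, b'), (b', b), (c, c'), (c', c)}"
      then show "T p x y" unfolding T_def using s d by (auto simp: insert_commute)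
    qed
    ultimately show ?thesis by blast
  qed
qed

end

section \<open>The Fano plane\<close>

context connected_incidence
begin

lemma no_lines_if_no_points: "P = {} \<Longrightarrow> L = {}"
proof (rule ccontr)
  assume "P = {}" "L \<noteq> {}"
  then obtain l where "l \<in> L" by blast
  moreover have "{p. I p l} = {}" using \<open>P = {}\<close> incident_in by blast
  ultimately show False using card_points_of_line[of l] by simp
qed

text \<open>
  Three pairwise collinear triples through \<open>v\<close> and one line \<open>a b c\<close> that avoids \<open>v\<close> determine the other three lines, because
  any two points are joined by exactly one line.  The numbering matches the translates of \<open>{0, 1, 3}\<close> modulo 7.
\<close>

theorem fano_coordinates:
  assumes "P \<noteq> {}"
  obtains f where "bij_betw f fano_points P" "\<And>A. A \<in> fano_lines \<Longrightarrow> \<exists>l\<in>L. {p. I p l} = f ` A"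
proof -
  have all: "\<exists>r. T p q r" if "p \<in> P" "q \<in> P" "p \<noteq> q" for p q
    using all_collinear[OF that] by (simp add: col_def)
  obtain v where "v \<in> P" using assms by blast
  then obtain a a' b b' d d' where s: "star v a a' b b' d d'" using star_exists by blast
  have P_eq: "P = {v, a, a', b, b', d, d'}"
    using star_in[OF s] star_col[OF s] all_collinear[OF \<open>v \<in> P\<close>] by blast
  have mate: "r \<noteq> v \<and> r \<noteq> p \<and> r \<noteq> q \<and> r \<noteq> p' \<and> r \<noteq> q'"
    if "T p q r" "T v p p'" "T v q q'" "p \<noteq> q'" "q \<noteq> p'" for p q r p' q'
    using that T_unique T_perms T_distinct by metis
  have third: "T p q r \<or> T p q r'"
    if s: "star v p p' q q' r r'" for p p' q q' r r'
  proof -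
    note d = star_distinct[OF s] and T = star_T[OF s]
    have "P = {v, p, p', q, q', r, r'}"
      using star_in[OF s] star_col[OF s] all_collinear[OF \<open>v \<in> P\<close>] by blast
    moreover obtain x where x: "T p q x" using all[of p q] star_in[OF s] d by auto
    moreover have "x \<in> P" using x T_perms T_in by blast
    moreover have "x \<noteq> v \<and> x \<noteq> p \<and> x \<noteq> q \<and> x \<noteq> p' \<and> x \<noteq> q'"
      using mate[OF x] T d by auto
    ultimately show ?thesis by blast
  qed
  obtain c c' where s: "star v a a' b b' c c'" and abc: "T a b c"
    using third[OF s] s star_perms by metis
  note d = star_distinct[OF s] and T = star_T[OF s]
  have other: "T p q' r'" if "star v p p' q q' r r'" "T p q r" for p p' q q' r r'
  proof -
    have "star v p p' q' q r r'" using that(1) star_perms by metis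
    then have "T p q' r \<or> T p q' r'" by (rule third)
    moreover have "\<not> T p q' r"
    proof
      assume "T p q' r"
      then have "q = q'" using that(2) T_unique T_perms by metis
      then show False using star_distinct[OF that(1)] by simp
    qed
    ultimately show ?thesis by blast
  qed
  have ab'c': "T a b' c'" using other[OF s abc] .
  have "star v b b' a a' c c'" using s star_perms by metis
  then have ba'c': "T b a' c'" using other abc T_perms by blast
  have "star v a' a b b' c' c" using s star_perms by metis
  then have a'b'c: "T a' b' c" using other ba'c' T_perms by blast
  define f where "f i = [v, a, b, a', c, c', b'] ! i" for i :: nat
  have "bij_betw f {..<7} (set [v, a, b, a', c, c', b'])"
    unfolding f_def using d by (intro bij_betw_nth) auto
  moreover have "P = set [v, a, b, a', c, c', b']"
    using star_in[OF s] star_col[OF s] all_collinear[OF \<open>v \<in> P\<close>] by auto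
  ultimately have bij: "bij_betw f fano_points P"
    by (simp add: fano_points_def lessThan_atLeast0)
  have f: "f 0 = v" "f 1 = a" "f 2 = b" "f 3 = a'" "f 4 = c" "f 5 = c'" "f 6 = b'"
    by (simp_all add: f_def)
  have "\<exists>l\<in>L. {p. I p l} = f ` A" if "A \<in> fano_lines" for A
  proof -
    have line: "\<exists>l\<in>L. {p. I p l} = {p, q, r}" if "T p q r" for p q r
      using that incident_in unfolding T_def by blast
    have "T v a a'" "T v b b'" "T v c c'" using T by blast+
    then have Ts: "T v a a'" "T a b c" "T b a' c'" "T a' c b'" "T c c' v" "T c' b' a" "T b' v b"
      using abc ba'c' T_perms[OF a'b'c] T_perms[OF ab'c'] T_perms by blast+
    have lines: "\<exists>l\<in>L. {p. I p l} = {f 0, f 1, f 3}" "\<exists>l\<in>L. {p. I p l} = {f 1, f 2, f 4}"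
      "\<exists>l\<in>L. {p. I p l} = {f 2, f 3, f 5}" "\<exists>l\<in>L. {p. I p l} = {f 3, f 4, f 6}"
      "\<exists>l\<in>L. {p. I p l} = {f 4, f 5, f 0}" "\<exists>l\<in>L. {p. I p l} = {f 5, f 6, f 1}"
      "\<exists>l\<in>L. {p. I p l} = {f 6, f 0, f 2}"
      unfolding f by (rule line, rule Ts)+
    have "A = {0,1,3} \<or> A = {1,2,4} \<or> A = {2,3,5} \<or> A = {3,4,6} \<or> A = {4,5,0} \<or> A = {5,6,1} \<or> A = {6,0,2}"
      using that unfolding fano_lines_eq by simp
    then show ?thesis
      by (elim disjE; simp only: image_insert image_empty lines)
  qed
  then show ?thesis using that bij by blast
qed

end

section \<open>Rayleigh quotients\<close>

text \<open>
  The squared norm of the image of \<open>x\<close> under the adjacency operator of the graph \<open>(V, R)\<close>.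
\<close>

definition energy :: "'a set \<Rightarrow> ('a \<Rightarrow> 'a \<Rightarrow> bool) \<Rightarrow> ('a \<Rightarrow> real) \<Rightarrow> real" where
  "energy V R x = (\<Sum>u\<in>V. (\<Sum>w | w \<in> V \<and> R u w. x w)\<^sup>2)"

definition norm2 :: "'a set \<Rightarrow> ('a \<Rightarrow> real) \<Rightarrow> real" where
  "norm2 V x = (\<Sum>u\<in>V. (x u)\<^sup>2)"

lemma linear_coefficient_zero:
  fixes b c :: real
  assumes "\<And>t. 0 \<le> 2 * t * b + t\<^sup>2 * c" "0 \<le> c"
  shows "b = 0"
proof (rule ccontr)
  assume "b \<noteq> 0"
  have "0 \<le> 2 * (- b / (c + 1)) * b + (- b / (c + 1))\<^sup>2 * c" by (rule assms(1))
  also have "\<dots> = - (b\<^sup>2 * (c + 2)) / (c + 1)\<^sup>2"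
    using assms(2) by (simp add: power2_eq_square divide_simps) (simp add: algebra_simps)
  also have "\<dots> < 0"
    using assms(2) \<open>b \<noteq> 0\<close> by (intro divide_neg_pos) (auto intro!: mult_pos_pos)
  finally show False by simp
qed

text \<open>
  The vectors that vanish outside \<open>V\<close> and have norm 1 form a compact set in the product topology.
\<close>

lemma minimal_energy_exists:
  assumes V: "finite V" "V \<noteq> {}"
  obtains x where "norm2 V x = 1" "\<And>y. energy V R x * norm2 V y \<le> energy V R y"
proof -
  define C :: "('a \<Rightarrow> real) set" where "C = PiE UNIV (\<lambda>v. if v \<in> V then {- 1..1} else {0})"
  define S where "S = C \<inter> {x. norm2 V x = 1}"
  have in_S: "x \<in> S" if "norm2 V x = 1" "\<And>v. v \<in> V \<Longrightarrow> \<bar>x v\<bar> \<le> 1" "\<And>v. v \<notin> V \<Longrightarrow> x v = 0" for x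
    using that by (auto simp: S_def C_def abs_le_iff minus_le_iff)
  have "compact C"
    unfolding C_def compactin_euclidean_iff[symmetric] euclidean_product_topology[symmetric] compactin_PiE
    by auto
  moreover have "continuous_on UNIV (norm2 V)"
    unfolding norm2_def by (intro continuous_intros continuous_on_product_coordinates)
  then have "closed (norm2 V -` {1})"
    by (intro closed_vimage closed_singleton)
  then have "closed {x. norm2 V x = 1}"
    by (simp add: vimage_def)
  ultimately have "compact S" unfolding S_def by (rule compact_Int_closed)
  moreover have "S \<noteq> {}"
  proof -
    obtain v where "v \<in> V" using V by blast
    then have "(\<lambda>u. if u = v then 1 else 0) \<in> S"
      using V(1) by (intro in_S) (auto simp: norm2_def if_distrib[of "\<lambda>z. z\<^sup>2"] cong: if_cong)
    then show ?thesis by blast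
  qed
  moreover have "continuous_on S (energy V R)"
    unfolding energy_def
    by (rule continuous_on_subset[of UNIV])
       (intro continuous_intros continuous_on_product_coordinates, simp)
  ultimately obtain x where x: "x \<in> S" "\<forall>y\<in>S. energy V R x \<le> energy V R y"
    using continuous_attains_inf by blast
  have "energy V R x * norm2 V y \<le> energy V R y" for y
  proof (cases "norm2 V y = 0")
    case True
    then show ?thesis by (simp add: energy_def sum_nonneg)
  next
    case False
    then have pos: "0 < norm2 V y" by (simp add: norm2_def sum_nonneg order_less_le)
    define z where "z v = (if v \<in> V then y v / sqrt (norm2 V y) else 0)" for v
    have "norm2 V z = norm2 V y / norm2 V y"
      unfolding norm2_def[of V z] z_def using pos
      by (simp add: power_divide norm2_def sum_divide_distrib[symmetric])
    then have z1: "norm2 V z = 1" using pos by simp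
    have "\<bar>z v\<bar> \<le> 1" if "v \<in> V" for v
    proof -
      from that have "(z v)\<^sup>2 \<le> norm2 V z" unfolding norm2_def using V(1) by (intro member_le_sum) auto
      then show ?thesis using z1 by (simp add: abs_square_le_1)
    qed
    then have "z \<in> S" using z1 by (intro in_S) (auto simp: z_def)
    then have "energy V R x \<le> energy V R z" using x(2) by blast
    also have "energy V R z = energy V R y / norm2 V y"
    proof -
      have "(\<Sum>w | w \<in> V \<and> R u w. z w) = (\<Sum>w | w \<in> V \<and> R u w. y w) / sqrt (norm2 V y)" for u
        unfolding sum_divide_distrib by (intro sum.cong) (auto simp: z_def)
      then show ?thesis using pos
        by (simp only: energy_def power_divide sum_divide_distrib[symmetric] real_sqrt_pow2 less_imp_le)
    qed
    finally show ?thesis using pos by (simp add: pos_le_divide_eq)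
  qed
  moreover have "norm2 V x = 1" using x(1) by (simp add: S_def)
  ultimately show ?thesis using that by blast
qed

text \<open>
  The minimum \<open>\<mu>\<close> of the Rayleigh quotient of \<open>A\<^sup>2\<close> is at most \<open>s\<^sup>2\<close> and is attained at an eigenvector \<open>m\<close> of \<open>A\<^sup>2\<close>.
  Since \<open>(A - sqrt \<mu>) (A + sqrt \<mu>) m = 0\<close>, one of \<open>sqrt \<mu>\<close> and \<open>- sqrt \<mu>\<close> is an eigenvalue of \<open>A\<close>.
\<close>

theorem small_eigenvalue_exists:
  assumes V: "finite V" and sym: "\<And>u w. R u w \<Longrightarrow> R w u"
    and x: "v \<in> V" "x v \<noteq> 0" "energy V R x \<le> s\<^sup>2 * norm2 V x" and s: "0 \<le> s"
  obtains c y v where "\<bar>c\<bar> \<le> s" "v \<in> V" "y v \<noteq> 0"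
    "\<And>u. u \<in> V \<Longrightarrow> (\<Sum>w | w \<in> V \<and> R u w. y w) = c * y u"
proof -
  define A where "A z u = (\<Sum>w | w \<in> V \<and> R u w. z w)" for z :: "_ \<Rightarrow> real" and u
  have A_alt: "A z u = (\<Sum>w\<in>V. if R u w then z w else 0)" for z u
    unfolding A_def using V by (simp add: sum.inter_filter)
  have E: "energy V R z = (\<Sum>u\<in>V. (A z u)\<^sup>2)" for z by (simp add: energy_def A_def)
  have A_lin: "A (\<lambda>w. a * z w + b * z' w) u = a * A z u + b * A z' u" for a b z z' u
    by (simp add: A_def sum.distrib sum_distrib_left)
  have A_adj: "(\<Sum>u\<in>V. A z u * A z' u) = (\<Sum>u\<in>V. A (A z) u * z' u)" for z z'
  proof -
    have "(\<Sum>u\<in>V. A z u * A z' u) = (\<Sum>u\<in>V. \<Sum>w\<in>V. if R u w then A z u * z' w else 0)"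
      by (simp add: A_alt[of z'] sum_distrib_left if_distrib[of "\<lambda>t. _ * t"] cong: if_cong)
    also have "\<dots> = (\<Sum>w\<in>V. \<Sum>u\<in>V. if R u w then A z u * z' w else 0)" by (rule sum.swap)
    also have "\<dots> = (\<Sum>w\<in>V. \<Sum>u\<in>V. if R w u then A z u * z' w else 0)"
      using sym by (intro sum.cong) auto
    also have "\<dots> = (\<Sum>w\<in>V. A (A z) w * z' w)"
      by (simp add: A_alt[of "A z"] sum_distrib_right if_distrib[of "\<lambda>t. t * _"] cong: if_cong)
    finally show ?thesis .
  qed
  obtain m where m: "norm2 V m = 1" "\<And>y. energy V R m * norm2 V y \<le> energy V R y"
    using minimal_energy_exists[OF V] x(1) by (metis empty_iff)
  define \<mu> where "\<mu> = energy V R m"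
  have \<mu>0: "0 \<le> \<mu>" by (simp add: \<mu>_def energy_def sum_nonneg)
  have Npos: "0 < norm2 V x"
    unfolding norm2_def using V x by (intro sum_pos2[of _ v]) auto
  have "\<mu> * norm2 V x \<le> s\<^sup>2 * norm2 V x" using m(2)[of x] x(3) by (simp add: \<mu>_def)
  then have \<mu>s: "\<mu> \<le> s\<^sup>2" using Npos by simp
  have AA: "A (A m) u = \<mu> * m u" if "u \<in> V" for u
  proof -
    define y where "y u = A (A m) u - \<mu> * m u" for u
    \<comment> \<open>The energy minus \<open>\<mu>\<close> times the squared norm is nonnegative and vanishes at \<open>m\<close>, so its derivative at \<open>m\<close> in
      the direction \<open>y\<close> is 0.\<close>
    have "(\<Sum>u\<in>V. A m u * A y u) - \<mu> * (\<Sum>u\<in>V. m u * y u) = 0"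
    proof (rule linear_coefficient_zero)
      show "0 \<le> energy V R y - \<mu> * norm2 V y" using m(2)[of y] by (simp add: \<mu>_def)
      fix t :: real
      let ?z = "\<lambda>u. 1 * m u + t * y u"
      have "energy V R ?z = \<mu> + 2 * t * (\<Sum>u\<in>V. A m u * A y u) + t\<^sup>2 * energy V R y"
        unfolding E A_lin \<mu>_def
        by (simp add: power2_sum sum.distrib sum_distrib_left power_mult_distrib mult_ac)
      moreover have "norm2 V ?z = 1 + 2 * t * (\<Sum>u\<in>V. m u * y u) + t\<^sup>2 * norm2 V y"
        using m(1) unfolding norm2_def
        by (simp add: power2_sum sum.distrib sum_distrib_left power_mult_distrib mult_ac)
      ultimately show "0 \<le> 2 * t * ((\<Sum>u\<in>V. A m u * A y u) - \<mu> * (\<Sum>u\<in>V. m u * y u)) +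
          t\<^sup>2 * (energy V R y - \<mu> * norm2 V y)"
        using m(2)[of ?z] unfolding \<mu>_def[symmetric] by (simp add: algebra_simps)
    qed
    moreover have "(y u)\<^sup>2 = A (A m) u * y u - \<mu> * (m u * y u)" for u
      by (simp add: y_def power2_eq_square algebra_simps)
    ultimately have "(\<Sum>u\<in>V. (y u)\<^sup>2) = 0"
      by (simp only: sum_subtractf A_adj sum_distrib_left)
    then show ?thesis using V that by (simp add: sum_nonneg_eq_0_iff y_def)
  qed
  have "\<exists>v'\<in>V. m v' \<noteq> 0"
  proof (rule ccontr)
    assume "\<not> ?thesis"
    then show False using m(1) by (simp add: norm2_def)
  qed
  then obtain v' where v': "v' \<in> V" "m v' \<noteq> 0" by blast
  have sq: "sqrt \<mu> \<le> s" using \<mu>s s by (simp add: real_le_lsqrt)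
  show ?thesis
  proof (cases "\<exists>v\<in>V. A m v + sqrt \<mu> * m v \<noteq> 0")
    case True
    then obtain v where v: "v \<in> V" "A m v + sqrt \<mu> * m v \<noteq> 0" by blast
    define y where "y = (\<lambda>u. 1 * A m u + sqrt \<mu> * m u)"
    have "A y u = sqrt \<mu> * y u" if "u \<in> V" for u
      unfolding y_def A_lin using AA[OF that] \<mu>0 by (simp add: algebra_simps)
    then show ?thesis using that[of "sqrt \<mu>" v y] v sq \<mu>0 by (auto simp: A_def y_def)
  next
    case False
    then have "A m u = - sqrt \<mu> * m u" if "u \<in> V" for u using that by (simp add: add_eq_0_iff)
    then show ?thesis using that[of "- sqrt \<mu>" v' m] v' sq \<mu>0 by (auto simp: A_def)
  qed
qed

section \<open>Median eigenvalues of bipartite graphs\<close>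

text \<open>
  If \<open>p (- x) = c p x\<close>, then a power of \<open>x - a\<close> that divides \<open>p\<close> gives the same power of \<open>x + a\<close>.
\<close>

lemma order_reflected:
  fixes p :: "real poly"
  assumes refl: "pcompose p [:0, - 1:] = Polynomial.smult c p" and c: "c \<noteq> 0" and p: "p \<noteq> 0"
  shows "order (- a) p = order a p"
proof -
  have le: "order a p \<le> order (- a) p" for a
  proof -
    obtain q where q: "p = [:- a, 1:] ^ order a p * q"
      using order_divides[of a "order a p" p] by (auto elim: dvdE)
    have pw: "pcompose (r ^ k) s = pcompose r s ^ k" for r s :: "real poly" and k
      by (induction k) (simp_all add: pcompose_mult pcompose_1)
    have "Polynomial.smult c p = pcompose ([:- a, 1:] ^ order a p * q) [:0, - 1:]"
      using refl q by simp
    also have "\<dots> = (- [:a, 1:]) ^ order a p * pcompose q [:0, - 1:]"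
      by (simp add: pcompose_mult pw pcompose_pCons)
    also have "\<dots> = [:a, 1:] ^ order a p * ((- 1) ^ order a p * pcompose q [:0, - 1:])"
      by (subst power_minus) (simp add: mult_ac)
    finally have "[:a, 1:] ^ order a p dvd Polynomial.smult c p" by (metis dvd_triv_left)
    then have "[:- (- a), 1:] ^ order a p dvd p" using c by (simp add: dvd_smult_iff)
    then show ?thesis using p order_divides[of "- a" "order a p" p] by simp
  qed
  from le[of a] le[of "- a"] show ?thesis by simp
qed

text \<open>
  The diagonal matrix of the signs \<open>\<sigma>\<close> is its own inverse and conjugates \<open>- A\<close> to \<open>A\<close>.
\<close>

lemma char_poly_anti_similar:
  fixes A :: "real mat" and \<sigma> :: "nat \<Rightarrow> real"
  assumes A: "A \<in> carrier_mat n n" and s: "\<And>i. i < n \<Longrightarrow> \<sigma> i = 1 \<or> \<sigma> i = - 1"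
    and flip: "\<And>i j. i < n \<Longrightarrow> j < n \<Longrightarrow> A $$ (i, j) \<noteq> 0 \<Longrightarrow> \<sigma> i = - \<sigma> j"
  shows "pcompose (char_poly A) [:0, - 1:] = Polynomial.smult ((- 1) ^ n) (char_poly A)"
proof -
  let ?D = "mat_diag n \<sigma>"
  have D: "?D \<in> carrier_mat n n" by simp
  have sq: "\<sigma> i * \<sigma> i = 1" if "i < n" for i using s[OF that] by auto
  have DD: "?D * ?D = 1\<^sub>m n"
    unfolding mat_diag_mult_left[OF D] by (rule eq_matI) (use sq in \<open>auto simp: mat_diag_def\<close>)
  have "?D * (- A) * ?D = A"
  proof (rule eq_matI)
    fix i j assume "i < dim_row A" "j < dim_col A"
    then have ij: "i < n" "j < n" using A by auto
    have "(?D * (- A) * ?D) $$ (i, j) = - (\<sigma> i * A $$ (i, j) * \<sigma> j)"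
      using A ij by (simp add: mat_diag_mult_left[of _ n n] mat_diag_mult_right[of _ n n])
    also have "\<dots> = A $$ (i, j)"
      using s[OF ij(1)] s[OF ij(2)] flip[OF ij] by (cases "A $$ (i, j) = 0") auto
    finally show "(?D * (- A) * ?D) $$ (i, j) = A $$ (i, j)" .
  qed (use A in \<open>auto simp: mat_diag_def\<close>)
  then have "similar_mat A (- A)"
    using A DD by (intro similar_matI[of _ _ ?D ?D n]) auto
  then have neg: "char_poly (- A) = char_poly A" using char_poly_similar by metis
  show ?thesis
  proof (rule poly_ext)
    fix x
    have "poly (char_poly A) (- x) = det (- 1 \<cdot>\<^sub>m - (char_matrix (- A) x))"
      unfolding char_poly_matrix[OF A] using A
      by (intro arg_cong[of _ _ det]) (auto simp: char_matrix_def intro!: eq_matI)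
    also have "\<dots> = (- 1) ^ n * poly (char_poly (- A)) x"
      using A by (simp add: char_poly_matrix[of _ n] char_matrix_def)
    finally show "poly (pcompose (char_poly A) [:0, - 1:]) x = poly (Polynomial.smult ((- 1) ^ n) (char_poly A)) x"
      by (simp add: poly_pcompose neg)
  qed
qed

text \<open>
  Reversing the list changes the sign of its entries.  So the two median entries are opposite, and all entries before the first
  are at least its value, while all entries after it are at most the opposite value.
\<close>

lemma antisymmetric_list_median:
  fixes xs :: "real list"
  assumes sorted: "sorted (rev xs)" and refl: "image_mset uminus (mset xs) = mset xs" and ne: "xs \<noteq> []"
  defines "n \<equiv> length xs"
  shows "xs ! (n div 2) = - xs ! ((n + 1) div 2 - 1)" and "0 \<le> xs ! ((n + 1) div 2 - 1)"
    and "c \<in> set xs \<Longrightarrow> xs ! ((n + 1) div 2 - 1) \<le> \<bar>c\<bar>"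
proof -
  have n: "0 < n" using ne by (simp add: n_def)
  have desc: "xs ! j \<le> xs ! i" if "i \<le> j" "j < n" for i j
    using sorted that by (auto simp: sorted_rev_iff_nth_mono n_def)
  have "sorted (map uminus xs)"
    using desc by (auto simp: sorted_iff_nth_mono n_def)
  moreover have "mset (map uminus xs) = mset (rev xs)" using refl by simp
  ultimately have "map uminus xs = rev xs"
    using sorted by (metis properties_for_sort)
  then have neg: "- xs ! i = xs ! (n - 1 - i)" if "i < n" for i
  proof -
    have "map uminus xs ! i = rev xs ! i" using \<open>map uminus xs = rev xs\<close> by simp
    moreover have "map uminus xs ! i = - (xs ! i)" using that by (intro nth_map) (simp add: n_def)
    moreover have "rev xs ! i = xs ! (n - 1 - i)" using that by (simp add: rev_nth n_def)
    ultimately show ?thesis by simp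
  qed
  have h: "(n + 1) div 2 - 1 < n" "n - 1 - ((n + 1) div 2 - 1) = n div 2"
    "(n + 1) div 2 - 1 \<le> n div 2" "n div 2 < n" using n by presburger+
  show eq: "xs ! (n div 2) = - xs ! ((n + 1) div 2 - 1)"
    using neg[OF h(1)] h(2) by simp
  then show "0 \<le> xs ! ((n + 1) div 2 - 1)"
    using desc[OF h(3,4)] by simp
  show "xs ! ((n + 1) div 2 - 1) \<le> \<bar>c\<bar>" if c: "c \<in> set xs"
  proof -
    obtain i where i: "i < n" "c = xs ! i" using c by (metis in_set_conv_nth n_def)
    show ?thesis
    proof (cases "i \<le> (n + 1) div 2 - 1")
      case True
      then show ?thesis using desc[OF True h(1)] i by simp
    next
      case False
      then have "n div 2 \<le> i" by presburger
      then show ?thesis using desc[of "n div 2" i] i eq by simp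
    qed
  qed
qed

lemma median_indices:
  "lower_median n = (n + 1) div 2" "upper_median n = n div 2 + 1"
proof -
  have "\<lfloor>real (n + 1) / real 2\<rfloor> = int ((n + 1) div 2)"
    by (rule floor_divide_of_nat_eq)
  moreover have "real (n + 1) / real 2 = (real n + 1) / 2" by simp
  ultimately have "\<lfloor>(real n + 1) / 2\<rfloor> = int ((n + 1) div 2)" by (simp only:)
  then show "lower_median n = (n + 1) div 2" by (simp only: lower_median_def nat_int)
  have "\<lceil>(real n + 1) / 2\<rceil> = int (n div 2 + 1)"
    by (rule ceiling_unique; cases "even n") (auto elim!: evenE oddE simp: field_simps)
  then show "upper_median n = n div 2 + 1" by (simp only: upper_median_def nat_int)
qed

lemma eigenvalue_adjacency_matrix_iff:
  assumes vs: "distinct vs" "set vs = verts G"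
  shows "eigenvalue (adjacency_matrix G vs) c \<longleftrightarrow>
    (\<exists>y v. v \<in> verts G \<and> y v \<noteq> 0 \<and>
      (\<forall>u\<in>verts G. (\<Sum>w | w \<in> verts G \<and> u \<rightarrow>\<^bsub>G\<^esub> w. y w) = c * y u))"
proof -
  define n where "n = length vs"
  have bij: "bij_betw (\<lambda>i. vs ! i) {..<n} (verts G)"
    using bij_betw_nth[OF vs(1), of "{..<n}" "set vs"] vs by (simp add: n_def)
  have fin: "finite (verts G)" using vs(2) by (metis finite_set)
  have all_verts: "(\<forall>u\<in>verts G. Q u) \<longleftrightarrow> (\<forall>i<n. Q (vs ! i))" for Q
    unfolding vs(2)[symmetric] n_def by (metis in_set_conv_nth)
  have mult: "(adjacency_matrix G vs *\<^sub>v vec n (\<lambda>i. y (vs ! i))) $ i =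
      (\<Sum>w | w \<in> verts G \<and> vs ! i \<rightarrow>\<^bsub>G\<^esub> w. y w)" if "i < n" for i and y :: "_ \<Rightarrow> real"
  proof -
    have "(adjacency_matrix G vs *\<^sub>v vec n (\<lambda>i. y (vs ! i))) $ i =
        (\<Sum>j<n. if vs ! i \<rightarrow>\<^bsub>G\<^esub> vs ! j then y (vs ! j) else 0)"
      using that by (auto simp: adjacency_matrix_def n_def scalar_prod_def lessThan_atLeast0 intro!: sum.cong)
    also have "\<dots> = (\<Sum>w\<in>verts G. if vs ! i \<rightarrow>\<^bsub>G\<^esub> w then y w else 0)"
      by (rule sum.reindex_bij_betw[OF bij])
    also have "\<dots> = (\<Sum>w | w \<in> verts G \<and> vs ! i \<rightarrow>\<^bsub>G\<^esub> w. y w)"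
      using fin by (simp add: sum.inter_filter)
    finally show ?thesis .
  qed
  have "eigenvalue (adjacency_matrix G vs) c \<longleftrightarrow>
    (\<exists>y. vec n (\<lambda>i. y (vs ! i)) \<noteq> 0\<^sub>v n \<and>
       adjacency_matrix G vs *\<^sub>v vec n (\<lambda>i. y (vs ! i)) = c \<cdot>\<^sub>v vec n (\<lambda>i. y (vs ! i)))"
  proof
    assume "eigenvalue (adjacency_matrix G vs) c"
    then obtain v where v: "v \<in> carrier_vec n" "v \<noteq> 0\<^sub>v n" "adjacency_matrix G vs *\<^sub>v v = c \<cdot>\<^sub>v v"
      unfolding eigenvalue_def eigenvector_def by (auto simp: adjacency_matrix_def n_def)
    define y where "y u = v $ (the_inv_into {..<n} (\<lambda>i. vs ! i) u)" for u
    have "vec n (\<lambda>i. y (vs ! i)) = v"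
      using v(1) bij by (intro eq_vecI) (auto simp: y_def bij_betw_def the_inv_into_f_f)
    then show "\<exists>y. vec n (\<lambda>i. y (vs ! i)) \<noteq> 0\<^sub>v n \<and>
       adjacency_matrix G vs *\<^sub>v vec n (\<lambda>i. y (vs ! i)) = c \<cdot>\<^sub>v vec n (\<lambda>i. y (vs ! i))"
      using v by (intro exI[of _ y]) simp
  next
    assume "\<exists>y. vec n (\<lambda>i. y (vs ! i)) \<noteq> 0\<^sub>v n \<and>
       adjacency_matrix G vs *\<^sub>v vec n (\<lambda>i. y (vs ! i)) = c \<cdot>\<^sub>v vec n (\<lambda>i. y (vs ! i))"
    then obtain y :: "_ \<Rightarrow> real" where "vec n (\<lambda>i. y (vs ! i)) \<noteq> 0\<^sub>v n"
       "adjacency_matrix G vs *\<^sub>v vec n (\<lambda>i. y (vs ! i)) = c \<cdot>\<^sub>v vec n (\<lambda>i. y (vs ! i))"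
      by blast
    moreover have "dim_row (adjacency_matrix G vs) = n" by (simp add: adjacency_matrix_def n_def)
    ultimately show "eigenvalue (adjacency_matrix G vs) c"
      unfolding eigenvalue_def eigenvector_def by (intro exI[of _ "vec n (\<lambda>i. y (vs ! i))"]) simp
  qed
  moreover have "vec n (\<lambda>i. y (vs ! i)) \<noteq> 0\<^sub>v n \<longleftrightarrow> (\<exists>v\<in>verts G. y v \<noteq> 0)" for y :: "_ \<Rightarrow> real"
  proof -
    have "vec n (\<lambda>i. y (vs ! i)) = 0\<^sub>v n \<longleftrightarrow> (\<forall>i<n. y (vs ! i) = 0)"
      by (auto simp: vec_eq_iff)
    also have "\<dots> \<longleftrightarrow> (\<forall>v\<in>verts G. y v = 0)"
      by (simp only: all_verts)
    finally show ?thesis by blast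
  qed
  moreover have "adjacency_matrix G vs *\<^sub>v vec n (\<lambda>i. y (vs ! i)) = c \<cdot>\<^sub>v vec n (\<lambda>i. y (vs ! i)) \<longleftrightarrow>
      (\<forall>u\<in>verts G. (\<Sum>w | w \<in> verts G \<and> u \<rightarrow>\<^bsub>G\<^esub> w. y w) = c * y u)" for y :: "_ \<Rightarrow> real"
  proof -
    have "adjacency_matrix G vs *\<^sub>v vec n (\<lambda>i. y (vs ! i)) = c \<cdot>\<^sub>v vec n (\<lambda>i. y (vs ! i)) \<longleftrightarrow>
        (\<forall>i<n. (\<Sum>w | w \<in> verts G \<and> vs ! i \<rightarrow>\<^bsub>G\<^esub> w. y w) = c * y (vs ! i))"
      by (subst vec_eq_iff) (auto simp: mult, auto simp: adjacency_matrix_def n_def)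
    then show ?thesis by (simp only: all_verts)
  qed
  ultimately show ?thesis by blast
qed

lemma bipartite_median_eigenvalue:
  assumes G: "graph G" "verts G \<noteq> {}" "bipartite G"
  shows "lambda_l G = - lambda_h G" and "0 \<le> lambda_h G"
    and "\<exists>y v. v \<in> verts G \<and> y v \<noteq> 0 \<and>
      (\<forall>u\<in>verts G. (\<Sum>w | w \<in> verts G \<and> u \<rightarrow>\<^bsub>G\<^esub> w. y w) = lambda_h G * y u)"
    and "\<lbrakk>v \<in> verts G; y v \<noteq> 0; \<And>u. u \<in> verts G \<Longrightarrow> (\<Sum>w | w \<in> verts G \<and> u \<rightarrow>\<^bsub>G\<^esub> w. y w) = c * y u\<rbrakk>
      \<Longrightarrow> lambda_h G \<le> \<bar>c\<bar>"
proof -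
  interpret graph G by fact
  obtain vs where vs: "distinct vs" "set vs = verts G"
    using finite_distinct_list[OF finite_verts] by blast
  define n where "n = length vs"
  let ?A = "adjacency_matrix G vs" and ?S = "graph_spectrum G"
  have A: "?A \<in> carrier_mat n n" by (simp add: adjacency_matrix_def n_def)
  have n: "n = card (verts G)" using vs distinct_card[OF vs(1)] by (simp add: n_def)
  have len: "length ?S = n" using length_graph_spectrum[OF G(1)] n by simp
  have mS: "mset ?S = proots (char_poly ?A)" using spectrum_eq[OF vs] by simp
  have p0: "char_poly ?A \<noteq> 0" using degree_monic_char_poly[OF A] by auto
  have set_S: "c \<in> set ?S \<longleftrightarrow> eigenvalue ?A c" for c
  proof -
    have "c \<in> set ?S \<longleftrightarrow> c \<in># proots (char_poly ?A)" by (simp flip: mS)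
    then show ?thesis using p0 by (simp add: eigenvalue_root_char_poly[OF A])
  qed
  obtain X Y where XY: "verts G = X \<union> Y" "X \<inter> Y = {}"
      "\<forall>e\<in>arcs G. (tail G e \<in> X \<and> head G e \<in> Y) \<or> (tail G e \<in> Y \<and> head G e \<in> X)"
    using G(3) unfolding bipartite_def by (elim exE conjE)
  define \<sigma> where "\<sigma> i = (if vs ! i \<in> X then 1 else - 1 :: real)" for i
  have flip: "\<sigma> i = - \<sigma> j" if "i < n" "j < n" "?A $$ (i, j) \<noteq> 0" for i j
  proof -
    have "vs ! i \<rightarrow>\<^bsub>G\<^esub> vs ! j" using that by (auto simp: adjacency_matrix_def n_def split: if_splits)
    then have "(vs ! i \<in> X \<and> vs ! j \<in> Y) \<or> (vs ! i \<in> Y \<and> vs ! j \<in> X)"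
      using XY(3) by (auto simp: arcs_ends_conv)
    then show ?thesis using XY(2) by (auto simp: \<sigma>_def)
  qed
  have "pcompose (char_poly ?A) [:0, - 1:] = Polynomial.smult ((- 1) ^ n) (char_poly ?A)"
    by (rule char_poly_anti_similar[OF A _ flip]) (auto simp: \<sigma>_def)
  then have "order (- a) (char_poly ?A) = order a (char_poly ?A)" for a
    by (rule order_reflected) (use p0 in auto)
  moreover have neg_count: "count (image_mset uminus M) (- a) = count M a" for M and a :: real
    by (induction M) auto
  ultimately have "count (image_mset uminus (mset ?S)) (- a) = count (mset ?S) (- a)" for a
    unfolding mS neg_count using p0 by simp
  then have "image_mset uminus (mset ?S) = mset ?S"
    by (metis minus_minus multiset_eqI)
  note med = antisymmetric_list_median[OF sorted_graph_spectrum this, unfolded len]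
  have ne: "?S \<noteq> []" using len n G(2) finite_verts by auto
  have lh: "lambda_h G = ?S ! ((n + 1) div 2 - 1)" "lambda_l G = ?S ! (n div 2)"
    by (simp_all add: lambda_h_def lambda_l_def graph_eigenvalue_def median_indices flip: n)
  show "lambda_l G = - lambda_h G" "0 \<le> lambda_h G" using med(1,2)[OF ne] lh by simp_all
  have "0 < n" using ne len by auto
  then have "(n + 1) div 2 - 1 < n" by presburger
  then have "lambda_h G \<in> set ?S" unfolding lh len[symmetric] by (rule nth_mem)
  then show "\<exists>y v. v \<in> verts G \<and> y v \<noteq> 0 \<and>
      (\<forall>u\<in>verts G. (\<Sum>w | w \<in> verts G \<and> u \<rightarrow>\<^bsub>G\<^esub> w. y w) = lambda_h G * y u)"
    unfolding set_S eigenvalue_adjacency_matrix_iff[OF vs] .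
  show "lambda_h G \<le> \<bar>c\<bar>"
    if "v \<in> verts G" "y v \<noteq> 0" "\<And>u. u \<in> verts G \<Longrightarrow> (\<Sum>w | w \<in> verts G \<and> u \<rightarrow>\<^bsub>G\<^esub> w. y w) = c * y u"
  proof -
    have "c \<in> set ?S" unfolding set_S eigenvalue_adjacency_matrix_iff[OF vs] using that by blast
    then show ?thesis using med(3)[OF ne] lh by simp
  qed
qed

section \<open>Connected components\<close>

text \<open>
  Without parallel arcs, a bijection of the vertices that preserves adjacency determines the map of the arcs.
\<close>

lemma digraph_iso_with_projI:
  assumes C: "wf_digraph C" "nomulti_digraph C"
    and bij: "bij_betw \<phi> (verts C) (pverts H)"
    and adj: "\<And>u v. u \<in> verts C \<Longrightarrow> v \<in> verts C \<Longrightarrow> u \<rightarrow>\<^bsub>C\<^esub> v \<longleftrightarrow> (\<phi> u, \<phi> v) \<in> parcs H"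
    and H: "parcs H \<subseteq> pverts H \<times> pverts H"
  shows "digraph_iso C (with_proj H)"
proof -
  interpret wf_digraph C by fact
  interpret nomulti_digraph C by fact
  define \<psi> where "\<psi> e = (\<phi> (tail C e), \<phi> (head C e))" for e
  define h where "h = \<lparr> iso_verts = \<phi>, iso_arcs = \<psi>, iso_head = snd, iso_tail = fst \<rparr>"
  have inj: "inj_on \<phi> (verts C)" using bij by (simp add: bij_betw_def)
  have "inj_on \<psi> (arcs C)"
  proof (rule inj_onI)
    fix d e assume de: "d \<in> arcs C" "e \<in> arcs C" "\<psi> d = \<psi> e"
    then have "tail C d = tail C e" "head C d = head C e"
      using inj by (auto simp: \<psi>_def inj_on_eq_iff)
    then show "d = e" using de no_multi_arcs by (auto simp: arc_to_ends_def)
  qed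
  then have "digraph_isomorphism h"
    using inj by (simp add: digraph_isomorphism_def h_def \<psi>_def wf_digraph_axioms)
  moreover have "with_proj H = app_iso h C"
  proof -
    have "\<psi> ` arcs C = parcs H"
    proof (intro equalityI subsetI)
      fix a assume "a \<in> \<psi> ` arcs C"
      then obtain e where e: "e \<in> arcs C" "a = \<psi> e" by blast
      then have "tail C e \<rightarrow>\<^bsub>C\<^esub> head C e" by (auto simp: arcs_ends_conv)
      then show "a \<in> parcs H" using adj e by (simp add: \<psi>_def)
    next
      fix a assume a: "a \<in> parcs H"
      then have "a \<in> \<phi> ` verts C \<times> \<phi> ` verts C" using H bij unfolding bij_betw_def by auto
      then obtain u v where uv: "u \<in> verts C" "v \<in> verts C" "a = (\<phi> u, \<phi> v)" by blast
      then have "u \<rightarrow>\<^bsub>C\<^esub> v" using adj a by blast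
      then show "a \<in> \<psi> ` arcs C" using uv(3) by (auto simp: arcs_ends_conv \<psi>_def)
    qed
    then show ?thesis using bij by (simp add: with_proj_def app_iso_def h_def bij_betw_def)
  qed
  ultimately show ?thesis unfolding digraph_iso_def by blast
qed

lemma digraph_iso_vertex_bijection:
  assumes "digraph_iso C H"
  obtains \<phi> where "bij_betw \<phi> (verts C) (verts H)"
    "\<And>u v. u \<in> verts C \<Longrightarrow> v \<in> verts C \<Longrightarrow> u \<rightarrow>\<^bsub>C\<^esub> v \<longleftrightarrow> \<phi> u \<rightarrow>\<^bsub>H\<^esub> \<phi> v"
proof -
  obtain h where h: "pre_digraph.digraph_isomorphism C h" "H = app_iso h C"
    using assms unfolding digraph_iso_def by blast
  interpret wf_digraph C using h(1) by (simp add: pre_digraph.digraph_isomorphism_def)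
  have inj: "inj_on (iso_verts h) (verts C)" using h(1) by (simp add: digraph_isomorphism_def)
  have "u \<rightarrow>\<^bsub>C\<^esub> v \<longleftrightarrow> iso_verts h u \<rightarrow>\<^bsub>H\<^esub> iso_verts h v" if uv: "u \<in> verts C" "v \<in> verts C" for u v
  proof
    assume "iso_verts h u \<rightarrow>\<^bsub>H\<^esub> iso_verts h v"
    then obtain u' v' where u': "u' \<rightarrow>\<^bsub>C\<^esub> v'" "iso_verts h u = iso_verts h u'" "iso_verts h v = iso_verts h v'"
      unfolding h(2) arcs_ends_app_iso_eq[OF h(1)] by auto
    then have "u = u'" "v = v'" using uv inj adj_in_verts[OF u'(1)] by (auto simp: inj_on_eq_iff)
    then show "u \<rightarrow>\<^bsub>C\<^esub> v" using u' by simp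
  qed (auto simp: h(2) arcs_ends_app_iso_eq[OF h(1)])
  moreover have "bij_betw (iso_verts h) (verts C) (verts H)" using inj by (simp add: bij_betw_def h(2))
  ultimately show ?thesis using that by blast
qed

context graph
begin

lemma scc_adjacent_iff:
  assumes "C \<in> sccs"
  shows "u \<rightarrow>\<^bsub>C\<^esub> v \<longleftrightarrow> u \<rightarrow>\<^bsub>G\<^esub> v \<and> u \<in> verts C \<and> v \<in> verts C"
proof -
  have C: "induced_subgraph C G" using assms by (rule in_sccs_imp_induced)
  then have "tail C = tail G" "head C = head G" "arcs C = {e \<in> arcs G. tail G e \<in> verts C \<and> head G e \<in> verts C}"
    by (auto simp: induced_subgraph_def subgraph_def compatible_def)
  then show ?thesis by (auto simp: arcs_ends_conv)
qed

lemma scc_verts_subset: "C \<in> sccs \<Longrightarrow> verts C \<subseteq> verts G"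
  using in_sccs_imp_induced by (metis induced_imp_subgraph subgraph_imp_subverts)

lemma scc_closed:
  assumes "C \<in> sccs" "u \<in> verts C" "u \<rightarrow>\<^bsub>G\<^esub> v"
  shows "v \<in> verts C"
proof (rule ccontr)
  assume "v \<notin> verts C"
  moreover have "verts C \<in> sccs_verts" using assms(1) by (intro in_sccs_vertsI_sccs) simp
  moreover have "u \<rightarrow>\<^sup>* v" using assms(3) by (rule reachable_adjI)
  moreover from this have "v \<rightarrow>\<^sup>* u" by (rule symmetric_reachable')
  ultimately show False using assms(2) unfolding in_sccs_verts_conv_reachable by blast
qed

lemma scc_eqI:
  assumes C: "C \<in> sccs" and S: "S \<subseteq> verts C" "S \<noteq> {}"
    and closed: "\<And>u v. u \<in> S \<Longrightarrow> u \<rightarrow>\<^bsub>G\<^esub> v \<Longrightarrow> v \<in> S"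
  shows "S = verts C"
proof (intro equalityI subsetI)
  fix v assume v: "v \<in> verts C"
  obtain u where u: "u \<in> S" using S(2) by blast
  interpret C: wf_digraph C using C in_sccs_imp_induced by (intro wf_digraphI_induced)
  have "u \<rightarrow>\<^sup>*\<^bsub>C\<^esub> v" using C u v S(1) by (auto simp: sccs_def strongly_connected_def)
  then show "v \<in> S"
    by (induction rule: C.reachable_induct) (use u closed scc_adjacent_iff[OF C] in auto)
qed (use S in blast)

lemma verts_eq_Union_sccs: "verts G = (\<Union>C\<in>sccs. verts C)"
proof (intro equalityI subsetI)
  fix u assume u: "u \<in> verts G"
  then have "(G \<restriction> {v. u \<rightarrow>\<^sup>* v}) \<in> sccs" by (rule induce_reachable_is_in_sccs)
  moreover have "u \<in> verts (G \<restriction> {v. u \<rightarrow>\<^sup>* v})" using u by simp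
  ultimately show "u \<in> (\<Union>C\<in>sccs. verts C)" by (rule UN_I)
qed (use scc_verts_subset in blast)

lemma scc_wf_nomulti: "C \<in> sccs \<Longrightarrow> wf_digraph C \<and> nomulti_digraph C"
proof
  assume "C \<in> sccs"
  then have C: "induced_subgraph C G" by (rule in_sccs_imp_induced)
  then show "wf_digraph C" by (rule wf_digraphI_induced)
  have "tail C = tail G" "head C = head G"
      "arcs C = {e \<in> arcs G. tail G e \<in> verts C \<and> head G e \<in> verts C}"
    using C by (auto simp: induced_subgraph_def subgraph_def compatible_def)
  then show "nomulti_digraph C"
    using no_multi_arcs by unfold_locales (auto simp: arc_to_ends_def)
qed


lemma adj_sym: "u \<rightarrow>\<^bsub>G\<^esub> v \<Longrightarrow> v \<rightarrow>\<^bsub>G\<^esub> u"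
  using arcs_ends_symmetric[OF sym_arcs] .

text \<open>
  An integral vector on one side \<open>P\<close>, extended by 0, has energy only at the vertices of the other side \<open>L\<close>.
\<close>

lemma energy_one_side:
  fixes x :: "'a \<Rightarrow> int"
  assumes PL: "P \<subseteq> verts G" "L \<subseteq> verts G" and nbr: "\<And>p w. p \<in> P \<Longrightarrow> p \<rightarrow>\<^bsub>G\<^esub> w \<Longrightarrow> w \<in> L"
  defines "x' \<equiv> \<lambda>v. if v \<in> P then real_of_int (x v) else 0"
  shows "energy (verts G) (\<lambda>u w. u \<rightarrow>\<^bsub>G\<^esub> w) x' = real_of_int (\<Sum>l\<in>L. (\<Sum>p | p \<in> P \<and> l \<in> L \<and> p \<rightarrow>\<^bsub>G\<^esub> l. x p)\<^sup>2)"
    and "norm2 (verts G) x' = real_of_int (\<Sum>p\<in>P. (x p)\<^sup>2)"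
proof -
  have inner: "(\<Sum>w | w \<in> verts G \<and> u \<rightarrow>\<^bsub>G\<^esub> w. x' w) = real_of_int (\<Sum>p | p \<in> P \<and> u \<in> L \<and> p \<rightarrow>\<^bsub>G\<^esub> u. x p)" for u
  proof -
    have "(\<Sum>w | w \<in> verts G \<and> u \<rightarrow>\<^bsub>G\<^esub> w. x' w) = (\<Sum>p | p \<in> P \<and> u \<in> L \<and> p \<rightarrow>\<^bsub>G\<^esub> u. real_of_int (x p))"
      using PL nbr adj_sym by (intro sum.mono_neutral_cong_right) (auto simp: x'_def)
    then show ?thesis by simp
  qed
  have "energy (verts G) (\<lambda>u w. u \<rightarrow>\<^bsub>G\<^esub> w) x' = (\<Sum>u\<in>verts G. real_of_int ((\<Sum>p | p \<in> P \<and> u \<in> L \<and> p \<rightarrow>\<^bsub>G\<^esub> u. x p)\<^sup>2))"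
    by (simp add: energy_def inner)
  also have "\<dots> = (\<Sum>l\<in>L. real_of_int ((\<Sum>p | p \<in> P \<and> l \<in> L \<and> p \<rightarrow>\<^bsub>G\<^esub> l. x p)\<^sup>2))"
    using PL by (intro sum.mono_neutral_right) auto
  finally show "energy (verts G) (\<lambda>u w. u \<rightarrow>\<^bsub>G\<^esub> w) x' = real_of_int (\<Sum>l\<in>L. (\<Sum>p | p \<in> P \<and> l \<in> L \<and> p \<rightarrow>\<^bsub>G\<^esub> l. x p)\<^sup>2)"
    by simp
  have "norm2 (verts G) x' = (\<Sum>p\<in>P. (real_of_int (x p))\<^sup>2)"
    unfolding norm2_def using PL by (intro sum.mono_neutral_cong_right) (auto simp: x'_def)
  then show "norm2 (verts G) x' = real_of_int (\<Sum>p\<in>P. (x p)\<^sup>2)" by simp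
qed

text \<open>
  If no such vector exists, the two sides of the component satisfy the assumptions of the locale \<open>connected_incidence\<close>, so
  they form a Fano plane, and its coordinates give an isomorphism onto the Heawood graph.
\<close>

theorem contracting_vector_of_component:
  assumes bip: "bipartite G" and sub: "subcubic G" and C: "C \<in> sccs"
    and not_iso: "\<not> digraph_iso C (with_proj heawood_graph)"
  shows "\<exists>x. (\<exists>v\<in>verts G. x v \<noteq> 0) \<and> energy (verts G) (\<lambda>u w. u \<rightarrow>\<^bsub>G\<^esub> w) x \<le> norm2 (verts G) x"
proof (rule ccontr)
  assume none: "\<not> ?thesis"
  have expanding: "\<not> energy (verts G) (\<lambda>u w. u \<rightarrow>\<^bsub>G\<^esub> w) x \<le> norm2 (verts G) x"
    if "v \<in> verts G" "x v \<noteq> 0" for v and x :: "'a \<Rightarrow> real"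
  proof
    assume "energy (verts G) (\<lambda>u w. u \<rightarrow>\<^bsub>G\<^esub> w) x \<le> norm2 (verts G) x"
    with that have "\<exists>x. (\<exists>v\<in>verts G. x v \<noteq> 0) \<and> energy (verts G) (\<lambda>u w. u \<rightarrow>\<^bsub>G\<^esub> w) x \<le> norm2 (verts G) x"
      by (intro exI[of _ x]) auto
    then show False using none by (rule notE[rotated])
  qed
  obtain X Y where XY: "verts G = X \<union> Y" "X \<inter> Y = {}"
      "\<forall>e\<in>arcs G. (tail G e \<in> X \<and> head G e \<in> Y) \<or> (tail G e \<in> Y \<and> head G e \<in> X)"
    using bip unfolding bipartite_def by (elim exE conjE)
  have adj_XY: "(u \<in> X \<and> v \<in> Y) \<or> (u \<in> Y \<and> v \<in> X)" if "u \<rightarrow>\<^bsub>G\<^esub> v" for u v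
    using that XY(3) by (auto simp: arcs_ends_conv)
  define P where "P = verts C \<inter> X"
  define L where "L = verts C \<inter> Y"
  define I where "I p l \<longleftrightarrow> p \<in> P \<and> l \<in> L \<and> p \<rightarrow>\<^bsub>G\<^esub> l" for p l
  have PL: "P \<subseteq> verts G" "L \<subseteq> verts G" "P \<inter> L = {}" "verts C = P \<union> L"
    using scc_verts_subset[OF C] XY(1,2) by (auto simp: P_def L_def)
  have nbr: "w \<in> L" if "p \<in> P" "p \<rightarrow>\<^bsub>G\<^esub> w" for p w
    using scc_closed[OF C, of p w] that adj_XY[of p w] XY(2) by (auto simp: P_def L_def)
  have nbr': "w \<in> P" if "l \<in> L" "l \<rightarrow>\<^bsub>G\<^esub> w" for l w
    using scc_closed[OF C, of l w] that adj_XY[of l w] XY(2) by (auto simp: P_def L_def)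
  have deg: "card {w. v \<rightarrow>\<^bsub>G\<^esub> w} \<le> 3" if "v \<in> verts G" for v
  proof -
    have "{w. v \<rightarrow>\<^bsub>G\<^esub> w} = head G ` out_arcs G v" by (auto simp: arcs_ends_conv)
    moreover have "finite (out_arcs G v)" using finite_arcs by (auto simp: out_arcs_def)
    ultimately have "card {w. v \<rightarrow>\<^bsub>G\<^esub> w} \<le> out_degree G v"
      by (simp add: out_degree_def card_image_le)
    then show ?thesis using sub that unfolding subcubic_def by force
  qed
  have fin_nbr: "finite {w. v \<rightarrow>\<^bsub>G\<^esub> w}" for v
    by (rule finite_subset[OF _ finite_verts]) (use adj_in_verts in auto)
  interpret connected_incidence P L I
  proof
    show "finite P" "finite L" using PL finite_verts by (auto intro: finite_subset)
    show "p \<in> P \<and> l \<in> L" if "I p l" for p l using that by (simp add: I_def)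
    show "card {l. I p l} \<le> 3" if "p \<in> P" for p
      using deg[of p] fin_nbr[of p] card_mono[of "{w. p \<rightarrow>\<^bsub>G\<^esub> w}" "{l. I p l}"] that PL by (force simp: I_def)
    show "card {p. I p l} \<le> 3" if "l \<in> L" for l
      using deg[of l] fin_nbr[of l] card_mono[of "{w. l \<rightarrow>\<^bsub>G\<^esub> w}" "{p. I p l}"] that PL adj_sym
      by (force simp: I_def)
    show "(\<Sum>p\<in>P. (x p)\<^sup>2) < (\<Sum>l\<in>L. (\<Sum>p | I p l. x p)\<^sup>2)" if "p \<in> P" "x p \<noteq> 0" for p and x :: "'a \<Rightarrow> int"
    proof (rule ccontr)
      let ?x = "\<lambda>v. if v \<in> P then real_of_int (x v) else 0"
      assume "\<not> ?thesis"
      then have "(\<Sum>l\<in>L. (\<Sum>p | p \<in> P \<and> l \<in> L \<and> p \<rightarrow>\<^bsub>G\<^esub> l. x p)\<^sup>2) \<le> (\<Sum>p\<in>P. (x p)\<^sup>2)"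
        by (simp add: I_def not_less)
      then have "energy (verts G) (\<lambda>u w. u \<rightarrow>\<^bsub>G\<^esub> w) ?x \<le> norm2 (verts G) ?x"
        using energy_one_side[where x = x, OF PL(1,2) nbr] by (simp only: of_int_le_iff)
      moreover have "p \<in> verts G" "?x p \<noteq> 0" using that PL(1) by auto
      ultimately show False using expanding[of p ?x] by (simp only: simp_thms)
    qed
    show "(\<Sum>l\<in>L. (y l)\<^sup>2) < (\<Sum>p\<in>P. (\<Sum>l | I p l. y l)\<^sup>2)" if "l \<in> L" "y l \<noteq> 0" for l and y :: "'a \<Rightarrow> int"
    proof (rule ccontr)
      let ?y = "\<lambda>v. if v \<in> L then real_of_int (y v) else 0"
      assume "\<not> ?thesis"
      moreover have "{l. I p l} = {l. l \<in> L \<and> p \<in> P \<and> l \<rightarrow>\<^bsub>G\<^esub> p}" for p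
        using adj_sym by (auto simp: I_def)
      ultimately have "(\<Sum>p\<in>P. (\<Sum>l | l \<in> L \<and> p \<in> P \<and> l \<rightarrow>\<^bsub>G\<^esub> p. y l)\<^sup>2) \<le> (\<Sum>l\<in>L. (y l)\<^sup>2)"
        by (simp add: not_less)
      then have "energy (verts G) (\<lambda>u w. u \<rightarrow>\<^bsub>G\<^esub> w) ?y \<le> norm2 (verts G) ?y"
        using energy_one_side[where x = y, OF PL(2,1) nbr'] by (simp only: of_int_le_iff)
      moreover have "l \<in> verts G" "?y l \<noteq> 0" using that PL(2) by auto
      ultimately show False using expanding[of l ?y] by (simp only: simp_thms)
    qed
    show "S = P" if S: "S \<subseteq> P" "S \<noteq> {}" and closed: "\<And>p q l. p \<in> S \<Longrightarrow> I p l \<Longrightarrow> I q l \<Longrightarrow> q \<in> S" for S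
    proof -
      let ?U = "S \<union> {l. \<exists>p\<in>S. I p l}"
      have "?U = verts C"
      proof (rule scc_eqI[OF C])
        show "?U \<subseteq> verts C" using S PL by (auto simp: I_def)
        fix u v assume u: "u \<in> ?U" and uv: "u \<rightarrow>\<^bsub>G\<^esub> v"
        show "v \<in> ?U"
        proof (cases "u \<in> S")
          case True
          then have "I u v" using S uv nbr by (auto simp: I_def)
          then show ?thesis using True by blast
        next
          case False
          then obtain p where p: "p \<in> S" "I p u" using u by blast
          then have "I v u" using nbr'[of u v] uv adj_sym by (auto simp: I_def)
          then show ?thesis using closed p by blast
        qed
      qed (use S in blast)
      then show ?thesis using PL S by (auto simp: I_def)
    qed
  qed
  have "verts C \<noteq> {}" using C by (auto simp: sccs_def strongly_connected_def)
  then have "P \<noteq> {}" using no_lines_if_no_points PL(4) by blast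
  then obtain f where f: "bij_betw f fano_points P" "\<And>A. A \<in> fano_lines \<Longrightarrow> \<exists>l\<in>L. {p. I p l} = f ` A"
    using fano_coordinates by blast
  define g where "g l = {i \<in> fano_points. I (f i) l}" for l
  have inj_f: "inj_on f fano_points" and f_img: "f ` fano_points = P" using f(1) by (auto simp: bij_betw_def)
  have fg: "f ` g l = {p. I p l}" for l
    using f_img incident_in by (auto simp: g_def)
  have g_A: "g l = A" if "A \<in> fano_lines" "{p. I p l} = f ` A" for l A
  proof -
    have "f ` g l = f ` A" using fg that(2) by simp
    moreover have "A \<subseteq> fano_points" "g l \<subseteq> fano_points" using fano_plane(3)[OF that(1)] by (auto simp: g_def)
    ultimately show ?thesis using inj_f by (simp add: inj_on_image_eq_iff)
  qed
  have line_eq: "l = m" if l: "l \<in> L" and eq: "{p. I p l} = {p. I p m}" for l m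
  proof -
    obtain p q where "p \<noteq> q" "p \<in> {p. I p l}" "q \<in> {p. I p l}"
      using card_points_of_line[OF l] by (auto simp: card_3_iff)
    moreover from this have "p \<in> {p. I p m}" "q \<in> {p. I p m}" using eq by simp_all
    ultimately show ?thesis using line_unique by blast
  qed
  have "bij_betw g L fano_lines"
    unfolding bij_betw_def
  proof
    show "inj_on g L" using fg line_eq by (metis inj_onI)
    show "g ` L = fano_lines"
    proof (intro equalityI subsetI)
      fix A assume "A \<in> g ` L"
      then obtain l where l: "l \<in> L" "A = g l" by blast
      obtain p q where pq: "p \<noteq> q" "I p l" "I q l"
        using card_points_of_line[OF l(1)] by (auto simp: card_3_iff)
      then obtain i j where ij: "i \<in> fano_points" "j \<in> fano_points" "p = f i" "q = f j"
        using f_img incident_in by (metis imageE)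
      then obtain A' where A': "A' \<in> fano_lines" "i \<in> A'" "j \<in> A'"
        using fano_plane(4)[of i j] pq(1) by blast
      then obtain m where m: "{p. I p m} = f ` A'" using f(2) by blast
      then have "I p m" "I q m" using A' ij by blast+
      then have "m = l" using line_unique pq by blast
      then show "A \<in> fano_lines" using g_A[OF A'(1) m] A'(1) l(2) by simp
    next
      fix A assume A: "A \<in> fano_lines"
      then obtain l where "l \<in> L" "{p. I p l} = f ` A" using f(2) by blast
      then show "A \<in> g ` L" using g_A[OF A] by blast
    qed
  qed
  define k where "k = the_inv_into fano_points f"
  have k: "bij_betw k P fano_points" unfolding k_def using f(1) by (rule bij_betw_the_inv_into)
  have fk: "f (k p) = p" if "p \<in> P" for p
    unfolding k_def using that inj_f f_img by (intro f_the_inv_into_f) auto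
  define \<phi> where "\<phi> v = (if v \<in> P then Inl (k v) else Inr (g v))" for v
  have "bij_betw \<phi> (P \<union> L) (Inl ` fano_points \<union> Inr ` fano_lines)"
  proof (rule bij_betw_combine)
    have "bij_betw (Inl \<circ> k) P (Inl ` fano_points)"
      using k by (rule bij_betw_trans) (simp add: bij_betw_def)
    then show "bij_betw \<phi> P (Inl ` fano_points)"
      by (rule bij_betw_cong[THEN iffD1, rotated]) (simp add: \<phi>_def)
    have "bij_betw (Inr \<circ> g) L (Inr ` fano_lines)"
      using \<open>bij_betw g L fano_lines\<close> by (rule bij_betw_trans) (simp add: bij_betw_def)
    then show "bij_betw \<phi> L (Inr ` fano_lines)"
      by (rule bij_betw_cong[THEN iffD1, rotated]) (use PL(3) in \<open>auto simp: \<phi>_def\<close>)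
  qed auto
  then have "bij_betw \<phi> (verts C) (pverts heawood_graph)"
    by (simp add: PL(4) heawood_graph_def Plus_def)
  moreover have "u \<rightarrow>\<^bsub>C\<^esub> v \<longleftrightarrow> (\<phi> u, \<phi> v) \<in> parcs heawood_graph" if uv: "u \<in> verts C" "v \<in> verts C" for u v
  proof -
    have adj: "u \<rightarrow>\<^bsub>C\<^esub> v \<longleftrightarrow> I u v \<or> I v u"
    proof
      assume "u \<rightarrow>\<^bsub>C\<^esub> v"
      then have G: "u \<rightarrow>\<^bsub>G\<^esub> v" using scc_adjacent_iff[OF C] by blast
      from uv(1) consider "u \<in> P" | "u \<in> L" using PL(4) by blast
      then show "I u v \<or> I v u"
      proof cases
        case 1
        then show ?thesis using nbr[OF _ G] G by (simp add: I_def)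
      next
        case 2
        then show ?thesis using nbr'[OF _ G] adj_sym[OF G] by (simp add: I_def)
      qed
    next
      assume "I u v \<or> I v u"
      then have "u \<rightarrow>\<^bsub>G\<^esub> v" using adj_sym unfolding I_def by blast
      then show "u \<rightarrow>\<^bsub>C\<^esub> v" using scc_adjacent_iff[OF C] uv by blast
    qed
    have PLc: "(\<phi> p, \<phi> l) \<in> parcs heawood_graph \<longleftrightarrow> I p l" "(\<phi> l, \<phi> p) \<in> parcs heawood_graph \<longleftrightarrow> I p l"
      if "p \<in> P" "l \<in> L" for p l
    proof -
      have "k p \<in> fano_points" "g l \<in> fano_lines"
        using k \<open>bij_betw g L fano_lines\<close> that by (auto simp: bij_betw_def)
      moreover have "k p \<in> g l \<longleftrightarrow> I p l" using fk[OF that(1)] \<open>k p \<in> fano_points\<close> by (simp add: g_def)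
      moreover have "l \<notin> P" using that PL(3) by blast
      ultimately show "(\<phi> p, \<phi> l) \<in> parcs heawood_graph \<longleftrightarrow> I p l" "(\<phi> l, \<phi> p) \<in> parcs heawood_graph \<longleftrightarrow> I p l"
        using that(1) by (auto simp: \<phi>_def heawood_graph_def)
    qed
    have "(\<phi> u, \<phi> v) \<notin> parcs heawood_graph" if "(u \<in> P \<and> v \<in> P) \<or> (u \<in> L \<and> v \<in> L)"
      using that PL(3) by (auto simp: \<phi>_def heawood_graph_def)
    moreover have "\<not> (I u v \<or> I v u)" if "(u \<in> P \<and> v \<in> P) \<or> (u \<in> L \<and> v \<in> L)"
      using that PL(3) by (auto simp: I_def)
    ultimately show ?thesis
      using adj PLc[of u v] PLc[of v u] uv PL(3,4) by (auto simp: I_def)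
  qed
  moreover have "parcs heawood_graph \<subseteq> pverts heawood_graph \<times> pverts heawood_graph"
    by (auto simp: heawood_graph_def)
  ultimately have "digraph_iso C (with_proj heawood_graph)"
    using scc_wf_nomulti[OF C] by (intro digraph_iso_with_projI) auto
  then show False using not_iso by blast
qed

end

section \<open>The Heawood graph and the main result\<close>

lemma energy_bij_betw:
  assumes bij: "bij_betw \<phi> V W"
    and adj: "\<And>u v. u \<in> V \<Longrightarrow> v \<in> V \<Longrightarrow> R u v \<longleftrightarrow> Q (\<phi> u) (\<phi> v)"
  shows "energy V R (\<lambda>v. x (\<phi> v)) = energy W Q x" and "norm2 V (\<lambda>v. x (\<phi> v)) = norm2 W x"
proof -
  have inner: "(\<Sum>w | w \<in> V \<and> R u w. x (\<phi> w)) = (\<Sum>w | w \<in> W \<and> Q (\<phi> u) w. x w)" if "u \<in> V" for u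
  proof (rule sum.reindex_bij_betw)
    show "bij_betw \<phi> {w. w \<in> V \<and> R u w} {w. w \<in> W \<and> Q (\<phi> u) w}"
      using bij adj that by (auto simp: bij_betw_def inj_on_def)
  qed
  show "energy V R (\<lambda>v. x (\<phi> v)) = energy W Q x"
    unfolding energy_def
    using sum.reindex_bij_betw[OF bij, of "\<lambda>u. (\<Sum>w | w \<in> W \<and> Q u w. x w)\<^sup>2"] by (simp add: inner)
  show "norm2 V (\<lambda>v. x (\<phi> v)) = norm2 W x"
    unfolding norm2_def by (rule sum.reindex_bij_betw[OF bij])
qed

text \<open>
  Three lines through every point and one through every pair: the matrix \<open>N\<close> of the incidences satisfies
  \<open>N\<^sup>T N = 2 I + J\<close>, where \<open>J\<close> is the all-ones matrix.
\<close>

lemma sum_of_squares_plane_of_order_2: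
  fixes x :: "'p \<Rightarrow> real" and I :: "'p \<Rightarrow> 'l \<Rightarrow> bool"
  assumes fin: "finite P" "finite L" and inc: "\<And>p l. I p l \<Longrightarrow> p \<in> P \<and> l \<in> L"
    and card: "\<And>p q. p \<in> P \<Longrightarrow> q \<in> P \<Longrightarrow> card {l. I p l \<and> I q l} = (if p = q then 3 else 1)"
  shows "(\<Sum>l\<in>L. (\<Sum>p | I p l. x p)\<^sup>2) = 2 * (\<Sum>p\<in>P. (x p)\<^sup>2) + (\<Sum>p\<in>P. x p)\<^sup>2"
proof -
  have "(\<Sum>l\<in>L. (\<Sum>p | I p l. x p)\<^sup>2) = (\<Sum>p\<in>P. \<Sum>q\<in>P. of_nat (card {l. I p l \<and> I q l}) * x p * x q)"
    using fin inc by (rule sum_of_squares_incidence)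
  also have "\<dots> = (\<Sum>p\<in>P. \<Sum>q\<in>P. (if p = q then 2 * (x p * x q) else 0) + x p * x q)"
    by (intro sum.cong refl) (simp add: card)
  also have "\<dots> = 2 * (\<Sum>p\<in>P. (x p)\<^sup>2) + (\<Sum>p\<in>P. x p)\<^sup>2"
  proof -
    have "(\<Sum>p\<in>P. \<Sum>q\<in>P. x p * x q) = (\<Sum>p\<in>P. x p)\<^sup>2"
      by (simp only: power2_eq_square sum_product)
    then show ?thesis using fin by (simp add: sum.distrib sum_distrib_left power2_eq_square)
  qed
  finally show ?thesis .
qed

lemma card_fano_lines_of_points:
  assumes "p \<in> fano_points" "q \<in> fano_points"
  shows "card {L. L \<in> fano_lines \<and> p \<in> L \<and> q \<in> L} = (if p = q then 3 else 1)"
proof (cases "p = q")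
  case True
  have pts: "fano_points = {0, 1, 2, 3, 4, 5, 6}" unfolding fano_points_def by auto
  have "\<forall>p\<in>fano_points. card (Set.filter (\<lambda>L. p \<in> L) fano_lines) = 3"
    unfolding fano_lines_eq pts by code_simp
  moreover have "{L. L \<in> fano_lines \<and> p \<in> L \<and> q \<in> L} = Set.filter (\<lambda>L. p \<in> L) fano_lines"
    using True by auto
  ultimately show ?thesis using True assms(1) by simp
next
  case False
  then obtain L where "L \<in> fano_lines \<and> p \<in> L \<and> q \<in> L" "\<And>M. M \<in> fano_lines \<and> p \<in> M \<and> q \<in> M \<Longrightarrow> M = L"
    using fano_plane(4)[OF assms] by blast
  then have "{L. L \<in> fano_lines \<and> p \<in> L \<and> q \<in> L} = {L}" by blast
  then show ?thesis using False by simp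
qed

lemma card_fano_points_of_lines:
  assumes "L \<in> fano_lines" "M \<in> fano_lines"
  shows "card {p. p \<in> L \<and> p \<in> M} = (if L = M then 3 else 1)"
proof (cases "L = M")
  case True
  then show ?thesis using fano_plane(3)[OF assms(1)] by simp
next
  case False
  then obtain p where "p \<in> L \<and> p \<in> M" "\<And>q. q \<in> L \<and> q \<in> M \<Longrightarrow> q = p"
    using fano_plane(5)[OF assms] by blast
  then have "{p. p \<in> L \<and> p \<in> M} = {p}" by blast
  then show ?thesis using False by simp
qed

text \<open>
  Both the Fano plane and its dual have one line through any two points, which gives the two square terms.
\<close>

lemma heawood_energy:
  defines "H \<equiv> with_proj heawood_graph"
  shows "energy (verts H) (\<lambda>u w. u \<rightarrow>\<^bsub>H\<^esub> w) x =
    2 * norm2 (verts H) x + (\<Sum>p\<in>fano_points. x (Inl p))\<^sup>2 + (\<Sum>A\<in>fano_lines. x (Inr A))\<^sup>2"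
proof -
  have fin: "finite fano_points" "finite fano_lines" by (simp_all add: fano_points_def fano_lines_def)
  have split: "(\<Sum>u\<in>verts H. F u) = (\<Sum>p\<in>fano_points. F (Inl p)) + (\<Sum>A\<in>fano_lines. F (Inr A))" for F :: "_ \<Rightarrow> real"
    using fin by (simp add: H_def heawood_graph_def sum.Plus)
  have in_p: "(\<Sum>w | w \<in> verts H \<and> Inl p \<rightarrow>\<^bsub>H\<^esub> w. x w) =
      (\<Sum>A | A \<in> fano_lines \<and> p \<in> fano_points \<and> p \<in> A. x (Inr A))" if "p \<in> fano_points" for p
  proof -
    have "{w. w \<in> verts H \<and> Inl p \<rightarrow>\<^bsub>H\<^esub> w} = Inr ` {A. A \<in> fano_lines \<and> p \<in> fano_points \<and> p \<in> A}"
      using that by (auto simp: H_def heawood_graph_def)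
    then show ?thesis by (simp add: sum.reindex)
  qed
  have in_A: "(\<Sum>w | w \<in> verts H \<and> Inr A \<rightarrow>\<^bsub>H\<^esub> w. x w) =
      (\<Sum>p | p \<in> fano_points \<and> A \<in> fano_lines \<and> p \<in> A. x (Inl p))" if "A \<in> fano_lines" for A
  proof -
    have "{w. w \<in> verts H \<and> Inr A \<rightarrow>\<^bsub>H\<^esub> w} = Inl ` {p. p \<in> fano_points \<and> A \<in> fano_lines \<and> p \<in> A}"
      using that by (auto simp: H_def heawood_graph_def)
    then show ?thesis by (simp add: sum.reindex)
  qed
  have "energy (verts H) (\<lambda>u w. u \<rightarrow>\<^bsub>H\<^esub> w) x =
      (\<Sum>p\<in>fano_points. (\<Sum>A | A \<in> fano_lines \<and> p \<in> fano_points \<and> p \<in> A. x (Inr A))\<^sup>2) +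
      (\<Sum>A\<in>fano_lines. (\<Sum>p | p \<in> fano_points \<and> A \<in> fano_lines \<and> p \<in> A. x (Inl p))\<^sup>2)"
    by (simp add: energy_def split in_p in_A cong: conj_cong)
  also have "(\<Sum>p\<in>fano_points. (\<Sum>A | A \<in> fano_lines \<and> p \<in> fano_points \<and> p \<in> A. x (Inr A))\<^sup>2) =
      2 * (\<Sum>A\<in>fano_lines. (x (Inr A))\<^sup>2) + (\<Sum>A\<in>fano_lines. x (Inr A))\<^sup>2"
  proof (rule sum_of_squares_plane_of_order_2)
    fix A B assume AB: "A \<in> fano_lines" "B \<in> fano_lines"
    have "{p. (A \<in> fano_lines \<and> p \<in> fano_points \<and> p \<in> A) \<and> (B \<in> fano_lines \<and> p \<in> fano_points \<and> p \<in> B)} = {p. p \<in> A \<and> p \<in> B}"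
      using AB fano_plane(3) by blast
    then show "card {p. (A \<in> fano_lines \<and> p \<in> fano_points \<and> p \<in> A) \<and> (B \<in> fano_lines \<and> p \<in> fano_points \<and> p \<in> B)} = (if A = B then 3 else 1)"
      using card_fano_points_of_lines[OF AB] by simp
  qed (use fin in auto)
  also have "(\<Sum>A\<in>fano_lines. (\<Sum>p | p \<in> fano_points \<and> A \<in> fano_lines \<and> p \<in> A. x (Inl p))\<^sup>2) =
      2 * (\<Sum>p\<in>fano_points. (x (Inl p))\<^sup>2) + (\<Sum>p\<in>fano_points. x (Inl p))\<^sup>2"
  proof (rule sum_of_squares_plane_of_order_2)
    fix p q assume pq: "p \<in> fano_points" "q \<in> fano_points"
    then have "{A. (p \<in> fano_points \<and> A \<in> fano_lines \<and> p \<in> A) \<and> (q \<in> fano_points \<and> A \<in> fano_lines \<and> q \<in> A)} =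
        {A. A \<in> fano_lines \<and> p \<in> A \<and> q \<in> A}" by blast
    then show "card {A. (p \<in> fano_points \<and> A \<in> fano_lines \<and> p \<in> A) \<and> (q \<in> fano_points \<and> A \<in> fano_lines \<and> q \<in> A)} = (if p = q then 3 else 1)"
      using card_fano_lines_of_points[OF pq] by simp
  qed (use fin in auto)
  finally show ?thesis by (simp add: norm2_def split)
qed


lemma energy_with_eigenvector:
  assumes "\<And>u. u \<in> V \<Longrightarrow> (\<Sum>w | w \<in> V \<and> R u w. y w) = c * y u"
  shows "energy V R y = c\<^sup>2 * norm2 V y"
  by (simp add: energy_def norm2_def assms power_mult_distrib sum_distrib_left)

lemma norm2_pos: "finite V \<Longrightarrow> v \<in> V \<Longrightarrow> y v \<noteq> 0 \<Longrightarrow> 0 < norm2 V y"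
  unfolding norm2_def by (intro sum_pos2[of _ v]) auto

lemma heawood_component_energy:
  assumes "digraph_iso C (with_proj heawood_graph)"
  shows "2 * norm2 (verts C) x \<le> energy (verts C) (\<lambda>u w. u \<rightarrow>\<^bsub>C\<^esub> w) x"
    and "\<exists>x. (\<exists>v\<in>verts C. x v \<noteq> 0) \<and> energy (verts C) (\<lambda>u w. u \<rightarrow>\<^bsub>C\<^esub> w) x = 2 * norm2 (verts C) x"
proof -
  let ?H = "with_proj heawood_graph"
  obtain \<phi> where \<phi>: "bij_betw \<phi> (verts C) (verts ?H)"
    "\<And>u v. u \<in> verts C \<Longrightarrow> v \<in> verts C \<Longrightarrow> u \<rightarrow>\<^bsub>C\<^esub> v \<longleftrightarrow> \<phi> u \<rightarrow>\<^bsub>?H\<^esub> \<phi> v"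
    using digraph_iso_vertex_bijection[OF assms] by blast
  note transfer = energy_bij_betw[OF \<phi>(1), where R = "\<lambda>u w. u \<rightarrow>\<^bsub>C\<^esub> w" and Q = "\<lambda>u w. u \<rightarrow>\<^bsub>?H\<^esub> w", OF \<phi>(2)]
  define \<psi> where "\<psi> = the_inv_into (verts C) \<phi>"
  have \<psi>: "\<psi> (\<phi> v) = v" if "v \<in> verts C" for v
    using \<phi>(1) that by (simp add: \<psi>_def bij_betw_def the_inv_into_f_f)
  have "energy (verts C) (\<lambda>u w. u \<rightarrow>\<^bsub>C\<^esub> w) (\<lambda>v. x (\<psi> (\<phi> v))) = energy (verts C) (\<lambda>u w. u \<rightarrow>\<^bsub>C\<^esub> w) x"
    unfolding energy_def by (intro sum.cong refl arg_cong[of _ _ "\<lambda>t. t\<^sup>2"]) (auto simp: \<psi>)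
  moreover have "norm2 (verts C) (\<lambda>v. x (\<psi> (\<phi> v))) = norm2 (verts C) x"
    unfolding norm2_def by (intro sum.cong) (auto simp: \<psi>)
  ultimately show "2 * norm2 (verts C) x \<le> energy (verts C) (\<lambda>u w. u \<rightarrow>\<^bsub>C\<^esub> w) x"
    using transfer[of "\<lambda>h. x (\<psi> h)"] heawood_energy[of "\<lambda>h. x (\<psi> h)"] by simp
  \<comment> \<open>Any nonzero vector whose sums over the points and over the lines vanish would do.\<close>
  let ?x = "\<lambda>h :: nat + nat set. if h = Inl 0 then 1 else if h = Inl 1 then - 1 else 0 :: real"
  have pts: "fano_points = insert 0 (insert 1 {2..<7})" unfolding fano_points_def by auto
  have "(\<Sum>p\<in>fano_points. ?x (Inl p)) = 0" by (simp add: pts)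
  moreover have "(\<Sum>A\<in>fano_lines. ?x (Inr A)) = 0" by simp
  ultimately have "energy (verts ?H) (\<lambda>u w. u \<rightarrow>\<^bsub>?H\<^esub> w) ?x = 2 * norm2 (verts ?H) ?x"
    unfolding heawood_energy by simp
  then have "energy (verts C) (\<lambda>u w. u \<rightarrow>\<^bsub>C\<^esub> w) (\<lambda>v. ?x (\<phi> v)) = 2 * norm2 (verts C) (\<lambda>v. ?x (\<phi> v))"
    using transfer[of ?x] by simp
  moreover have "Inl 0 \<in> verts ?H" by (auto simp: heawood_graph_def fano_points_def)
  then obtain v where "v \<in> verts C" "\<phi> v = Inl 0" using \<phi>(1) by (metis bij_betw_iff_bijections)
  then have "\<exists>v\<in>verts C. ?x (\<phi> v) \<noteq> 0" by (intro bexI[of _ v]) simp_all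
  ultimately show "\<exists>x. (\<exists>v\<in>verts C. x v \<noteq> 0) \<and> energy (verts C) (\<lambda>u w. u \<rightarrow>\<^bsub>C\<^esub> w) x = 2 * norm2 (verts C) x"
    by (intro exI[of _ "\<lambda>v. ?x (\<phi> v)"]) blast
qed

context graph
begin

lemma finite_sccs: "finite sccs"
proof -
  have "verts ` sccs \<subseteq> Pow (verts G)" using scc_verts_subset by auto
  then have "finite (verts ` sccs)" by (rule finite_subset) (simp add: finite_verts)
  then show ?thesis using inj_on_verts_sccs by (rule finite_imageD)
qed

lemma sccs_disjoint: "C \<in> sccs \<Longrightarrow> D \<in> sccs \<Longrightarrow> C \<noteq> D \<Longrightarrow> verts C \<inter> verts D = {}"
  using sccs_verts_disjoint in_sccs_vertsI_sccs inj_on_verts_sccs by (metis imageI inj_onD)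

lemma sum_over_components: "(\<Sum>u\<in>verts G. F u) = (\<Sum>C\<in>sccs. \<Sum>u\<in>verts C. F u)" for F :: "'a \<Rightarrow> real"
  unfolding verts_eq_Union_sccs
proof (rule sum.UNION_disjoint)
  show "\<forall>C\<in>sccs. finite (verts C)" using scc_verts_subset finite_verts by (blast intro: finite_subset)
qed (use finite_sccs sccs_disjoint in auto)

lemma norm2_components: "norm2 (verts G) x = (\<Sum>C\<in>sccs. norm2 (verts C) x)"
  unfolding norm2_def by (rule sum_over_components)

lemma energy_components:
  "energy (verts G) (\<lambda>u w. u \<rightarrow>\<^bsub>G\<^esub> w) x = (\<Sum>C\<in>sccs. energy (verts C) (\<lambda>u w. u \<rightarrow>\<^bsub>C\<^esub> w) x)"
  unfolding energy_def sum_over_components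
proof (intro sum.cong refl)
  fix C u assume C: "C \<in> sccs" "u \<in> verts C"
  have "{w. w \<in> verts G \<and> u \<rightarrow>\<^bsub>G\<^esub> w} = {w. w \<in> verts C \<and> u \<rightarrow>\<^bsub>C\<^esub> w}"
    using C scc_adjacent_iff[OF C(1)] scc_closed[OF C] scc_verts_subset[OF C(1)] by blast
  then show "(\<Sum>w | w \<in> verts G \<and> u \<rightarrow>\<^bsub>G\<^esub> w. x w)\<^sup>2 = (\<Sum>w | w \<in> verts C \<and> u \<rightarrow>\<^bsub>C\<^esub> w. x w)\<^sup>2"
    by simp
qed

lemma lambda_h_le_if_contracting:
  assumes bip: "bipartite G" and x: "v \<in> verts G" "x v \<noteq> 0"
    and small: "energy (verts G) (\<lambda>u w. u \<rightarrow>\<^bsub>G\<^esub> w) x \<le> s\<^sup>2 * norm2 (verts G) x" and s: "0 \<le> s"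
  shows "lambda_h G \<le> s"
proof -
  obtain c y v' where y: "\<bar>c\<bar> \<le> s" "v' \<in> verts G" "y v' \<noteq> 0"
    "\<And>u. u \<in> verts G \<Longrightarrow> (\<Sum>w | w \<in> verts G \<and> u \<rightarrow>\<^bsub>G\<^esub> w. y w) = c * y u"
    by (rule small_eigenvalue_exists[OF finite_verts _ x small s]) (rule adj_sym, assumption, rule that)
  have "verts G \<noteq> {}" using x(1) by blast
  then have "lambda_h G \<le> \<bar>c\<bar>"
    by (rule bipartite_median_eigenvalue(4)[where y = y, OF graph_axioms _ bip y(2,3)]) (rule y(4))
  then show ?thesis using y(1) by linarith
qed

text \<open>
  The lower bound is applied to an eigenvector of \<open>lambda_h G\<close>, component by component; the upper bound needs a vector on one
  component only.
\<close>

lemma lambda_h_heawood: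
  assumes ne: "verts G \<noteq> {}" and bip: "bipartite G"
    and iso: "\<forall>C\<in>sccs. digraph_iso C (with_proj heawood_graph)"
  shows "lambda_h G = sqrt 2"
proof (rule antisym)
  obtain y v where y: "v \<in> verts G" "y v \<noteq> 0"
    "\<forall>u\<in>verts G. (\<Sum>w | w \<in> verts G \<and> u \<rightarrow>\<^bsub>G\<^esub> w. y w) = lambda_h G * y u"
    using bipartite_median_eigenvalue(3)[OF graph_axioms ne bip] by blast
  have "2 * norm2 (verts G) y \<le> energy (verts G) (\<lambda>u w. u \<rightarrow>\<^bsub>G\<^esub> w) y"
    unfolding norm2_components energy_components sum_distrib_left
    using iso heawood_component_energy(1) by (intro sum_mono) blast
  also have "\<dots> = (lambda_h G)\<^sup>2 * norm2 (verts G) y"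
    by (rule energy_with_eigenvector) (use y(3) in blast)
  finally have "2 \<le> (lambda_h G)\<^sup>2" using norm2_pos[of "verts G" v y] y by simp
  then show "sqrt 2 \<le> lambda_h G"
    using bipartite_median_eigenvalue(2)[OF graph_axioms ne bip] by (simp add: real_le_lsqrt)
  obtain C where C: "C \<in> sccs" using ne verts_eq_Union_sccs by blast
  then obtain x v where x: "v \<in> verts C" "x v \<noteq> 0"
      "energy (verts C) (\<lambda>u w. u \<rightarrow>\<^bsub>C\<^esub> w) x = 2 * norm2 (verts C) x"
    using iso heawood_component_energy(2) by metis
  let ?x = "\<lambda>u. if u \<in> verts C then x u else 0"
  have "energy (verts D) (\<lambda>u w. u \<rightarrow>\<^bsub>D\<^esub> w) ?x = (if D = C then 2 * norm2 (verts C) x else 0)"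
    "norm2 (verts D) ?x = (if D = C then norm2 (verts C) x else 0)" if "D \<in> sccs" for D
  proof -
    have eq: "?x u = (if D = C then x u else 0)" if "u \<in> verts D" for u
      using that sccs_disjoint[OF \<open>D \<in> sccs\<close> C] by auto
    have "energy (verts D) (\<lambda>u w. u \<rightarrow>\<^bsub>D\<^esub> w) ?x = energy (verts D) (\<lambda>u w. u \<rightarrow>\<^bsub>D\<^esub> w) (\<lambda>u. if D = C then x u else 0)"
      unfolding energy_def by (intro sum.cong refl arg_cong[of _ _ "\<lambda>t. t\<^sup>2"]) (use eq in blast)
    then show "energy (verts D) (\<lambda>u w. u \<rightarrow>\<^bsub>D\<^esub> w) ?x = (if D = C then 2 * norm2 (verts C) x else 0)"
      using x(3) by (simp add: energy_def)
    have "norm2 (verts D) ?x = norm2 (verts D) (\<lambda>u. if D = C then x u else 0)"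
      unfolding norm2_def by (intro sum.cong refl arg_cong[of _ _ "\<lambda>t. t\<^sup>2"]) (use eq in blast)
    then show "norm2 (verts D) ?x = (if D = C then norm2 (verts C) x else 0)"
      by (simp add: norm2_def)
  qed
  then have "energy (verts G) (\<lambda>u w. u \<rightarrow>\<^bsub>G\<^esub> w) ?x \<le> (sqrt 2)\<^sup>2 * norm2 (verts G) ?x"
    unfolding energy_components norm2_components using finite_sccs C by simp
  then show "lambda_h G \<le> sqrt 2"
    using x(1,2) scc_verts_subset[OF C] by (intro lambda_h_le_if_contracting[OF bip, of v ?x]) auto
qed

end

theorem theorem1p3:
  fixes G :: "('a, 'b) pre_digraph"
  assumes "graph G"
    and "verts G \<noteq> {}"
    and "bipartite G"
    and "subcubic G"
  shows "((\<forall>C\<in>pre_digraph.sccs G. digraph_iso C (with_proj heawood_graph)) \<longrightarrow>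
            HL_index G = sqrt 2 \<and> lambda_h G = sqrt 2 \<and> \<bar>lambda_l G\<bar> = sqrt 2) \<and>
         (\<not> (\<forall>C\<in>pre_digraph.sccs G. digraph_iso C (with_proj heawood_graph)) \<longrightarrow>
            lambda_h G \<in> {-1..1} \<and> lambda_l G \<in> {-1..1} \<and> HL_index G \<le> 1)"
proof -
  interpret graph G by fact
  note l = bipartite_median_eigenvalue(1)[OF assms(1-3)] and h0 = bipartite_median_eigenvalue(2)[OF assms(1-3)]
  show ?thesis
  proof (intro conjI impI)
    assume "\<forall>C\<in>sccs. digraph_iso C (with_proj heawood_graph)"
    then have h: "lambda_h G = sqrt 2" using lambda_h_heawood assms(2,3) by blast
    show "HL_index G = sqrt 2" "lambda_h G = sqrt 2" "\<bar>lambda_l G\<bar> = sqrt 2"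
      using h l by (simp_all add: HL_index_def)
  next
    assume "\<not> (\<forall>C\<in>sccs. digraph_iso C (with_proj heawood_graph))"
    then obtain x v where "v \<in> verts G" "x v \<noteq> 0" 
        "energy (verts G) (\<lambda>u w. u \<rightarrow>\<^bsub>G\<^esub> w) x \<le> norm2 (verts G) x"
      using contracting_vector_of_component[OF assms(3,4)] by metis
    then have h1: "lambda_h G \<le> 1" using lambda_h_le_if_contracting[OF assms(3), of v x 1] by simp
    show "lambda_h G \<in> {-1..1}" "lambda_l G \<in> {-1..1}" "HL_index G \<le> 1"
      using h0 h1 l by (simp_all add: HL_index_def)
  qed
qed

end
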